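(* Let $A$ and $M$ be compact smooth manifolds, possibly with boundary, let $\rho\colon A\to M$ be a smooth map, let $\Lambda$ be a proper subring of $\mathbb{R}$, and let $k\ge 1$. Let $\widehat{Z}^k(\rho)=\operatorname{Ker}(\Delta\colon\widehat{C}^k(\rho)\to\widehat{C}^{k+1}(\rho))$ and define $$\varphi\colon \widehat{Z}^k(\rho)\to \widehat{H}^k(\rho),\qquad \varphi((c,b),(h,e),(\omega,\theta))=\widetilde{(h,e)}|_{Z_{k-1}(\rho)},$$ where the tilde denotes reduction modulo $\Lambda$. Then $\varphi$ induces an isomorphism $$H_k(\widehat{C}^*(\rho))\cong \widehat{H}^k(\rho).$$
   Context: $C_kM$ denotes the group of smooth $k$-chains of $M$ and $\Omega^kM$ the group of smooth differential $k$-forms on $M$; similarly for $A$ (groups in negative degree are zero). Relative chains: $C_k(\rho)=C_kM\times C_{k-1}A$ with differential $\partial(\sigma,\tau)=(\partial\sigma+\rho_*\tau,-\partial\tau)$; its $k$-cycles are denoted $Z_k(\rho)$. Relative cochains: for an abelian group $G$, $C^k(\rho;G)=\operatorname{Hom}(C_k(\rho),G)$, with differential $\delta(h,e)=(\delta h,\rho^*h-\delta e)$. Relative forms: $\Omega^k(\rho)=\Omega^kM\times\Omega^{k-1}A$ with differential $\delta(\omega,\theta)=(d\omega,\rho^*\omega-d\theta)$. A pair $(\omega,\theta)\in\Omega^k(\rho)$ is regarded as a cochain by $(\omega,\theta)(\sigma,\tau)=\int_\sigma\omega+\int_\tau\theta$ for $(\sigma,\tau)\in C_k(\rho)$. Via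 integration followed by reduction modulo $\Lambda$, $\Omega^k(\rho)$ is viewed as a subgroup of $C^k(\rho;\mathbb{R}/\Lambda)$. $\Omega^k_\Lambda(\rho)\subset\Omega^k(\rho)$ is the subgroup of pairs with relative $\Lambda$-periods, i.e. pairs $(\omega,\theta)$ taking values in $\Lambda$ on $Z_k(\rho)$. Relative Cheeger-Simons differential characters of degree $k$: $$\widehat{H}^k(\rho)=\{f\in\operatorname{Hom}(Z_{k-1}(\rho),\mathbb{R}/\Lambda)\mid f\circ\partial\in\Omega^k(\rho)\}.$$ The complex: $\widehat{C}^k(\rho)=C^k(\rho;\Lambda)\times C^{k-1}(\rho;\mathbb{R})\times\Omega^k_\Lambda(\rho)$ with differential $$\Delta((c,b),(h,e),(\omega,\theta))=(\delta(c,b),\ (\omega,\theta)-(c,b)-\delta(h,e),\ 0).$$ $H_k(\widehat{C}^*(\rho))$ denotes $\operatorname{Ker}(\Delta\colon\widehat{C}^k(\rho)\to\widehat{C}^{k+1}(\rho))/\operatorname{Im}(\Delta\colon\widehat{C}^{k-1}(\rho)\to\widehat{C}^{k}(\rho))$.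
   Formalization: For k = 1 the manifold A is assumed empty: if k = 1 and A is nonempty, the image of Δ is not contained in the kernel (take the constant function 1 on M), and φ kills the cocycle ((0,1),(0,0),(0,1)), which is not in the image of Δ. *)

theory Defs
  imports "HOL-Homology.Homology" "HOL-Analysis.Analysis"
    "HOL-Algebra.Algebraic_Closure_Type"
begin

section \<open>Smooth functions on subsets of Euclidean space\<close>

text \<open>
  Euclidean space of dimension n is \<open>Euclidean_space n\<close>, whose points are the functions
  \<open>nat \<Rightarrow> real\<close> vanishing from index n on. This is the setting of the standard simplices of the
  singular homology library, and it includes dimension 0.
\<close>

primrec Cr_on :: "nat \<Rightarrow> nat \<Rightarrow> (nat \<Rightarrow> real) set \<Rightarrow> ((nat \<Rightarrow> real) \<Rightarrow> real) \<Rightarrow> bool" where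
  "Cr_on 0 n V f \<longleftrightarrow> continuous_map (subtopology (Euclidean_space n) V) euclideanreal f"
| "Cr_on (Suc r) n V f \<longleftrightarrow>
     continuous_map (subtopology (Euclidean_space n) V) euclideanreal f \<and>
     (\<forall>i<n. (\<forall>x\<in>V. (\<lambda>t. f (x(i := t))) differentiable (at (x i))) \<and>
            Cr_on r n V (\<lambda>x. deriv (\<lambda>t. f (x(i := t))) (x i)))"

definition local_smooth_extension ::
    "nat \<Rightarrow> (nat \<Rightarrow> real) set \<Rightarrow> ((nat \<Rightarrow> real) \<Rightarrow> real) \<Rightarrow> (nat \<Rightarrow> real) \<Rightarrow>
     ((nat \<Rightarrow> real) \<Rightarrow> real) \<Rightarrow> bool" where
  "local_smooth_extension n S f x g \<longleftrightarrow>
     (\<exists>V. openin (Euclidean_space n) V \<and> x \<in> V \<and> (\<forall>r. Cr_on r n V g) \<and> (\<forall>y\<in>V \<inter> S. g y = f y))"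

definition smooth_on :: "nat \<Rightarrow> (nat \<Rightarrow> real) set \<Rightarrow> ((nat \<Rightarrow> real) \<Rightarrow> real) \<Rightarrow> bool" where
  "smooth_on n S f \<longleftrightarrow> S \<subseteq> topspace (Euclidean_space n) \<and>
     (\<forall>x\<in>S. \<exists>g. local_smooth_extension n S f x g)"

definition smooth_vec_on ::
    "nat \<Rightarrow> (nat \<Rightarrow> real) set \<Rightarrow> ((nat \<Rightarrow> real) \<Rightarrow> nat \<Rightarrow> real) \<Rightarrow> bool" where
  "smooth_vec_on n S F \<longleftrightarrow> (\<forall>j. smooth_on n S (\<lambda>x. F x j))"

text \<open>
  The differential of \<open>F\<close> at \<open>x\<close> applied to \<open>v\<close>, computed from an arbitrary local smooth extension
  of each component. It is independent of the extension when S is relatively open in a half space,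
  and also when S is relatively open in a standard simplex and v is tangent to the simplex; these
  are the only uses below.
\<close>

definition differential ::
    "nat \<Rightarrow> (nat \<Rightarrow> real) set \<Rightarrow> ((nat \<Rightarrow> real) \<Rightarrow> nat \<Rightarrow> real) \<Rightarrow> (nat \<Rightarrow> real) \<Rightarrow>
     (nat \<Rightarrow> real) \<Rightarrow> nat \<Rightarrow> real" where
  "differential n S F x v = (\<lambda>j.
     let g = (SOME g. local_smooth_extension n S (\<lambda>y. F y j) x g)
     in \<Sum>i<n. v i * deriv (\<lambda>t. g (x(i := t))) (x i))"

definition unit_vec :: "nat \<Rightarrow> nat \<Rightarrow> real" where
  "unit_vec i = (\<lambda>j. if j = i then 1 else 0)"


section \<open>Smooth manifolds with boundary\<close>

type_synonym 'a chart = "'a set \<times> ('a \<Rightarrow> nat \<Rightarrow> real)"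

record 'a mfd =
  mtop :: "'a topology"
  mdim :: nat
  atlas :: "'a chart set"

text \<open>For \<open>n = 0\<close> the half space is the one-point space.\<close>

definition half_space :: "nat \<Rightarrow> (nat \<Rightarrow> real) topology" where
  "half_space n = subtopology (Euclidean_space n) {x. 0 \<le> x 0}"

definition is_chart :: "'a topology \<Rightarrow> nat \<Rightarrow> 'a chart \<Rightarrow> bool" where
  "is_chart S n c \<longleftrightarrow>
     openin S (fst c) \<and> openin (half_space n) (snd c ` fst c) \<and>
     homeomorphic_map (subtopology S (fst c)) (subtopology (half_space n) (snd c ` fst c)) (snd c)"

definition inv_chart :: "'a chart \<Rightarrow> (nat \<Rightarrow> real) \<Rightarrow> 'a" where
  "inv_chart c = inv_into (fst c) (snd c)"

definition smooth_manifold :: "'a mfd \<Rightarrow> bool" where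
  "smooth_manifold M \<longleftrightarrow>
     Hausdorff_space (mtop M) \<and> second_countable (mtop M) \<and>
     (\<forall>c\<in>atlas M. is_chart (mtop M) (mdim M) c) \<and>
     topspace (mtop M) = (\<Union>c\<in>atlas M. fst c) \<and>
     (\<forall>c\<in>atlas M. \<forall>d\<in>atlas M.
        smooth_vec_on (mdim M) (snd c ` (fst c \<inter> fst d)) (snd d \<circ> inv_chart c))"

definition smooth_map :: "'a mfd \<Rightarrow> 'b mfd \<Rightarrow> ('a \<Rightarrow> 'b) \<Rightarrow> bool" where
  "smooth_map M N f \<longleftrightarrow> continuous_map (mtop M) (mtop N) f \<and>
     (\<forall>c\<in>atlas M. \<forall>d\<in>atlas N.
        smooth_vec_on (mdim M) (snd c ` {p \<in> fst c. f p \<in> fst d}) (snd d \<circ> f \<circ> inv_chart c))"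


section \<open>Tangent vectors and differential forms\<close>

text \<open>
  A tangent vector at p is given by its coordinate vectors in all charts around p, which are
  related by the differentials of the transition maps. By convention its coordinates are 0 in
  charts that do not contain p.
\<close>

type_synonym 'a tvec = "'a chart \<Rightarrow> nat \<Rightarrow> real"

definition tvec_of :: "'a mfd \<Rightarrow> 'a chart \<Rightarrow> 'a \<Rightarrow> (nat \<Rightarrow> real) \<Rightarrow> 'a tvec" where
  "tvec_of M c p u = (\<lambda>d.
     if d \<in> atlas M \<and> p \<in> fst d
     then differential (mdim M) (snd c ` (fst c \<inter> fst d)) (snd d \<circ> inv_chart c) (snd c p) u
     else (\<lambda>_. 0))"

definition tangent_space :: "'a mfd \<Rightarrow> 'a \<Rightarrow> 'a tvec set" where
  "tangent_space M p =
     {v. \<forall>c\<in>atlas M. p \<in> fst c \<longrightarrow>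
           v c \<in> topspace (Euclidean_space (mdim M)) \<and> v = tvec_of M c p (v c)}"

text \<open>The value of an alternating form on a k-tuple of vectors is represented as a function on
  lists of length k; it is 0 by convention outside its domain, so that equality of forms is equality
  of functions.\<close>

type_synonym 'a form = "'a \<Rightarrow> 'a tvec list \<Rightarrow> real"

definition alternating_multilinear :: "nat \<Rightarrow> 'a tvec set \<Rightarrow> ('a tvec list \<Rightarrow> real) \<Rightarrow> bool" where
  "alternating_multilinear k T f \<longleftrightarrow>
     (\<forall>vs. \<not> (length vs = k \<and> set vs \<subseteq> T) \<longrightarrow> f vs = 0) \<and>
     (\<forall>vs i u w a b. length vs = k \<and> set vs \<subseteq> T \<and> i < k \<and> u \<in> T \<and> w \<in> T \<longrightarrow>
        f (vs[i := (\<lambda>c j. a * u c j + b * w c j)]) = a * f (vs[i := u]) + b * f (vs[i := w])) \<and>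
     (\<forall>vs i j. length vs = k \<and> set vs \<subseteq> T \<and> i < j \<and> j < k \<and> vs ! i = vs ! j \<longrightarrow> f vs = 0)"

definition is_form :: "'a mfd \<Rightarrow> nat \<Rightarrow> 'a form \<Rightarrow> bool" where
  "is_form M k \<omega> \<longleftrightarrow>
     (\<forall>p. p \<notin> topspace (mtop M) \<longrightarrow> \<omega> p = (\<lambda>_. 0)) \<and>
     (\<forall>p\<in>topspace (mtop M). alternating_multilinear k (tangent_space M p) (\<omega> p)) \<and>
     (\<forall>c\<in>atlas M. \<forall>js. length js = k \<and> set js \<subseteq> {..<mdim M} \<longrightarrow>
        smooth_on (mdim M) (snd c ` fst c)
          (\<lambda>x. \<omega> (inv_chart c x) (map (\<lambda>j. tvec_of M c (inv_chart c x) (unit_vec j)) js)))"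

definition forms :: "'a mfd \<Rightarrow> int \<Rightarrow> 'a form monoid" where
  "forms M k =
     \<lparr>carrier = (if k < 0 then {\<lambda>p vs. 0} else {\<omega>. is_form M (nat k) \<omega>}),
      monoid.mult = (\<lambda>\<omega> \<eta> p vs. \<omega> p vs + \<eta> p vs),
      one = (\<lambda>p vs. 0)\<rparr>"


section \<open>Smooth singular chains and integration\<close>

definition smooth_simplex :: "'a mfd \<Rightarrow> nat \<Rightarrow> ((nat \<Rightarrow> real) \<Rightarrow> 'a) \<Rightarrow> bool" where
  "smooth_simplex M k s \<longleftrightarrow> singular_simplex k (mtop M) s \<and>
     (\<forall>c\<in>atlas M. smooth_vec_on (Suc k) {x \<in> standard_simplex k. s x \<in> fst c} (snd c \<circ> s))"

definition smooth_chains :: "'a mfd \<Rightarrow> int \<Rightarrow> 'a chain monoid" where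
  "smooth_chains M k = free_Abelian_group (if k < 0 then {} else {s. smooth_simplex M (nat k) s})"

definition simplex_differential ::
    "'a mfd \<Rightarrow> nat \<Rightarrow> ((nat \<Rightarrow> real) \<Rightarrow> 'a) \<Rightarrow> (nat \<Rightarrow> real) \<Rightarrow> (nat \<Rightarrow> real) \<Rightarrow> 'a tvec" where
  "simplex_differential M k s x v = (\<lambda>c.
     if c \<in> atlas M \<and> s x \<in> fst c
     then differential (Suc k) {y \<in> standard_simplex k. s y \<in> fst c} (snd c \<circ> s) x v
     else (\<lambda>_. 0))"

text \<open>
  The standard simplex is parametrised by its last k barycentric coordinates \<open>t 1, \<dots>, t k\<close>; the
  coordinate vector field of \<open>t j\<close> is \<open>unit_vec j - unit_vec 0\<close>. For \<open>k = 0\<close> the product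
  measure is the unit mass at a point, and the integral is evaluation at that point.
\<close>

definition barycentric :: "nat \<Rightarrow> (nat \<Rightarrow> real) \<Rightarrow> nat \<Rightarrow> real" where
  "barycentric k t = (\<lambda>i. if i = 0 then 1 - (\<Sum>j\<in>{1..k}. t j) else if i \<le> k then t i else 0)"

definition integral_simplex :: "'a mfd \<Rightarrow> nat \<Rightarrow> 'a form \<Rightarrow> ((nat \<Rightarrow> real) \<Rightarrow> 'a) \<Rightarrow> real" where
  "integral_simplex M k \<omega> s =
     (LINT t : {t. (\<forall>j\<in>{1..k}. 0 \<le> t j) \<and> (\<Sum>j\<in>{1..k}. t j) \<le> 1} | Pi\<^sub>M {1..k} (\<lambda>_. lborel).
        \<omega> (s (barycentric k t))
          (map (\<lambda>j. simplex_differential M k s (barycentric k t) (\<lambda>i. unit_vec j i - unit_vec 0 i))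
               [1..<Suc k]))"

definition integral_chain :: "'a mfd \<Rightarrow> int \<Rightarrow> 'a form \<Rightarrow> 'a chain \<Rightarrow> real" where
  "integral_chain M k \<omega> c =
     (\<Sum>s\<in>Poly_Mapping.keys c. of_int (Poly_Mapping.lookup c s) * integral_simplex M (nat k) \<omega> s)"


section \<open>Relative chains, cochains and forms\<close>

text \<open>Degrees are integers. In degrees \<open>k \<le> 0\<close> the library function
  \<open>chain_boundary (nat k)\<close> is 0, as it should be.\<close>

definition rel_chains :: "'a mfd \<Rightarrow> 'm mfd \<Rightarrow> int \<Rightarrow> ('m chain \<times> 'a chain) monoid" where
  "rel_chains A M k = smooth_chains M k \<times>\<times> smooth_chains A (k - 1)"

definition rel_boundary ::
    "('a \<Rightarrow> 'm) \<Rightarrow> int \<Rightarrow> 'm chain \<times> 'a chain \<Rightarrow> 'm chain \<times> 'a chain" where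
  "rel_boundary \<rho> k = (\<lambda>(\<sigma>, \<tau>).
     (chain_boundary (nat k) \<sigma> + chain_map (nat (k - 1)) \<rho> \<tau>, - chain_boundary (nat (k - 1)) \<tau>))"

definition rel_cycles ::
    "'a mfd \<Rightarrow> 'm mfd \<Rightarrow> ('a \<Rightarrow> 'm) \<Rightarrow> int \<Rightarrow> ('m chain \<times> 'a chain) monoid" where
  "rel_cycles A M \<rho> k = (rel_chains A M k)
     \<lparr>carrier := kernel (rel_chains A M k) (rel_chains A M (k - 1)) (rel_boundary \<rho> k)\<rparr>"

definition Hom_group :: "('c, 'x) monoid_scheme \<Rightarrow> ('g, 'y) monoid_scheme \<Rightarrow> ('c \<Rightarrow> 'g) monoid" where
  "Hom_group C G =
     \<lparr>carrier = hom C G \<inter> extensional (carrier C),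
      monoid.mult = (\<lambda>f g. \<lambda>x\<in>carrier C. f x \<otimes>\<^bsub>G\<^esub> g x),
      one = (\<lambda>x\<in>carrier C. \<one>\<^bsub>G\<^esub>)\<rparr>"

abbreviation real_ring :: "real ring" where
  "real_ring \<equiv> ring_of_type_algebra"

abbreviation real_group :: "real monoid" where
  "real_group \<equiv> add_monoid real_ring"

definition subring_group :: "real set \<Rightarrow> real monoid" where
  "subring_group \<Lambda> = real_group\<lparr>carrier := \<Lambda>\<rparr>"

definition reals_mod :: "real set \<Rightarrow> real set monoid" where
  "reals_mod \<Lambda> = real_group Mod \<Lambda>"

definition reduce_mod :: "real set \<Rightarrow> real \<Rightarrow> real set" where
  "reduce_mod \<Lambda> x = \<Lambda> #>\<^bsub>real_group\<^esub> x"

type_synonym ('a, 'm) rel_cochain = "'m chain \<times> 'a chain \<Rightarrow> real"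

definition rel_cochains ::
    "'a mfd \<Rightarrow> 'm mfd \<Rightarrow> int \<Rightarrow> real monoid \<Rightarrow> ('a, 'm) rel_cochain monoid" where
  "rel_cochains A M k G = Hom_group (rel_chains A M k) G"

text \<open>
  A cochain f corresponds to the pair \<open>(h, e)\<close> with \<open>h \<sigma> = f (\<sigma>, 0)\<close> and
  \<open>e \<tau> = f (0, \<tau>)\<close>; the definition is \<open>\<delta>(h, e) = (\<delta>h, \<rho>\<^sup>*h - \<delta>e)\<close>
  evaluated at \<open>(\<sigma>, \<tau>)\<close>.
\<close>

definition rel_coboundary ::
    "'a mfd \<Rightarrow> 'm mfd \<Rightarrow> ('a \<Rightarrow> 'm) \<Rightarrow> int \<Rightarrow> ('a, 'm) rel_cochain \<Rightarrow> ('a, 'm) rel_cochain" where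
  "rel_coboundary A M \<rho> k f =
     (let h = (\<lambda>\<sigma>. f (\<sigma>, 0)); e = (\<lambda>\<tau>. f (0, \<tau>)) in
      restrict (\<lambda>(\<sigma>, \<tau>).
        h (chain_boundary (nat (k + 1)) \<sigma>) +
        (h (chain_map (nat k) \<rho> \<tau>) - e (chain_boundary (nat k) \<tau>)))
        (carrier (rel_chains A M (k + 1))))"

definition rel_forms :: "'a mfd \<Rightarrow> 'm mfd \<Rightarrow> int \<Rightarrow> ('m form \<times> 'a form) monoid" where
  "rel_forms A M k = forms M k \<times>\<times> forms A (k - 1)"

definition rel_integral ::
    "'a mfd \<Rightarrow> 'm mfd \<Rightarrow> int \<Rightarrow> 'm form \<times> 'a form \<Rightarrow> 'm chain \<times> 'a chain \<Rightarrow> real" where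
  "rel_integral A M k = (\<lambda>(\<omega>, \<theta>) (\<sigma>, \<tau>). integral_chain M k \<omega> \<sigma> + integral_chain A (k - 1) \<theta> \<tau>)"

definition rel_period_forms ::
    "'a mfd \<Rightarrow> 'm mfd \<Rightarrow> ('a \<Rightarrow> 'm) \<Rightarrow> real set \<Rightarrow> int \<Rightarrow> ('m form \<times> 'a form) monoid" where
  "rel_period_forms A M \<rho> \<Lambda> k = (rel_forms A M k)
     \<lparr>carrier := {w \<in> carrier (rel_forms A M k).
                    \<forall>z\<in>carrier (rel_cycles A M \<rho> k). rel_integral A M k w z \<in> \<Lambda>}\<rparr>"


section \<open>Relative differential characters\<close>

definition diff_characters ::
    "'a mfd \<Rightarrow> 'm mfd \<Rightarrow> ('a \<Rightarrow> 'm) \<Rightarrow> real set \<Rightarrow> int \<Rightarrow>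
     ('m chain \<times> 'a chain \<Rightarrow> real set) monoid" where
  "diff_characters A M \<rho> \<Lambda> k =
     (Hom_group (rel_cycles A M \<rho> (k - 1)) (reals_mod \<Lambda>))
     \<lparr>carrier := {f \<in> carrier (Hom_group (rel_cycles A M \<rho> (k - 1)) (reals_mod \<Lambda>)).
        \<exists>w\<in>carrier (rel_forms A M k). \<forall>x\<in>carrier (rel_chains A M k).
          f (rel_boundary \<rho> k x) = reduce_mod \<Lambda> (rel_integral A M k w x)}\<rparr>"


section \<open>The complex\<close>

type_synonym ('a, 'm) hat_cochain =
  "('a, 'm) rel_cochain \<times> ('a, 'm) rel_cochain \<times> ('m form \<times> 'a form)"

definition hat_complex ::
    "'a mfd \<Rightarrow> 'm mfd \<Rightarrow> ('a \<Rightarrow> 'm) \<Rightarrow> real set \<Rightarrow> int \<Rightarrow> ('a, 'm) hat_cochain monoid" where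
  "hat_complex A M \<rho> \<Lambda> k =
     rel_cochains A M k (subring_group \<Lambda>) \<times>\<times> rel_cochains A M (k - 1) real_group
       \<times>\<times> rel_period_forms A M \<rho> \<Lambda> k"

definition hat_diff ::
    "'a mfd \<Rightarrow> 'm mfd \<Rightarrow> ('a \<Rightarrow> 'm) \<Rightarrow> int \<Rightarrow> ('a, 'm) hat_cochain \<Rightarrow> ('a, 'm) hat_cochain" where
  "hat_diff A M \<rho> k = (\<lambda>(c, h, w).
     (rel_coboundary A M \<rho> k c,
      (\<lambda>x\<in>carrier (rel_chains A M k).
         rel_integral A M k w x - c x - rel_coboundary A M \<rho> (k - 1) h x),
      \<one>\<^bsub>rel_forms A M (k + 1)\<^esub>))"

definition hat_cocycles ::
    "'a mfd \<Rightarrow> 'm mfd \<Rightarrow> ('a \<Rightarrow> 'm) \<Rightarrow> real set \<Rightarrow> int \<Rightarrow> ('a, 'm) hat_cochain monoid" where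
  "hat_cocycles A M \<rho> \<Lambda> k = (hat_complex A M \<rho> \<Lambda> k)
     \<lparr>carrier := kernel (hat_complex A M \<rho> \<Lambda> k) (hat_complex A M \<rho> \<Lambda> (k + 1))
                   (hat_diff A M \<rho> k)\<rparr>"

definition hat_coboundaries ::
    "'a mfd \<Rightarrow> 'm mfd \<Rightarrow> ('a \<Rightarrow> 'm) \<Rightarrow> real set \<Rightarrow> int \<Rightarrow> ('a, 'm) hat_cochain set" where
  "hat_coboundaries A M \<rho> \<Lambda> k =
     hat_diff A M \<rho> (k - 1) ` carrier (hat_complex A M \<rho> \<Lambda> (k - 1))"

text \<open>
  The differential squares to 0 on the component of degree k as soon as \<open>k \<ge> 1\<close>, or when A is empty.
  For \<open>k = 0\<close> and A nonempty it does not: the constant function 1 on M lies in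
  \<open>rel_period_forms A M \<rho> \<Lambda> 0\<close>, but its coboundary has the nonzero second component
  \<open>\<rho>\<^sup>*1 = 1\<close>. So cohomology is only meaningful in degree 1 when A is empty.
\<close>

definition hat_cohomology ::
    "'a mfd \<Rightarrow> 'm mfd \<Rightarrow> ('a \<Rightarrow> 'm) \<Rightarrow> real set \<Rightarrow> int \<Rightarrow> ('a, 'm) hat_cochain set monoid" where
  "hat_cohomology A M \<rho> \<Lambda> k = hat_cocycles A M \<rho> \<Lambda> k Mod hat_coboundaries A M \<rho> \<Lambda> k"

definition char_map ::
    "'a mfd \<Rightarrow> 'm mfd \<Rightarrow> ('a \<Rightarrow> 'm) \<Rightarrow> real set \<Rightarrow> int \<Rightarrow> ('a, 'm) hat_cochain \<Rightarrow>
     ('m chain \<times> 'a chain \<Rightarrow> real set)" where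
  "char_map A M \<rho> \<Lambda> k = (\<lambda>(c, h, w).
     \<lambda>z\<in>carrier (rel_cycles A M \<rho> (k - 1)). reduce_mod \<Lambda> (h z))"

end

theory Submission
  imports Defs
begin

text \<open>
  Where the classical argument uses Stokes' theorem, a contraction argument suffices. Contracting a
  smooth simplex to a vertex changes the integrals of a form over the simplex and over its faces
  continuously, down to 0 (in the case of the faces of a 1-simplex by cancellation). A proper subring
  \<open>\<Lambda>\<close> of the reals contains no interval, so integrals that stay in \<open>\<Lambda>\<close> along the contraction vanish.
  Hence forms with \<open>\<Lambda>\<close>-periods are closed, and a form all of whose integrals lie in \<open>\<Lambda>\<close> is 0.

  The rest is homological algebra: the cycles are a direct summand of the chains, since the boundary
  map goes into a free abelian group, so characters on cycles extend to chains and lift to real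
  cochains (surjectivity), and real cochains that vanish on cycles are coboundaries because the reals
  are divisible (injectivity).
\<close>

section \<open>Smooth functions on Euclidean space\<close>

text \<open>Contraction settles positive degrees only: over a contracted p-simplex the integral is
  t^p times an average of the form over ever smaller simplices, whereas over a 0-simplex it is an
  evaluation and does not shrink. This is why \<open>A\<close> has to be empty for k = 1: the
  0-forms on \<open>A\<close> that occur then may be nonzero constants in \<Lambda>, and the values
  of a function on \<open>M\<close> at the image of \<open>A\<close> cancel against nothing. The
  average itself has a limit at t = 0, the value of the form on the edges at the vertex times the
  volume of the standard simplex. So a form with integrals in \<Lambda> vanishes on all tuples that
  are edges of a simplex at its vertex 0. Closedness enters only as the vanishing of integrals over
  relative boundaries; no exterior derivative occurs. The analytic obstacle is that smoothness on a
  half space or a simplex means existence of local extensions, which are not unique. Differentials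
  are therefore evaluated in directions spanned by segments inside the set, where one-sided
  derivatives fix the value.\<close>

abbreviation coord_space :: "nat \<Rightarrow> (nat \<Rightarrow> real) set" where
  "coord_space n \<equiv> {x. \<forall>i\<ge>n. x i = 0}"

abbreviation part_deriv :: "nat \<Rightarrow> ((nat \<Rightarrow> real) \<Rightarrow> real) \<Rightarrow> (nat \<Rightarrow> real) \<Rightarrow> real" where
  "part_deriv i f x \<equiv> deriv (\<lambda>t. f (x(i := t))) (x i)"

text \<open>Trades the abstract product topology for the type-class topology on functions, so that
  \<open>continuous_on\<close>, \<open>open\<close> and compactness arguments apply.\<close>

lemma Euclidean_space_eq: "Euclidean_space n = top_of_set (coord_space n)"
  by (simp add: Euclidean_space_def euclidean_product_topology)

lemma openin_Euclidean_space_subset: "openin (Euclidean_space n) V \<Longrightarrow> V \<subseteq> coord_space n"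
  using openin_subset by (fastforce simp: topspace_Euclidean_space)

text \<open>A basic open set of the product topology restricts each coordinate separately. Points of
  \<open>coord_space n\<close> agree from coordinate n on, so only n of these restrictions matter
  and one radius serves them all.\<close>

lemma openin_Euclidean_space_box:
  assumes "openin (Euclidean_space n) V" "y \<in> V"
  shows "\<exists>d>0. \<forall>z\<in>coord_space n. (\<forall>i<n. \<bar>z i - y i\<bar> < d) \<longrightarrow> z \<in> V"
proof -
  obtain U where U: "open U" "V = coord_space n \<inter> U"
    using assms(1) unfolding Euclidean_space_eq openin_open by auto
  then obtain B where B: "y \<in> Pi\<^sub>E UNIV B" "\<And>i. openin euclidean (B i)" "Pi\<^sub>E UNIV B \<subseteq> U"
    using product_topology_open_contains_basis[of "\<lambda>_. euclidean" UNIV U y] assms(2)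
    by (auto simp: open_fun_def)
  have "\<forall>i. \<exists>e>0. \<forall>r. \<bar>r - y i\<bar> < e \<longrightarrow> r \<in> B i"
  proof
    fix i
    have "open (B i)" "y i \<in> B i" using B by auto
    then show "\<exists>e>0. \<forall>r. \<bar>r - y i\<bar> < e \<longrightarrow> r \<in> B i"
      by (simp add: open_dist dist_real_def)
  qed
  then obtain e where e: "\<And>i. e i > 0" "\<And>i r. \<bar>r - y i\<bar> < e i \<Longrightarrow> r \<in> B i" by metis
  \<comment> \<open>The element 1 keeps the set nonempty when n = 0.\<close>
  define d where "d = Min (insert 1 (e ` {..<n}))"
  have "d > 0" using e(1) by (auto simp: d_def)
  moreover have "z \<in> V" if z: "z \<in> coord_space n" "\<And>i. i < n \<Longrightarrow> \<bar>z i - y i\<bar> < d" for z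
  proof -
    have "z i \<in> B i" for i
    proof (cases "i < n")
      case True
      then have "d \<le> e i" by (auto simp: d_def intro: Min_le)
      then show ?thesis using z(2)[OF True] e(2) by force
    next
      case False
      then have "z i = y i" using z(1) assms(2) U by auto
      then show ?thesis using B(1) by (auto simp: PiE_def Pi_def)
    qed
    then show ?thesis using B(3) U z(1) by (auto simp: PiE_def Pi_def extensional_def)
  qed
  ultimately show ?thesis by blast
qed

section \<open>Functions of class C^r on open sets\<close>

lemma continuous_map_Euclidean_space_iff_on:
  "V \<subseteq> coord_space n \<Longrightarrow>
    continuous_map (subtopology (Euclidean_space n) V) euclideanreal f \<longleftrightarrow> continuous_on V f"
  by (simp add: Euclidean_space_eq subtopology_subtopology Int_absorb1)

lemma Cr_on_imp_continuous_on:
  "V \<subseteq> coord_space n \<Longrightarrow> Cr_on r n V f \<Longrightarrow> continuous_on V f"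
  by (cases r) (auto simp: continuous_map_Euclidean_space_iff_on)

lemma Cr_on_SucI:
  assumes "V \<subseteq> coord_space n" "continuous_on V f"
    "\<And>i x. i < n \<Longrightarrow> x \<in> V \<Longrightarrow> (\<lambda>t. f (x(i := t))) differentiable (at (x i))"
    "\<And>i. i < n \<Longrightarrow> Cr_on r n V (part_deriv i f)"
  shows "Cr_on (Suc r) n V f"
  using assms by (simp add: continuous_map_Euclidean_space_iff_on)

lemma Cr_on_has_part_deriv:
  assumes "Cr_on (Suc r) n V f" "i < n" "x \<in> V"
  shows "((\<lambda>t. f (x(i := t))) has_real_derivative part_deriv i f x) (at (x i))"
proof -
  have "(\<lambda>t. f (x(i := t))) differentiable (at (x i))"
    using iffD1[OF Cr_on.simps(2) assms(1)] assms(2,3) by blast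
  then show ?thesis
    by (simp only: DERIV_deriv_iff_real_differentiable)
qed

lemma Cr_on_part_deriv: "Cr_on (Suc r) n V f \<Longrightarrow> i < n \<Longrightarrow> Cr_on r n V (part_deriv i f)"
  using iffD1[OF Cr_on.simps(2)] by blast

lemma Cr_on_SucD: "Cr_on (Suc r) n V f \<Longrightarrow> Cr_on r n V f"
proof (induction r arbitrary: f)
  case (Suc r)
  note * = iffD1[OF Cr_on.simps(2) Suc.prems]
  show ?case
    by (rule iffD2[OF Cr_on.simps(2)]) (use * Suc.IH in blast)
qed simp

lemma eventually_upd_in:
  assumes "openin (Euclidean_space n) V" "x \<in> V" "i < n"
  shows "\<forall>\<^sub>F t in nhds (x i). x(i := t) \<in> V"
proof -
  obtain d where d: "d > 0" "\<forall>z\<in>coord_space n. (\<forall>i<n. \<bar>z i - x i\<bar> < d) \<longrightarrow> z \<in> V"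
    using openin_Euclidean_space_box[OF assms(1,2)] by blast
  have x: "x \<in> coord_space n" using assms(2) openin_Euclidean_space_subset[OF assms(1)] by blast
  have "x(i := t) \<in> V" if "dist t (x i) < d" for t
    by (rule d(2)[rule_format]) (use x assms(3) that d(1) in \<open>auto simp: dist_real_def\<close>)
  then show ?thesis
    unfolding eventually_nhds_metric using d(1) by blast
qed

lemma part_deriv_cong:
  assumes "openin (Euclidean_space n) V" "x \<in> V" "i < n" "\<And>y. y \<in> V \<Longrightarrow> f y = g y"
  shows "part_deriv i f x = part_deriv i g x"
proof (rule deriv_cong_ev)
  show "\<forall>\<^sub>F t in nhds (x i). f (x(i := t)) = g (x(i := t))"
    using eventually_upd_in[OF assms(1-3)] by eventually_elim (simp add: assms(4))
qed simp

text \<open>On an open \<open>V\<close>, partial derivatives at a point see only values at nearby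
  points, which again lie in \<open>V\<close>. The lemma serves to replace \<open>part_deriv\<close>
  of a sum, product or composite by its formula.\<close>

lemma Cr_on_cong:
  assumes V: "openin (Euclidean_space n) V" and "Cr_on r n V f" "\<And>y. y \<in> V \<Longrightarrow> f y = g y"
  shows "Cr_on r n V g"
  using assms(2,3)
proof (induction r arbitrary: f g)
  case 0
  then show ?case
    using openin_Euclidean_space_subset[OF V] by (simp add: continuous_map_Euclidean_space_iff_on cong: continuous_on_cong)
next
  case (Suc r)
  have sub: "V \<subseteq> coord_space n" by (rule openin_Euclidean_space_subset[OF V])
  show ?case
  proof (rule Cr_on_SucI[OF sub])
    show "continuous_on V g"
      using Cr_on_imp_continuous_on[OF sub Suc.prems(1)] Suc.prems(2) by (simp cong: continuous_on_cong)
  next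
    fix i x assume i: "i < n" and x: "x \<in> V"
    have "((\<lambda>t. g (x(i := t))) has_real_derivative part_deriv i f x) (at (x i))"
    proof (rule has_field_derivative_transform_within_open[OF Cr_on_has_part_deriv[OF Suc.prems(1) i x]])
      show "x i \<in> interior {t. x(i:=t) \<in> V}"
        using eventually_upd_in[OF V x i] unfolding eventually_nhds interior_def by blast
      show "f (x(i := t)) = g (x(i := t))" if "t \<in> interior {t. x(i:=t) \<in> V}" for t
        using Suc.prems(2) that interior_subset by blast
    qed simp
    then show "(\<lambda>t. g (x(i := t))) differentiable (at (x i))"
      unfolding real_differentiable_def by (rule exI)
  next
    fix i assume i: "i < n"
    show "Cr_on r n V (part_deriv i g)"
      by (rule Suc.IH[OF Cr_on_part_deriv[OF Suc.prems(1) i]]) (rule part_deriv_cong[OF V _ i Suc.prems(2)])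
  qed
qed

lemma Cr_on_subset:
  assumes "Cr_on r n V f" "V' \<subseteq> V" "V \<subseteq> coord_space n"
  shows "Cr_on r n V' f"
  using assms(1)
proof (induction r arbitrary: f)
  case 0
  have "continuous_on V' f"
    using Cr_on_imp_continuous_on[OF assms(3) 0] assms(2) by (rule continuous_on_subset)
  then show ?case using assms(2,3) by (subst Cr_on.simps(1), subst continuous_map_Euclidean_space_iff_on) auto
next
  case (Suc r)
  show ?case
  proof (rule Cr_on_SucI)
    show "V' \<subseteq> coord_space n" using assms(2,3) by blast
    show "continuous_on V' f"
      using Cr_on_imp_continuous_on[OF assms(3) Suc.prems] assms(2) by (rule continuous_on_subset)
    show "(\<lambda>t. f (x(i := t))) differentiable at (x i)" if "i < n" "x \<in> V'" for i x
      using iffD1[OF Cr_on.simps(2) Suc.prems] that assms(2) by blast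
  qed (intro Suc.IH Cr_on_part_deriv[OF Suc.prems])
qed

lemma Cr_on_const: "V \<subseteq> coord_space n \<Longrightarrow> Cr_on r n V (\<lambda>_. c)"
  by (induction r arbitrary: c) (auto simp: continuous_map_Euclidean_space_iff_on)

lemma Cr_on_coord:
  assumes "V \<subseteq> coord_space n"
  shows "Cr_on r n V (\<lambda>x. x j)"
proof (cases r)
  case 0
  then show ?thesis using assms
    by (simp add: continuous_map_Euclidean_space_iff_on continuous_on_subset[OF continuous_on_product_coordinates])
next
  case (Suc q)
  have D: "((\<lambda>t. (x(i := t)) j) has_real_derivative (if i = j then 1 else 0)) (at (x i))" for i and x :: "nat \<Rightarrow> real"
    by (cases "i = j") auto
  show ?thesis unfolding Suc
  proof (rule Cr_on_SucI[OF assms])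
    show "continuous_on V (\<lambda>x. x j)"
      by (rule continuous_on_subset[OF continuous_on_product_coordinates]) simp
    show "Cr_on q n V (part_deriv i (\<lambda>x. x j))" for i
      unfolding DERIV_imp_deriv[OF D] using assms by (rule Cr_on_const)
  qed (unfold real_differentiable_def, rule exI, rule D)
qed

lemma Cr_on_add:
  assumes V: "openin (Euclidean_space n) V" and "Cr_on r n V f" "Cr_on r n V g"
  shows "Cr_on r n V (\<lambda>x. f x + g x)"
  using assms(2,3)
proof (induction r arbitrary: f g)
  case 0
  then show ?case using openin_Euclidean_space_subset[OF V]
    by (auto simp: continuous_map_Euclidean_space_iff_on intro: continuous_intros)
next
  case (Suc r)
  have sub: "V \<subseteq> coord_space n" by (rule openin_Euclidean_space_subset[OF V])
  have D: "((\<lambda>t. f (x(i := t)) + g (x(i := t))) has_real_derivative part_deriv i f x + part_deriv i g x) (at (x i))"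
    if "i < n" "x \<in> V" for i x
    by (intro DERIV_add Cr_on_has_part_deriv[OF Suc.prems(1)] Cr_on_has_part_deriv[OF Suc.prems(2)] that)
  show ?case
  proof (rule Cr_on_SucI[OF sub])
    show "continuous_on V (\<lambda>x. f x + g x)"
      by (intro continuous_on_add Cr_on_imp_continuous_on[OF sub Suc.prems(1)] Cr_on_imp_continuous_on[OF sub Suc.prems(2)])
  next
    fix i assume i: "i < n"
    show "Cr_on r n V (part_deriv i (\<lambda>x. f x + g x))"
      by (rule Cr_on_cong[OF V Suc.IH[OF Cr_on_part_deriv[OF Suc.prems(1) i] Cr_on_part_deriv[OF Suc.prems(2) i]]])
        (rule DERIV_imp_deriv[OF D[OF i], symmetric])
  qed (unfold real_differentiable_def, rule exI, erule (1) D)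
qed

lemma Cr_on_mult:
  assumes V: "openin (Euclidean_space n) V" and "Cr_on r n V f" "Cr_on r n V g"
  shows "Cr_on r n V (\<lambda>x. f x * g x)"
  using assms(2,3)
proof (induction r arbitrary: f g)
  case 0
  then show ?case using openin_Euclidean_space_subset[OF V]
    by (auto simp: continuous_map_Euclidean_space_iff_on intro: continuous_intros)
next
  case (Suc r)
  have sub: "V \<subseteq> coord_space n" by (rule openin_Euclidean_space_subset[OF V])
  have D: "((\<lambda>t. f (x(i := t)) * g (x(i := t))) has_real_derivative part_deriv i f x * g x + part_deriv i g x * f x) (at (x i))"
    if "i < n" "x \<in> V" for i x
    using DERIV_mult[OF Cr_on_has_part_deriv[OF Suc.prems(1) that] Cr_on_has_part_deriv[OF Suc.prems(2) that]]
    unfolding fun_upd_triv .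
  show ?case
  proof (rule Cr_on_SucI[OF sub])
    show "continuous_on V (\<lambda>x. f x * g x)"
      by (intro continuous_on_mult Cr_on_imp_continuous_on[OF sub Suc.prems(1)] Cr_on_imp_continuous_on[OF sub Suc.prems(2)])
  next
    fix i assume i: "i < n"
    have "Cr_on r n V (\<lambda>x. part_deriv i f x * g x + part_deriv i g x * f x)"
      by (rule Cr_on_add[OF V
            Suc.IH[OF Cr_on_part_deriv[OF Suc.prems(1) i] Cr_on_SucD[OF Suc.prems(2)]]
            Suc.IH[OF Cr_on_part_deriv[OF Suc.prems(2) i] Cr_on_SucD[OF Suc.prems(1)]]])
    then show "Cr_on r n V (part_deriv i (\<lambda>x. f x * g x))"
      by (rule Cr_on_cong[OF V]) (rule DERIV_imp_deriv[OF D[OF i], symmetric])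
  qed (unfold real_differentiable_def, rule exI, erule (1) D)
qed

lemma Cr_on_sum:
  assumes V: "openin (Euclidean_space n) V" and "\<And>j. j \<in> J \<Longrightarrow> Cr_on r n V (f j)"
  shows "Cr_on r n V (\<lambda>x. \<Sum>j\<in>J. f j x)"
  using assms(2)
proof (induction J rule: infinite_finite_induct)
  case (insert j J)
  then have "Cr_on r n V (\<lambda>x. f j x + (\<Sum>j\<in>J. f j x))"
    by (intro Cr_on_add[OF V]) auto
  then show ?case using insert.hyps by simp
qed (simp_all add: Cr_on_const[OF openin_Euclidean_space_subset[OF V]])

section \<open>Total differentiability and the chain rule\<close>

lemma openin_Euclidean_space_preimage:
  assumes "openin (Euclidean_space n) V" "continuous_on V g" "open T"
  shows "openin (Euclidean_space n) {x \<in> V. g x \<in> T}"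
proof -
  have "openin (top_of_set V) (V \<inter> g -` T)"
    by (rule continuous_openin_preimage_gen[OF assms(2,3)])
  then have "openin (Euclidean_space n) (V \<inter> g -` T)"
    using assms(1) unfolding Euclidean_space_eq by (rule openin_trans)
  moreover have "V \<inter> g -` T = {x \<in> V. g x \<in> T}" by auto
  ultimately show ?thesis by simp
qed

text \<open>Phrased with the difference quotient so that one statement covers both orders of the end
  points.\<close>

lemma MVT_segment:
  fixes h :: "real \<Rightarrow> real"
  assumes "a \<noteq> b" "\<And>t. t \<in> closed_segment a b \<Longrightarrow> (h has_real_derivative h' t) (at t)"
  shows "\<exists>\<xi>\<in>closed_segment a b. (h b - h a) / (b - a) = h' \<xi>"
proof -
  have *: "\<exists>\<xi>\<in>{u..v}. h v - h u = (v - u) * h' \<xi>"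
    if "u < v" "\<And>t. t \<in> {u..v} \<Longrightarrow> (h has_real_derivative h' t) (at t)" for u v
    using MVT2[OF that(1), of h h'] that(2) by force
  show ?thesis
  proof (cases "a < b")
    case True
    then have "closed_segment a b = {a..b}" by (simp add: closed_segment_eq_real_ivl)
    then show ?thesis using *[OF True] assms(2) True by force
  next
    case False
    then have ba: "b < a" using assms(1) by simp
    then have eq: "closed_segment a b = {b..a}" by (simp add: closed_segment_eq_real_ivl)
    obtain \<xi> where "\<xi> \<in> {b..a}" "h a - h b = (a - b) * h' \<xi>"
      using *[OF ba] assms(2) eq by force
    then have "(h b - h a) / (b - a) = h' \<xi>" using ba by (simp add: field_simps)
    then show ?thesis using \<open>\<xi> \<in> {b..a}\<close> eq by blast
  qed
qed

text \<open>Total differentiability in the form of Caratheodory. The way from \<open>y\<close> to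
  \<open>z\<close> changes one coordinate at a time; the telescoping sum over the intermediate
  points \<open>w j z\<close> gives the identity. The mean value theorem turns each quotient into a
  partial derivative at a point near \<open>y\<close>, and continuity of the partial derivatives
  gives the estimate.\<close>

lemma Cr_on_caratheodory:
  assumes V: "openin (Euclidean_space n) V" and f: "Cr_on (Suc r) n V f" and y: "y \<in> V"
  shows "\<exists>q. (\<forall>z\<in>coord_space n. f z - f y = (\<Sum>j<n. q j z * (z j - y j))) \<and>
    (\<forall>e>0. \<exists>d>0. \<forall>z\<in>coord_space n. (\<forall>i<n. \<bar>z i - y i\<bar> < d) \<longrightarrow>
       (\<forall>j<n. \<bar>q j z - part_deriv j f y\<bar> < e))"
proof -
  have sub: "V \<subseteq> coord_space n" by (rule openin_Euclidean_space_subset[OF V])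
  then have yc: "y \<in> coord_space n" using y by blast
  define w where "w m z = (\<lambda>i. if i < m then z i else y i)" for m and z :: "nat \<Rightarrow> real"
  \<comment> \<open>For \<open>z j = y j\<close> the factor of \<open>q j z\<close> in the identity
    is 0; taking the limit as the value there spares the estimate an exception.\<close>
  define q where "q j z = (if z j = y j then part_deriv j f y else (f (w (Suc j) z) - f (w j z)) / (z j - y j))"
    for j z
  have "f z - f y = (\<Sum>j<n. q j z * (z j - y j))" if z: "z \<in> coord_space n" for z
  proof -
    have "q j z * (z j - y j) = f (w (Suc j) z) - f (w j z)" for j
    proof (cases "z j = y j")
      case True
      then have "w (Suc j) z = w j z" by (auto simp: w_def fun_eq_iff less_Suc_eq)
      then show ?thesis using True by simp
    next
      case False
      then show ?thesis by (simp add: q_def)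
    qed
    then have "(\<Sum>j<n. q j z * (z j - y j)) = f (w n z) - f (w 0 z)"
      using sum_lessThan_telescope[of "\<lambda>j. f (w j z)" n] by simp
    moreover have "w n z = z" using z yc by (auto simp: w_def fun_eq_iff)
    moreover have "w 0 z = y" by (simp add: w_def)
    ultimately show ?thesis by simp
  qed
  moreover have "\<exists>d>0. \<forall>z\<in>coord_space n. (\<forall>i<n. \<bar>z i - y i\<bar> < d) \<longrightarrow>
       (\<forall>j<n. \<bar>q j z - part_deriv j f y\<bar> < e)" if e: "e > 0" for e
  proof -
    define U where "U j = {x \<in> V. part_deriv j f x \<in> ball (part_deriv j f y) e}" for j
    have U: "openin (Euclidean_space n) (U j)" if "j < n" for j
      unfolding U_def
      by (intro openin_Euclidean_space_preimage[OF V]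
          Cr_on_imp_continuous_on[OF sub Cr_on_part_deriv[OF f that]] open_ball)
    have "\<forall>j. \<exists>d. j < n \<longrightarrow> d > 0 \<and> (\<forall>z\<in>coord_space n. (\<forall>i<n. \<bar>z i - y i\<bar> < d) \<longrightarrow> z \<in> U j)"
      using openin_Euclidean_space_box[OF U] y e by (auto simp: U_def)
    from choice[OF this] obtain dd where "\<forall>j. j < n \<longrightarrow> dd j > 0 \<and>
        (\<forall>z\<in>coord_space n. (\<forall>i<n. \<bar>z i - y i\<bar> < dd j) \<longrightarrow> z \<in> U j)" ..
    then have dd: "dd j > 0" "z \<in> coord_space n \<Longrightarrow> (\<forall>i<n. \<bar>z i - y i\<bar> < dd j) \<Longrightarrow> z \<in> U j"
      if "j < n" for j z
      using that by blast+
    define d where "d = Min (insert 1 (dd ` {..<n}))"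
    have d0: "d > 0" using dd(1) by (auto simp: d_def)
    have dle: "d \<le> dd j" if "j < n" for j using that by (auto simp: d_def intro: Min_le)
    have "\<bar>q j z - part_deriv j f y\<bar> < e"
      if z: "z \<in> coord_space n" "\<forall>i<n. \<bar>z i - y i\<bar> < d" and j: "j < n" for j z
    proof (cases "z j = y j")
      case True
      then show ?thesis using e by (simp add: q_def)
    next
      case False
      have inU: "(w j z)(j := t) \<in> U j" if t: "t \<in> closed_segment (y j) (z j)" for t
      proof (rule dd(2)[OF j])
        have tj: "\<bar>t - y j\<bar> \<le> \<bar>z j - y j\<bar>"
          using t by (auto simp: closed_segment_eq_real_ivl split: if_splits)
        show "(w j z)(j := t) \<in> coord_space n" using z(1) yc j by (auto simp: w_def)
        show "\<forall>i<n. \<bar>((w j z)(j := t)) i - y i\<bar> < dd j"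
        proof (intro allI impI)
          fix i assume "i < n"
          then have "\<bar>((w j z)(j := t)) i - y i\<bar> < d" using z(2) tj d0 by (auto simp: w_def)
          then show "\<bar>((w j z)(j := t)) i - y i\<bar> < dd j" using dle[OF j] by linarith
        qed
      qed
      have "\<exists>\<xi>\<in>closed_segment (y j) (z j).
          (f ((w j z)(j := z j)) - f ((w j z)(j := y j))) / (z j - y j) = part_deriv j f ((w j z)(j := \<xi>))"
      proof (rule MVT_segment)
        show "y j \<noteq> z j" using False by simp
        show "((\<lambda>t. f ((w j z)(j := t))) has_real_derivative part_deriv j f ((w j z)(j := t))) (at t)"
          if "t \<in> closed_segment (y j) (z j)" for t
        proof -
          have "(w j z)(j := t) \<in> V" using inU[OF that] by (simp add: U_def)
          from Cr_on_has_part_deriv[OF f j this] show ?thesis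
            unfolding fun_upd_upd fun_upd_same .
        qed
      qed
      moreover have "(w j z)(j := z j) = w (Suc j) z" "(w j z)(j := y j) = w j z"
        by (auto simp: w_def fun_eq_iff)
      ultimately obtain \<xi> where "\<xi> \<in> closed_segment (y j) (z j)" "q j z = part_deriv j f ((w j z)(j := \<xi>))"
        using False unfolding q_def by auto
      then show ?thesis using inU[of \<xi>] unfolding U_def by (auto simp: dist_real_def)
    qed
    then show ?thesis using d0 by blast
  qed
  ultimately show ?thesis by blast
qed

text \<open>The derivative is taken within \<open>S\<close>, so \<open>t0\<close> may be an end
  point of an interval, as for curves that start on the boundary of a half space or a simplex.
  Dividing the Caratheodory identity by \<open>t - t0\<close> gives the claim.\<close>

lemma Cr_on_chain_curve:
  assumes V: "openin (Euclidean_space n) V" and f: "Cr_on (Suc r) n V f"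
    and \<gamma>0: "\<gamma> t0 \<in> V" and \<gamma>S: "\<And>t. t \<in> S \<Longrightarrow> \<gamma> t \<in> coord_space n"
    and D: "\<And>j. j < n \<Longrightarrow> ((\<lambda>t. \<gamma> t j) has_real_derivative D j) (at t0 within S)"
  shows "((\<lambda>t. f (\<gamma> t)) has_real_derivative (\<Sum>j<n. part_deriv j f (\<gamma> t0) * D j)) (at t0 within S)"
proof -
  obtain q where q: "\<forall>z\<in>coord_space n. f z - f (\<gamma> t0) = (\<Sum>j<n. q j z * (z j - \<gamma> t0 j))"
    "\<forall>e>0. \<exists>d>0. \<forall>z\<in>coord_space n. (\<forall>i<n. \<bar>z i - \<gamma> t0 i\<bar> < d) \<longrightarrow>
       (\<forall>j<n. \<bar>q j z - part_deriv j f (\<gamma> t0)\<bar> < e)"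
    using Cr_on_caratheodory[OF V f \<gamma>0] by blast
  have inS: "\<forall>\<^sub>F t in at t0 within S. t \<in> S" by (simp add: eventually_at_filter)
  have qlim: "((\<lambda>t. q j (\<gamma> t)) \<longlongrightarrow> part_deriv j f (\<gamma> t0)) (at t0 within S)" if j: "j < n" for j
  proof (rule tendstoI)
    fix e :: real assume "e > 0"
    then obtain d where d: "d > 0" "\<forall>z\<in>coord_space n. (\<forall>i<n. \<bar>z i - \<gamma> t0 i\<bar> < d) \<longrightarrow>
       (\<forall>j<n. \<bar>q j z - part_deriv j f (\<gamma> t0)\<bar> < e)" using q(2) by blast
    have "\<forall>\<^sub>F t in at t0 within S. \<forall>i\<in>{..<n}. \<bar>\<gamma> t i - \<gamma> t0 i\<bar> < d"
    proof (rule eventually_ball_finite[OF finite_lessThan], rule ballI)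
      fix i assume "i \<in> {..<n}"
      then have "continuous (at t0 within S) (\<lambda>t. \<gamma> t i)"
        using D[of i] DERIV_continuous by auto
      then have "((\<lambda>t. \<gamma> t i) \<longlongrightarrow> \<gamma> t0 i) (at t0 within S)" by (simp add: continuous_within)
      from tendstoD[OF this d(1)] show "\<forall>\<^sub>F t in at t0 within S. \<bar>\<gamma> t i - \<gamma> t0 i\<bar> < d"
        by (simp add: dist_real_def)
    qed
    with inS show "\<forall>\<^sub>F t in at t0 within S. dist (q j (\<gamma> t)) (part_deriv j f (\<gamma> t0)) < e"
    proof eventually_elim
      case (elim t)
      then show ?case using d(2)[rule_format, OF \<gamma>S[of t], of j] j by (simp add: dist_real_def)
    qed
  qed
  have "((\<lambda>t. \<Sum>j<n. q j (\<gamma> t) * ((\<gamma> t j - \<gamma> t0 j) / (t - t0))) \<longlongrightarrow>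
      (\<Sum>j<n. part_deriv j f (\<gamma> t0) * D j)) (at t0 within S)"
    using D by (intro tendsto_sum tendsto_mult qlim) (auto simp: has_field_derivative_iff)
  moreover have "\<forall>\<^sub>F t in at t0 within S.
      (\<Sum>j<n. q j (\<gamma> t) * ((\<gamma> t j - \<gamma> t0 j) / (t - t0))) = (f (\<gamma> t) - f (\<gamma> t0)) / (t - t0)"
    using inS
  proof eventually_elim
    case (elim t)
    show ?case using q(1)[rule_format, OF \<gamma>S[OF elim]] by (simp add: sum_divide_distrib)
  qed
  ultimately show ?thesis
    unfolding has_field_derivative_iff by (rule Lim_transform_eventually)
qed

lemma Cr_on_compose_has_part_deriv:
  assumes V: "openin (Euclidean_space n) V" and W: "openin (Euclidean_space m) W"
    and GW: "\<And>x. x \<in> V \<Longrightarrow> G x \<in> W" and f: "Cr_on (Suc r) m W f"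
    and G: "\<And>l. l < m \<Longrightarrow> Cr_on (Suc r') n V (\<lambda>x. G x l)"
    and x: "x \<in> V" and i: "i < n"
  shows "((\<lambda>t. f (G (x(i := t)))) has_real_derivative
    (\<Sum>l<m. part_deriv l f (G x) * part_deriv i (\<lambda>x. G x l) x)) (at (x i))"
proof -
  define S where "S = interior {t. x(i := t) \<in> V}"
  have S: "open S" "x i \<in> S" "\<And>t. t \<in> S \<Longrightarrow> x(i := t) \<in> V"
    using eventually_upd_in[OF V x i] interior_subset unfolding S_def eventually_nhds
    by (auto simp: interior_def)
  have "((\<lambda>t. f (G (x(i := t)))) has_real_derivative
      (\<Sum>l<m. part_deriv l f (G (x(i := x i))) * part_deriv i (\<lambda>x. G x l) x)) (at (x i) within S)"
  proof (rule Cr_on_chain_curve[OF W f])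
    show "G (x(i := x i)) \<in> W" using GW[OF x] by simp
    show "G (x(i := t)) \<in> coord_space m" if "t \<in> S" for t
      using GW[OF S(3)[OF that]] openin_Euclidean_space_subset[OF W] by blast
    show "((\<lambda>t. G (x(i := t)) l) has_real_derivative part_deriv i (\<lambda>x. G x l) x) (at (x i) within S)"
      if "l < m" for l
      by (rule has_field_derivative_at_within[OF Cr_on_has_part_deriv[OF G[OF that] i x]])
  qed
  then show ?thesis unfolding at_within_open[OF S(2,1)] fun_upd_triv .
qed

lemma continuous_on_coord_space:
  fixes G :: "'a::topological_space \<Rightarrow> nat \<Rightarrow> real"
  assumes "\<And>l. l < m \<Longrightarrow> continuous_on V (\<lambda>x. G x l)" "\<And>x. x \<in> V \<Longrightarrow> G x \<in> coord_space m"
  shows "continuous_on V G"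
proof (rule continuous_on_coordinatewise_then_product)
  fix l
  show "continuous_on V (\<lambda>x. G x l)"
  proof (cases "l < m")
    case False
    then have "G x l = 0" if "x \<in> V" for x using assms(2)[OF that] by simp
    then show ?thesis by (subst continuous_on_cong[OF refl]) auto
  qed (rule assms(1))
qed

text \<open>Induction on r for all \<open>f\<close> at once: by the chain rule a partial derivative
  of the composite is a sum of products of \<open>part_deriv l f\<close> composed with
  \<open>G\<close>, covered by the induction hypothesis, and of partial derivatives of the
  components of \<open>G\<close>.\<close>

lemma Cr_on_compose:
  assumes V: "openin (Euclidean_space n) V" and W: "openin (Euclidean_space m) W"
    and GW: "\<And>x. x \<in> V \<Longrightarrow> G x \<in> W" and "Cr_on r m W f"
    and "\<And>l. l < m \<Longrightarrow> Cr_on r n V (\<lambda>x. G x l)"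
  shows "Cr_on r n V (\<lambda>x. f (G x))"
  using assms(4,5)
proof (induction r arbitrary: f)
  have subV: "V \<subseteq> coord_space n" by (rule openin_Euclidean_space_subset[OF V])
  have subW: "W \<subseteq> coord_space m" by (rule openin_Euclidean_space_subset[OF W])
  have cont: "continuous_on V (\<lambda>x. f (G x))"
    if "Cr_on r m W f" "\<And>l. l < m \<Longrightarrow> Cr_on r n V (\<lambda>x. G x l)" for f r
  proof (rule continuous_on_compose2[OF Cr_on_imp_continuous_on[OF subW that(1)]])
    show "continuous_on V G"
      by (rule continuous_on_coord_space[OF Cr_on_imp_continuous_on[OF subV that(2)]])
        (use GW subW in auto)
  qed (use GW in auto)
  {
    case 0
    show ?case using cont[OF 0] subV by (simp add: continuous_map_Euclidean_space_iff_on)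
  next
    case (Suc r)
    have D: "((\<lambda>t. f (G (x(i := t)))) has_real_derivative
        (\<Sum>l<m. part_deriv l f (G x) * part_deriv i (\<lambda>x. G x l) x)) (at (x i))"
      if "x \<in> V" "i < n" for x i
      using GW that by (intro Cr_on_compose_has_part_deriv[OF V W _ Suc.prems]) auto
    show ?case
    proof (rule Cr_on_SucI[OF subV cont[OF Suc.prems]])
      show "(\<lambda>t. f (G (x(i := t)))) differentiable at (x i)" if "i < n" "x \<in> V" for i x
        unfolding real_differentiable_def by (rule exI, rule D[OF that(2,1)])
    next
      fix i assume i: "i < n"
      have "Cr_on r n V (\<lambda>x. \<Sum>l<m. part_deriv l f (G x) * part_deriv i (\<lambda>x. G x l) x)"
      proof (rule Cr_on_sum[OF V], rule Cr_on_mult[OF V])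
        fix l assume "l \<in> {..<m}"
        then have l: "l < m" by simp
        show "Cr_on r n V (\<lambda>x. part_deriv l f (G x))"
          by (rule Suc.IH[OF Cr_on_part_deriv[OF Suc.prems(1) l] Cr_on_SucD[OF Suc.prems(2)]])
        show "Cr_on r n V (part_deriv i (\<lambda>x. G x l))"
          by (rule Cr_on_part_deriv[OF Suc.prems(2)[OF l] i])
      qed
      then show "Cr_on r n V (part_deriv i (\<lambda>x. f (G x)))"
        by (rule Cr_on_cong[OF V]) (rule DERIV_imp_deriv[OF D[OF _ i], symmetric])
    qed
  }
qed

section \<open>Smooth functions on arbitrary subsets\<close>

lemma smooth_on_subset_coord_space: "smooth_on n S f \<Longrightarrow> S \<subseteq> coord_space n"
  by (simp add: smooth_on_def topspace_Euclidean_space)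

lemma smooth_on_extension: "smooth_on n S f \<Longrightarrow> x \<in> S \<Longrightarrow> \<exists>g. local_smooth_extension n S f x g"
  by (simp add: smooth_on_def)

lemma smooth_onI:
  "S \<subseteq> coord_space n \<Longrightarrow> (\<And>x. x \<in> S \<Longrightarrow> \<exists>g. local_smooth_extension n S f x g) \<Longrightarrow> smooth_on n S f"
  by (simp add: smooth_on_def topspace_Euclidean_space)

lemma local_smooth_extensionE:
  assumes "local_smooth_extension n S f x g"
  obtains V where "openin (Euclidean_space n) V" "x \<in> V" "\<And>r. Cr_on r n V g" "\<And>y. y \<in> V \<Longrightarrow> y \<in> S \<Longrightarrow> g y = f y"
  using assms unfolding local_smooth_extension_def by blast

lemma local_smooth_extensionI:
  "openin (Euclidean_space n) V \<Longrightarrow> x \<in> V \<Longrightarrow> (\<And>r. Cr_on r n V g) \<Longrightarrow> (\<And>y. y \<in> V \<Longrightarrow> y \<in> S \<Longrightarrow> g y = f y)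
    \<Longrightarrow> local_smooth_extension n S f x g"
  unfolding local_smooth_extension_def by blast

lemma local_smooth_extension_mono:
  "local_smooth_extension n S f x g \<Longrightarrow> S' \<subseteq> S \<Longrightarrow> (\<And>y. y \<in> S' \<Longrightarrow> f y = f' y) \<Longrightarrow>
    local_smooth_extension n S' f' x g"
  unfolding local_smooth_extension_def by (metis IntD1 IntD2 IntI subsetD)

lemma smooth_on_cong_subset:
  assumes "smooth_on n S f" "S' \<subseteq> S" "\<And>y. y \<in> S' \<Longrightarrow> f y = f' y"
  shows "smooth_on n S' f'"
proof (rule smooth_onI)
  fix x assume x: "x \<in> S'"
  then obtain g where "local_smooth_extension n S f x g"
    using smooth_on_extension[OF assms(1)] assms(2) by blast
  then have "local_smooth_extension n S' f' x g"
    by (rule local_smooth_extension_mono) (use assms in auto)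
  then show "\<exists>g. local_smooth_extension n S' f' x g" by blast
qed (use smooth_on_subset_coord_space[OF assms(1)] assms(2) in blast)

text \<open>Shrinking the domain of an extension by the open set that cuts \<open>T\<close> out of
  \<open>S\<close> turns agreement on \<open>T\<close> into agreement on \<open>S\<close>.\<close>

lemma smooth_on_local:
  assumes "\<And>x. x \<in> S \<Longrightarrow> \<exists>T. openin (top_of_set S) T \<and> x \<in> T \<and> smooth_on n T f"
  shows "smooth_on n S f"
proof (rule smooth_onI)
  show "S \<subseteq> coord_space n"
    using assms smooth_on_subset_coord_space by blast
  fix x assume x: "x \<in> S"
  then obtain T where T: "openin (top_of_set S) T" "x \<in> T" "smooth_on n T f" using assms by blast
  then obtain U where U: "open U" "T = S \<inter> U" by (auto simp: openin_open)
  obtain g where "local_smooth_extension n T f x g" using smooth_on_extension[OF T(3,2)] ..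
  then obtain V where V: "openin (Euclidean_space n) V" "x \<in> V" "\<And>r. Cr_on r n V g"
      "\<And>y. y \<in> V \<Longrightarrow> y \<in> T \<Longrightarrow> g y = f y"
    by (rule local_smooth_extensionE) blast
  have "local_smooth_extension n S f x g"
  proof (rule local_smooth_extensionI)
    show "openin (Euclidean_space n) (V \<inter> U)"
      using V(1) U(1) unfolding Euclidean_space_eq by (auto simp: openin_open)
    show "Cr_on r n (V \<inter> U) g" for r
      by (rule Cr_on_subset[OF V(3)]) (use openin_Euclidean_space_subset[OF V(1)] in auto)
  qed (use V U T x in auto)
  then show "\<exists>g. local_smooth_extension n S f x g" by blast
qed

lemma continuous_on_local:
  fixes f :: "'a::t2_space \<Rightarrow> 'b::topological_space"
  assumes "\<And>x. x \<in> S \<Longrightarrow> \<exists>T. openin (top_of_set S) T \<and> x \<in> T \<and> continuous_on T f"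
  shows "continuous_on S f"
  unfolding continuous_on_eq_continuous_within
proof
  fix x assume "x \<in> S"
  then obtain T where T: "openin (top_of_set S) T" "x \<in> T" "continuous_on T f" using assms by blast
  then obtain U where U: "open U" "T = S \<inter> U" by (auto simp: openin_open)
  have "at x within S = at x within T"
    by (rule at_within_nhd[of x U]) (use T(2) U in auto)
  moreover have "continuous (at x within T) f"
    using T(2,3) unfolding continuous_on_eq_continuous_within by auto
  ultimately show "continuous (at x within S) f"
    by (simp only: continuous_within)
qed

lemma smooth_on_imp_continuous_on:
  assumes "smooth_on n S f"
  shows "continuous_on S f"
proof (rule continuous_on_local)
  fix x assume x: "x \<in> S"
  obtain g where "local_smooth_extension n S f x g" using smooth_on_extension[OF assms x] ..
  then obtain V where V: "openin (Euclidean_space n) V" "x \<in> V" "\<And>r. Cr_on r n V g"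
      "\<And>y. y \<in> V \<Longrightarrow> y \<in> S \<Longrightarrow> g y = f y"
    by (rule local_smooth_extensionE) blast
  then obtain U where U: "open U" "V = coord_space n \<inter> U"
    unfolding Euclidean_space_eq by (auto simp: openin_open)
  have "continuous_on (S \<inter> U) f"
  proof (rule continuous_on_eq)
    show "continuous_on (S \<inter> U) g"
      by (rule continuous_on_subset[OF Cr_on_imp_continuous_on[OF openin_Euclidean_space_subset[OF V(1)] V(3)]])
        (use smooth_on_subset_coord_space[OF assms] U(2) in auto)
    show "g y = f y" if "y \<in> S \<inter> U" for y
      using V(4) that U(2) smooth_on_subset_coord_space[OF assms] by auto
  qed
  then show "\<exists>T. openin (top_of_set S) T \<and> x \<in> T \<and> continuous_on T f"
    using x V(2) U openin_open_Int[OF U(1)] by blast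
qed

lemma local_smooth_extension_const: "S \<subseteq> coord_space n \<Longrightarrow> x \<in> S \<Longrightarrow> local_smooth_extension n S (\<lambda>_. c) x (\<lambda>_. c)"
  by (rule local_smooth_extensionI[where V = "coord_space n"])
    (auto simp: Euclidean_space_eq Cr_on_const)

lemma smooth_on_const: "S \<subseteq> coord_space n \<Longrightarrow> smooth_on n S (\<lambda>_. c)"
  by (rule smooth_onI) (auto intro: local_smooth_extension_const)

text \<open>One statement for sums, products and differences, which differ only in the closure rule
  \<open>op\<close>; the two extensions are combined on the intersection of their domains.\<close>

lemma local_smooth_extension_binop:
  assumes "local_smooth_extension n S f1 x g1" "local_smooth_extension n S f2 x g2"
    and op: "\<And>V r. openin (Euclidean_space n) V \<Longrightarrow> Cr_on r n V g1 \<Longrightarrow> Cr_on r n V g2 \<Longrightarrow> Cr_on r n V (\<lambda>x. b (g1 x) (g2 x))"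
  shows "local_smooth_extension n S (\<lambda>x. b (f1 x) (f2 x)) x (\<lambda>x. b (g1 x) (g2 x))"
proof -
  obtain V where V: "openin (Euclidean_space n) V" "x \<in> V" "\<And>r. Cr_on r n V g1"
      "\<And>y. y \<in> V \<Longrightarrow> y \<in> S \<Longrightarrow> g1 y = f1 y"
    using assms(1) by (rule local_smooth_extensionE) blast
  obtain W where W: "openin (Euclidean_space n) W" "x \<in> W" "\<And>r. Cr_on r n W g2"
      "\<And>y. y \<in> W \<Longrightarrow> y \<in> S \<Longrightarrow> g2 y = f2 y"
    using assms(2) by (rule local_smooth_extensionE) blast
  show ?thesis
  proof (rule local_smooth_extensionI)
    show o: "openin (Euclidean_space n) (V \<inter> W)" using V(1) W(1) by (rule openin_Int)
    show "Cr_on r n (V \<inter> W) (\<lambda>x. b (g1 x) (g2 x))" for r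
      by (rule op[OF o Cr_on_subset[OF V(3)] Cr_on_subset[OF W(3)]])
        (use openin_Euclidean_space_subset[OF V(1)] openin_Euclidean_space_subset[OF W(1)] in auto)
  qed (use V W in auto)
qed

lemmas local_smooth_extension_add = local_smooth_extension_binop[where b = "(+)", OF _ _ Cr_on_add]
lemmas local_smooth_extension_mult = local_smooth_extension_binop[where b = "(*)", OF _ _ Cr_on_mult]

lemma smooth_on_add: "smooth_on n S f \<Longrightarrow> smooth_on n S g \<Longrightarrow> smooth_on n S (\<lambda>x. f x + g x)"
  by (rule smooth_onI[OF smooth_on_subset_coord_space], assumption)
    (blast dest: smooth_on_extension intro: local_smooth_extension_add)

lemma smooth_on_mult: "smooth_on n S f \<Longrightarrow> smooth_on n S g \<Longrightarrow> smooth_on n S (\<lambda>x. f x * g x)"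
  by (rule smooth_onI[OF smooth_on_subset_coord_space], assumption)
    (blast dest: smooth_on_extension intro: local_smooth_extension_mult)

text \<open>The extension of the map \<open>F\<close> is assembled from extensions
  \<open>h l\<close> of its components, filled up with 0 so that it takes values in
  \<open>coord_space m\<close>. The second conclusion is the chain rule for exactly this extension,
  which is what computes the differential of a composite.\<close>

lemma local_smooth_extension_compose:
  assumes S: "S \<subseteq> coord_space n" and T: "T \<subseteq> coord_space m" and F: "\<And>y. y \<in> S \<Longrightarrow> F y \<in> T" and x: "x \<in> S"
    and g: "local_smooth_extension m T f (F x) g"
    and h: "\<And>l. l < m \<Longrightarrow> local_smooth_extension n S (\<lambda>y. F y l) x (h l)"
  shows "local_smooth_extension n S (\<lambda>y. f (F y)) x (\<lambda>y. g (\<lambda>l. if l < m then h l y else 0))"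
    and "i < n \<Longrightarrow> part_deriv i (\<lambda>y. g (\<lambda>l. if l < m then h l y else 0)) x =
          (\<Sum>l<m. part_deriv l g (F x) * part_deriv i (h l) x)"
proof -
  define G where "G y = (\<lambda>l. if l < m then h l y else 0)" for y
  obtain W where W: "openin (Euclidean_space m) W" "F x \<in> W" "\<And>r. Cr_on r m W g"
      "\<And>y. y \<in> W \<Longrightarrow> y \<in> T \<Longrightarrow> g y = f y"
    using g by (rule local_smooth_extensionE) blast
  have "\<forall>l<m. \<exists>V. openin (Euclidean_space n) V \<and> x \<in> V \<and> (\<forall>r. Cr_on r n V (h l)) \<and> (\<forall>y\<in>V \<inter> S. h l y = F y l)"
    using h by (auto simp: local_smooth_extension_def)
  then obtain V where V: "\<And>l. l < m \<Longrightarrow> openin (Euclidean_space n) (V l)" "\<And>l. l < m \<Longrightarrow> x \<in> V l"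
      "\<And>l r. l < m \<Longrightarrow> Cr_on r n (V l) (h l)" "\<And>l y. l < m \<Longrightarrow> y \<in> V l \<Longrightarrow> y \<in> S \<Longrightarrow> h l y = F y l"
    by (metis IntI)
  \<comment> \<open>The whole space is included as a factor for the case m = 0, where there is no
    \<open>V l\<close>.\<close>
  define V0 where "V0 = \<Inter>(insert (coord_space n) (V ` {..<m}))"
  have V0: "openin (Euclidean_space n) V0"
    unfolding V0_def using V(1) by (intro openin_Inter) (auto simp: Euclidean_space_eq)
  have V0sub: "V0 \<subseteq> coord_space n" "\<And>l. l < m \<Longrightarrow> V0 \<subseteq> V l" by (auto simp: V0_def)
  have C0: "Cr_on r n V0 (h l)" if "l < m" for r l
    by (rule Cr_on_subset[OF V(3)[OF that] V0sub(2)[OF that] openin_Euclidean_space_subset[OF V(1)[OF that]]])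
  have GF: "G y = F y" if "y \<in> V0" "y \<in> S" for y
  proof
    fix l
    show "G y l = F y l"
    proof (cases "l < m")
      case True
      then show ?thesis using V(4)[OF True] V0sub(2)[OF True] that by (auto simp: G_def)
    next
      case False
      then show ?thesis using F[OF that(2)] T by (auto simp: G_def)
    qed
  qed
  have x0: "x \<in> V0" using x S V(2) by (auto simp: V0_def)
  obtain U where U: "open U" "W = coord_space m \<inter> U"
    using W(1) unfolding Euclidean_space_eq by (auto simp: openin_open)
  have contG: "continuous_on V0 G"
    by (rule continuous_on_coord_space[where m = m])
      (auto simp: G_def intro: Cr_on_imp_continuous_on[OF V0sub(1) C0])
  \<comment> \<open>The points that the assembled map sends into the domain \<open>W\<close> of
    \<open>g\<close>; these form an open set because \<open>G\<close> is continuous with values in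
    \<open>coord_space m\<close>.\<close>
  define V1 where "V1 = V0 \<inter> G -` U"
  have "openin (top_of_set V0) V1" unfolding V1_def
    by (rule continuous_openin_preimage_gen[OF contG U(1)])
  then have V1: "openin (Euclidean_space n) V1"
    using V0 unfolding Euclidean_space_eq by (rule openin_trans)
  have V1V0: "V1 \<subseteq> V0" by (auto simp: V1_def)
  have GW: "G y \<in> W" if "y \<in> V1" for y using that U(2) by (auto simp: V1_def G_def)
  have x1: "x \<in> V1" using x0 GF[OF x0 x] W(2) U(2) by (auto simp: V1_def)
  have C1: "Cr_on r n V1 (\<lambda>y. G y l)" if "l < m" for r l
    using Cr_on_subset[OF C0[OF that] V1V0 V0sub(1)] that by (simp add: G_def)
  show "local_smooth_extension n S (\<lambda>y. f (F y)) x (\<lambda>y. g (\<lambda>l. if l < m then h l y else 0))"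
    unfolding G_def[symmetric]
  proof (rule local_smooth_extensionI[OF V1 x1])
    show "Cr_on r n V1 (\<lambda>y. g (G y))" for r
      by (rule Cr_on_compose[OF V1 W(1) GW W(3) C1])
    show "g (G y) = f (F y)" if "y \<in> V1" "y \<in> S" for y
      using GF[of y] GW[OF that(1)] W(4)[of "F y"] V1V0 F[OF that(2)] that by auto
  qed
  assume i: "i < n"
  have "part_deriv i (\<lambda>y. g (G y)) x = (\<Sum>l<m. part_deriv l g (G x) * part_deriv i (\<lambda>y. G y l) x)"
    by (rule DERIV_imp_deriv[OF Cr_on_compose_has_part_deriv[OF V1 W(1) GW W(3) C1 x1 i]])
  also have "\<dots> = (\<Sum>l<m. part_deriv l g (F x) * part_deriv i (h l) x)"
    using GF[OF x0 x] by (intro sum.cong) (auto simp: G_def)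
  finally show "part_deriv i (\<lambda>y. g (\<lambda>l. if l < m then h l y else 0)) x =
      (\<Sum>l<m. part_deriv l g (F x) * part_deriv i (h l) x)"
    unfolding G_def .
qed

lemma smooth_vec_onD: "smooth_vec_on n S F \<Longrightarrow> smooth_on n S (\<lambda>x. F x j)"
  by (simp add: smooth_vec_on_def)

lemma smooth_on_compose:
  assumes "smooth_vec_on n S F" "smooth_on m T f" "\<And>y. y \<in> S \<Longrightarrow> F y \<in> T"
  shows "smooth_on n S (\<lambda>y. f (F y))"
proof (rule smooth_onI)
  show S: "S \<subseteq> coord_space n" by (rule smooth_on_subset_coord_space[OF smooth_vec_onD[OF assms(1)]])
  fix x assume x: "x \<in> S"
  obtain g where g: "local_smooth_extension m T f (F x) g"
    using smooth_on_extension[OF assms(2) assms(3)[OF x]] ..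
  have "\<forall>l. \<exists>h. local_smooth_extension n S (\<lambda>y. F y l) x h"
    using smooth_on_extension[OF smooth_vec_onD[OF assms(1)] x] by blast
  then obtain h where h: "\<And>l. local_smooth_extension n S (\<lambda>y. F y l) x (h l)" by metis
  show "\<exists>g. local_smooth_extension n S (\<lambda>y. f (F y)) x g"
    using local_smooth_extension_compose(1)[OF S smooth_on_subset_coord_space[OF assms(2)] assms(3) x g h] by blast
qed

lemma smooth_vec_on_compose:
  assumes "smooth_vec_on n S F" "smooth_vec_on m T G" "\<And>y. y \<in> S \<Longrightarrow> F y \<in> T"
  shows "smooth_vec_on n S (\<lambda>y. G (F y))"
  using smooth_on_compose[OF assms(1) smooth_vec_onD[OF assms(2)] assms(3)] by (simp add: smooth_vec_on_def)

text \<open>Directions along which the derivative of a local smooth extension does not depend on the choice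
  of the extension.\<close>

definition determined_dir :: "nat \<Rightarrow> (nat \<Rightarrow> real) set \<Rightarrow> (nat \<Rightarrow> real) \<Rightarrow> (nat \<Rightarrow> real) \<Rightarrow> bool" where
  "determined_dir n S x v \<longleftrightarrow>
     (\<forall>g. local_smooth_extension n S (\<lambda>_. 0) x g \<longrightarrow> (\<Sum>i<n. v i * part_deriv i g x) = 0)"

lemma determined_dir_mono: "determined_dir n S' x v \<Longrightarrow> S' \<subseteq> S \<Longrightarrow> determined_dir n S x v"
  unfolding determined_dir_def
  using local_smooth_extension_mono[where S = S and S' = S' and f = "\<lambda>_. 0" and f' = "\<lambda>_. 0"] by simp

lemma determined_dir_lincomb:
  assumes "\<And>k. k \<in> K \<Longrightarrow> determined_dir n S x (u k)" "\<And>i. i < n \<Longrightarrow> v i = (\<Sum>k\<in>K. a k * u k i)"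
  shows "determined_dir n S x v"
  unfolding determined_dir_def
proof (intro allI impI)
  fix g assume g: "local_smooth_extension n S (\<lambda>_. 0) x g"
  have "(\<Sum>i<n. v i * part_deriv i g x) = (\<Sum>i<n. \<Sum>k\<in>K. a k * (u k i * part_deriv i g x))"
    using assms(2) by (intro sum.cong) (auto simp: sum_distrib_right mult.assoc)
  also have "\<dots> = (\<Sum>k\<in>K. a k * (\<Sum>i<n. u k i * part_deriv i g x))"
    by (subst sum.swap) (simp add: sum_distrib_left)
  also have "\<dots> = 0"
    using assms(1) g by (intro sum.neutral) (auto simp: determined_dir_def)
  finally show "(\<Sum>i<n. v i * part_deriv i g x) = 0" .
qed

text \<open>Every extension of the zero function vanishes along the segment, so its one-sided
  derivative at the starting point is 0; the chain rule identifies this derivative with the sum in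
  question.\<close>

lemma determined_dir_segment:
  assumes S: "S \<subseteq> coord_space n" and e: "e > 0" and seg: "\<And>t. 0 \<le> t \<Longrightarrow> t \<le> e \<Longrightarrow> (\<lambda>i. x i + t * u i) \<in> S"
  shows "determined_dir n S x u"
  unfolding determined_dir_def
proof (intro allI impI)
  fix g assume "local_smooth_extension n S (\<lambda>_. 0) x g"
  then obtain V where V: "openin (Euclidean_space n) V" "x \<in> V" "\<And>r. Cr_on r n V g"
      "\<And>y. y \<in> V \<Longrightarrow> y \<in> S \<Longrightarrow> g y = 0"
    by (rule local_smooth_extensionE) blast
  define \<gamma> where "\<gamma> t = (\<lambda>i. x i + t * u i)" for t
  obtain d where d: "d > 0" "\<forall>z\<in>coord_space n. (\<forall>i<n. \<bar>z i - x i\<bar> < d) \<longrightarrow> z \<in> V"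
    using openin_Euclidean_space_box[OF V(1,2)] by blast
  \<comment> \<open>The summand 1 makes \<open>B\<close> positive and the bound strict; up to time
    \<open>d / B\<close> the segment stays in the box of radius d around \<open>x\<close>.\<close>
  define B where "B = (\<Sum>i<n. \<bar>u i\<bar>) + 1"
  have B: "B > 0" "\<And>i. i < n \<Longrightarrow> \<bar>u i\<bar> < B"
  proof -
    show "B > 0" unfolding B_def by (simp add: add_nonneg_pos sum_nonneg)
    show "\<bar>u i\<bar> < B" if "i < n" for i
      using member_le_sum[of i "{..<n}" "\<lambda>i. \<bar>u i\<bar>"] that unfolding B_def by simp
  qed
  define e' where "e' = min e (d / B)"
  have e': "e' > 0" "e' \<le> e" using e d(1) B(1) by (auto simp: e'_def)
  have \<gamma>: "\<gamma> t \<in> V \<and> \<gamma> t \<in> S" if t: "t \<in> {0..e'}" for t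
  proof -
    have S1: "\<gamma> t \<in> S" using seg[of t] t e' by (simp add: \<gamma>_def)
    have "\<bar>\<gamma> t i - x i\<bar> < d" if i: "i < n" for i
    proof (cases "t = 0")
      case True
      then show ?thesis using d(1) by (simp add: \<gamma>_def)
    next
      case False
      then have "\<bar>\<gamma> t i - x i\<bar> = t * \<bar>u i\<bar>" using t by (simp add: \<gamma>_def abs_mult)
      also have "\<dots> < t * B" using B(2)[OF i] False t by (intro mult_strict_left_mono) auto
      also have "\<dots> \<le> (d / B) * B" using t B(1) by (intro mult_right_mono) (auto simp: e'_def)
      finally show ?thesis using B(1) by simp
    qed
    then show ?thesis using d(2) S1 S by blast
  qed
  have \<gamma>0: "\<gamma> 0 = x" by (simp add: \<gamma>_def)
  have "((\<lambda>t. g (\<gamma> t)) has_real_derivative (\<Sum>j<n. part_deriv j g (\<gamma> 0) * u j)) (at 0 within {0..e'})"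
  proof (rule Cr_on_chain_curve[OF V(1) V(3)[of "Suc 0"]])
    show "\<gamma> 0 \<in> V" using V(2) \<gamma>0 by simp
    show "\<gamma> t \<in> coord_space n" if "t \<in> {0..e'}" for t using \<gamma>[OF that] S by blast
    show "((\<lambda>t. \<gamma> t j) has_real_derivative u j) (at 0 within {0..e'})" for j
      unfolding \<gamma>_def by (auto intro!: derivative_eq_intros)
  qed
  moreover have "((\<lambda>t. g (\<gamma> t)) has_real_derivative 0) (at 0 within {0..e'})"
  proof (rule has_field_derivative_transform_within[where f = "\<lambda>_. 0" and d = 1])
    show "0 = g (\<gamma> t)" if "t \<in> {0..e'}" for t using \<gamma>[OF that] V(4)[of "\<gamma> t"] by simp
  qed (use e' in auto)
  moreover have "at 0 within {0..e'} \<noteq> bot"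
    using e'(1) by (simp add: at_within_Icc_at_right trivial_limit_at_right_real)
  ultimately have "(\<Sum>j<n. part_deriv j g (\<gamma> 0) * u j) = 0"
    by (rule has_field_derivative_unique)
  then show "(\<Sum>i<n. u i * part_deriv i g x) = 0" using \<gamma>0 by (simp add: mult.commute)
qed

text \<open>At boundary points too every direction is determined: each coordinate vector points into
  the half space, and these vectors span.\<close>

lemma determined_dir_half_space:
  assumes "openin (half_space n) S" "x \<in> S"
  shows "determined_dir n S x v"
proof (rule determined_dir_lincomb)
  obtain V where V: "openin (Euclidean_space n) V" "S = V \<inter> {x. 0 \<le> x 0}"
    using assms(1) unfolding half_space_def openin_subtopology by blast
  have Vsub: "V \<subseteq> coord_space n" by (rule openin_Euclidean_space_subset[OF V(1)])
  obtain d where d: "d > 0" "\<forall>z\<in>coord_space n. (\<forall>i<n. \<bar>z i - x i\<bar> < d) \<longrightarrow> z \<in> V"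
    using openin_Euclidean_space_box[OF V(1)] assms(2) V(2) by blast
  show "determined_dir n S x (unit_vec k)" if k: "k \<in> {..<n}" for k
  proof (rule determined_dir_segment[where e = "d / 2"])
    show "S \<subseteq> coord_space n" using V Vsub by blast
    show "d / 2 > 0" using d(1) by simp
    show "(\<lambda>i. x i + t * unit_vec k i) \<in> S" if t: "0 \<le> t" "t \<le> d / 2" for t
    proof -
      have "(\<lambda>i. x i + t * unit_vec k i) \<in> V"
        using d(1) t k assms(2) V(2) Vsub by (intro d(2)[rule_format]) (auto simp: unit_vec_def)
      moreover have "0 \<le> x 0 + t * unit_vec k 0"
        using t assms(2) V(2) by (auto simp: unit_vec_def)
      ultimately show ?thesis using V(2) by simp
    qed
  qed
  show "v i = (\<Sum>k\<in>{..<n}. v k * unit_vec k i)" if "i < n" for i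
  proof -
    have "(\<Sum>k\<in>{..<n}. v k * unit_vec k i) = (\<Sum>k\<in>{..<n}. if k = i then v i else 0)"
      by (rule sum.cong) (auto simp: unit_vec_def)
    then show ?thesis using that by simp
  qed
qed

lemma standard_simplex_subset_coord_space: "standard_simplex p \<subseteq> coord_space (Suc p)"
  by (auto simp: standard_simplex_def)

text \<open>The directions from \<open>x\<close> towards the vertices are determined by convexity. A
  vector with coordinate sum 0 is the combination of them with its own coordinates as coefficients,
  since the multiples of \<open>x\<close> then add up to 0.\<close>

lemma determined_dir_simplex:
  assumes S: "openin (top_of_set (standard_simplex p)) S" "x \<in> S" and v: "(\<Sum>i\<le>p. v i) = 0"
  shows "determined_dir (Suc p) S x v"
proof (rule determined_dir_lincomb)
  obtain U where U: "open U" "S = standard_simplex p \<inter> U" using S(1) by (auto simp: openin_open)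
  have xs: "x \<in> standard_simplex p" "x \<in> U" using U S by auto
  have V: "openin (Euclidean_space (Suc p)) (coord_space (Suc p) \<inter> U)"
    unfolding Euclidean_space_eq using U(1) by (rule openin_open_Int)
  obtain d where d: "d > 0"
      "\<forall>z\<in>coord_space (Suc p). (\<forall>i<Suc p. \<bar>z i - x i\<bar> < d) \<longrightarrow> z \<in> coord_space (Suc p) \<inter> U"
    using openin_Euclidean_space_box[OF V, of x] xs standard_simplex_subset_coord_space by blast
  show "determined_dir (Suc p) S x (\<lambda>i. unit_vec k i - x i)" if k: "k \<in> {..p}" for k
  \<comment> \<open>Up to time 1 convexity keeps the segment in the simplex; up to time
    \<open>d / 2\<close> it stays in the open set \<open>U\<close>, because its direction has
    coordinates of absolute value at most 1.\<close>
  proof (rule determined_dir_segment[where e = "min 1 (d / 2)"])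
    show "S \<subseteq> coord_space (Suc p)" using U(2) standard_simplex_subset_coord_space by blast
    show "min 1 (d / 2) > 0" using d(1) by simp
    show "(\<lambda>i. x i + t * (unit_vec k i - x i)) \<in> S" if t: "0 \<le> t" "t \<le> min 1 (d / 2)" for t
    proof -
      have "unit_vec k \<in> standard_simplex p" using k by (simp add: unit_vec_def)
      then have "(\<lambda>i. (1 - t) * x i + t * unit_vec k i) \<in> standard_simplex p"
        using convex_standard_simplex[OF xs(1), of "unit_vec k" t] t by simp
      moreover have "(\<lambda>i. (1 - t) * x i + t * unit_vec k i) = (\<lambda>i. x i + t * (unit_vec k i - x i))"
        by (simp add: algebra_simps)
      ultimately have s: "(\<lambda>i. x i + t * (unit_vec k i - x i)) \<in> standard_simplex p" by simp
      have "(\<lambda>i. x i + t * (unit_vec k i - x i)) \<in> coord_space (Suc p) \<inter> U"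
      proof (rule d(2)[rule_format])
        show "(\<lambda>i. x i + t * (unit_vec k i - x i)) \<in> coord_space (Suc p)"
          using s standard_simplex_subset_coord_space by blast
        fix i
        have "0 \<le> x i \<and> x i \<le> 1" using xs(1) by (simp add: standard_simplex_def)
        then have "\<bar>unit_vec k i - x i\<bar> \<le> 1" by (auto simp: unit_vec_def)
        then have "t * \<bar>unit_vec k i - x i\<bar> \<le> t * 1" using t(1) by (intro mult_left_mono)
        then show "\<bar>x i + t * (unit_vec k i - x i) - x i\<bar> < d" using t d(1) by (simp add: abs_mult)
      qed
      then show ?thesis using s U(2) by simp
    qed
  qed
  show "v i = (\<Sum>k\<in>{..p}. v k * (unit_vec k i - x i))" if "i < Suc p" for i
  proof -
    have "(\<Sum>k\<in>{..p}. v k * (unit_vec k i - x i)) = (\<Sum>k\<in>{..p}. v k * unit_vec k i) - (\<Sum>k\<in>{..p}. v k) * x i"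
      by (simp add: right_diff_distrib sum_subtractf sum_distrib_right)
    also have "(\<Sum>k\<in>{..p}. v k * unit_vec k i) = (\<Sum>k\<in>{..p}. if k = i then v i else 0)"
      by (rule sum.cong) (auto simp: unit_vec_def)
    finally show ?thesis using that v by simp
  qed
qed

section \<open>The differential of a smooth map\<close>

lemma differential_lincomb:
  "differential n S F x (\<lambda>i. a * u i + b * w i) = (\<lambda>j. a * differential n S F x u j + b * differential n S F x w j)"
  by (simp add: differential_def Let_def sum.distrib sum_distrib_left algebra_simps)

text \<open>Frees \<open>differential\<close> from the choice in its definition: two extensions
  differ by an extension of 0, whose derivative in a determined direction vanishes.\<close>

lemma differential_eq:
  assumes "determined_dir n S x v" "local_smooth_extension n S (\<lambda>y. F y j) x g"
  shows "differential n S F x v j = (\<Sum>i<n. v i * part_deriv i g x)"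
proof -
  define g' where "g' = (SOME g. local_smooth_extension n S (\<lambda>y. F y j) x g)"
  have g': "local_smooth_extension n S (\<lambda>y. F y j) x g'"
    unfolding g'_def by (rule someI[of "local_smooth_extension n S (\<lambda>y. F y j) x", OF assms(2)])
  obtain V where V: "openin (Euclidean_space n) V" "x \<in> V" "\<And>r. Cr_on r n V g"
    using assms(2) by (rule local_smooth_extensionE) blast
  obtain V' where V': "openin (Euclidean_space n) V'" "x \<in> V'" "\<And>r. Cr_on r n V' g'"
    using g' by (rule local_smooth_extensionE) blast
  have op: "Cr_on r n U (\<lambda>x. g' x - g x)"
    if U: "openin (Euclidean_space n) U" "Cr_on r n U g'" "Cr_on r n U g" for U r
    using Cr_on_add[OF U(1,2) Cr_on_mult[OF U(1) Cr_on_const[OF openin_Euclidean_space_subset[OF U(1)], of r "-1"] U(3)]]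
    by simp
  have "local_smooth_extension n S (\<lambda>y. F y j - F y j) x (\<lambda>y. g' y - g y)"
    by (rule local_smooth_extension_binop[where b = "(-)", OF g' assms(2) op])
  then have "local_smooth_extension n S (\<lambda>y. 0) x (\<lambda>y. g' y - g y)" by simp
  then have "(\<Sum>i<n. v i * part_deriv i (\<lambda>y. g' y - g y) x) = 0"
    by (rule assms(1)[unfolded determined_dir_def, rule_format])
  moreover have "part_deriv i (\<lambda>y. g' y - g y) x = part_deriv i g' x - part_deriv i g x" if "i < n" for i
    by (rule DERIV_imp_deriv[OF DERIV_diff[OF
          Cr_on_has_part_deriv[OF V'(3)[of "Suc 0"] that V'(2)] Cr_on_has_part_deriv[OF V(3)[of "Suc 0"] that V(2)]]])
  ultimately have "(\<Sum>i<n. v i * part_deriv i g' x) = (\<Sum>i<n. v i * part_deriv i g x)"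
    by (simp add: right_diff_distrib sum_subtractf)
  then show ?thesis unfolding differential_def Let_def g'_def .
qed

text \<open>An extension for the larger set is also one for the smaller set, and the direction is
  determined even there. Differentials of maps with different domains are compared by moving them to
  a common subset.\<close>

lemma differential_subset:
  assumes F: "smooth_vec_on n S F" and S': "S' \<subseteq> S" "x \<in> S'" "determined_dir n S' x v"
    and eq: "\<And>y. y \<in> S' \<Longrightarrow> F y = F' y"
  shows "differential n S F x v = differential n S' F' x v"
proof
  fix j
  obtain g where g: "local_smooth_extension n S (\<lambda>y. F y j) x g"
    using smooth_on_extension[OF smooth_vec_onD[OF F]] S' by blast
  have "local_smooth_extension n S' (\<lambda>y. F' y j) x g"
    by (rule local_smooth_extension_mono[OF g S'(1)]) (simp add: eq)
  then show "differential n S F x v j = differential n S' F' x v j"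
    using differential_eq[where F = F, OF determined_dir_mono[OF S'(3,1)] g]
      differential_eq[where F = F', OF S'(3)] by simp
qed

text \<open>Both vectors have to be determined, \<open>v\<close> for \<open>F\<close> and its image
  for \<open>G\<close>, so that the extensions used in the chain rule may stand for the chosen
  ones.\<close>

lemma differential_compose:
  assumes F: "smooth_vec_on n S F" and G: "smooth_vec_on m T G" and FT: "\<And>y. y \<in> S \<Longrightarrow> F y \<in> T"
    and x: "x \<in> S" and v: "determined_dir n S x v" and w: "determined_dir m T (F x) (differential n S F x v)"
  shows "differential n S (\<lambda>y. G (F y)) x v = differential m T G (F x) (differential n S F x v)"
proof
  fix j
  have S: "S \<subseteq> coord_space n" by (rule smooth_on_subset_coord_space[OF smooth_vec_onD[OF F]])
  have T: "T \<subseteq> coord_space m" by (rule smooth_on_subset_coord_space[OF smooth_vec_onD[OF G]])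
  obtain g where g: "local_smooth_extension m T (\<lambda>y. G y j) (F x) g"
    using smooth_on_extension[OF smooth_vec_onD[OF G] FT[OF x]] by blast
  have "\<forall>l. \<exists>h. local_smooth_extension n S (\<lambda>y. F y l) x h"
    using smooth_on_extension[OF smooth_vec_onD[OF F] x] by blast
  from choice[OF this] obtain h where "\<forall>l. local_smooth_extension n S (\<lambda>y. F y l) x (h l)" ..
  then have h: "local_smooth_extension n S (\<lambda>y. F y l) x (h l)" for l by (rule spec)
  note c = local_smooth_extension_compose[where f = "\<lambda>y. G y j", OF S T FT x g h]
  have "differential n S (\<lambda>y. G (F y)) x v j =
      (\<Sum>i<n. v i * part_deriv i (\<lambda>y. g (\<lambda>l. if l < m then h l y else 0)) x)"
    by (rule differential_eq[where F = "\<lambda>y. G (F y)", OF v c(1)])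
  also have "\<dots> = (\<Sum>i<n. \<Sum>l<m. v i * part_deriv i (h l) x * part_deriv l g (F x))"
    using c(2) by (intro sum.cong) (auto simp: sum_distrib_left mult_ac)
  also have "\<dots> = (\<Sum>l<m. differential n S F x v l * part_deriv l g (F x))"
    by (subst sum.swap) (simp add: differential_eq[where F = F, OF v h] sum_distrib_right)
  also have "\<dots> = differential m T G (F x) (differential n S F x v) j"
    by (rule differential_eq[where F = G, OF w g, symmetric])
  finally show "differential n S (\<lambda>y. G (F y)) x v j = \<dots>" .
qed

text \<open>A component of \<open>F\<close> that vanishes on \<open>S\<close> has the extension 0,
  and in a determined direction this extension may be used.\<close>

lemma differential_in_coord_space:
  assumes "x \<in> S" "S \<subseteq> coord_space n" "determined_dir n S x v" "\<And>y. y \<in> S \<Longrightarrow> F y \<in> coord_space m"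
  shows "differential n S F x v \<in> coord_space m"
proof -
  have "differential n S F x v j = 0" if "m \<le> j" for j
  proof -
    have "local_smooth_extension n S (\<lambda>y. F y j) x (\<lambda>_. 0)"
      by (rule local_smooth_extension_mono[OF local_smooth_extension_const[OF assms(2,1)]])
        (use assms(4) that in auto)
    then show ?thesis by (simp add: differential_eq[where F = F, OF assms(3)])
  qed
  then show ?thesis by simp
qed

text \<open>Holds for every \<open>v\<close>, because the extension chosen in
  \<open>differential\<close> depends on the point and the component but not on the vector.\<close>

lemma differential_eq_sum:
  "differential n S F x v i = (\<Sum>j<n. v j * differential n S F x (unit_vec j) i)"
proof -
  have "(\<Sum>l<n. unit_vec j l * a l) = a j" if "j < n" for j and a :: "nat \<Rightarrow> real"
  proof -
    have "(\<Sum>l<n. unit_vec j l * a l) = (\<Sum>l<n. if l = j then a j else 0)"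
      by (rule sum.cong) (auto simp: unit_vec_def)
    then show ?thesis using that by simp
  qed
  then show ?thesis by (simp add: differential_def Let_def)
qed

text \<open>Near \<open>x\<close> a single extension \<open>g\<close> computes the differential at
  all points, by independence of the choice; there the differential is a combination of the
  continuous partial derivatives of \<open>g\<close>.\<close>

lemma continuous_on_differential:
  assumes F: "smooth_vec_on n S F" and v: "\<And>x. x \<in> S \<Longrightarrow> determined_dir n S x v"
  shows "continuous_on S (\<lambda>x. differential n S F x v j)"
proof (rule continuous_on_local)
  fix x assume x: "x \<in> S"
  obtain g where "local_smooth_extension n S (\<lambda>y. F y j) x g"
    using smooth_on_extension[OF smooth_vec_onD[OF F] x] by blast
  then obtain V where V: "openin (Euclidean_space n) V" "x \<in> V" "\<And>r. Cr_on r n V g"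
      "\<And>y. y \<in> V \<Longrightarrow> y \<in> S \<Longrightarrow> g y = F y j"
    by (rule local_smooth_extensionE) blast
  have S: "S \<subseteq> coord_space n" by (rule smooth_on_subset_coord_space[OF smooth_vec_onD[OF F]])
  have Vsub: "V \<subseteq> coord_space n" by (rule openin_Euclidean_space_subset[OF V(1)])
  obtain U where U: "open U" "V = coord_space n \<inter> U"
    using V(1) unfolding Euclidean_space_eq by (auto simp: openin_open)
  have eq: "differential n S F y v j = (\<Sum>i<n. v i * part_deriv i g y)" if y: "y \<in> S \<inter> U" for y
  proof (rule differential_eq)
    show "determined_dir n S y v" using v y by blast
    show "local_smooth_extension n S (\<lambda>y. F y j) y g"
      by (rule local_smooth_extensionI[OF V(1) _ V(3,4)]) (use y S U(2) in auto)
  qed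
  have "continuous_on V (\<lambda>y. \<Sum>i<n. v i * part_deriv i g y)"
    by (intro continuous_on_sum continuous_on_mult continuous_on_const
        Cr_on_imp_continuous_on[OF Vsub Cr_on_part_deriv[OF V(3)[of "Suc 0"]]]) auto
  then have "continuous_on (S \<inter> U) (\<lambda>y. \<Sum>i<n. v i * part_deriv i g y)"
    by (rule continuous_on_subset) (use S U(2) in auto)
  then have "continuous_on (S \<inter> U) (\<lambda>y. differential n S F y v j)"
    by (rule continuous_on_eq) (simp add: eq)
  then show "\<exists>T. openin (top_of_set S) T \<and> x \<in> T \<and> continuous_on T (\<lambda>x. differential n S F x v j)"
    using x V(2) U openin_open_Int[OF U(1)] by blast
qed

text \<open>\<open>l j\<close> is the image of the j-th unit vector. On a standard simplex, where
  the coordinates sum to 1, this is the affine map with vertices \<open>l j\<close>.\<close>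

definition lin_map :: "nat \<Rightarrow> (nat \<Rightarrow> nat \<Rightarrow> real) \<Rightarrow> (nat \<Rightarrow> real) \<Rightarrow> nat \<Rightarrow> real" where
  "lin_map n l x = (\<lambda>i. \<Sum>j<n. l j i * x j)"

lemma lin_map_unit_vec:
  assumes "x \<in> coord_space n"
  shows "lin_map n unit_vec x = x"
proof
  fix i
  have "lin_map n unit_vec x i = (\<Sum>j<n. if j = i then x i else 0)"
    unfolding lin_map_def by (rule sum.cong) (auto simp: unit_vec_def)
  then show "lin_map n unit_vec x i = x i" using assms by auto
qed

lemma local_smooth_extension_affine:
  assumes "S \<subseteq> coord_space n" "x \<in> S"
  shows "local_smooth_extension n S (\<lambda>x. a + (\<Sum>j<n. l j * x j)) x (\<lambda>x. a + (\<Sum>j<n. l j * x j))"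
proof (rule local_smooth_extensionI[where V = "coord_space n"])
  show o: "openin (Euclidean_space n) (coord_space n)" by (simp add: Euclidean_space_eq)
  show "Cr_on r n (coord_space n) (\<lambda>x. a + (\<Sum>j<n. l j * x j))" for r
    by (intro Cr_on_add[OF o] Cr_on_sum[OF o] Cr_on_mult[OF o] Cr_on_const Cr_on_coord order_refl)
qed (use assms in auto)

lemma part_deriv_affine:
  assumes "i < n"
  shows "part_deriv i (\<lambda>x. a + (\<Sum>j<n. l j * x j)) x = l i"
proof (rule DERIV_imp_deriv)
  have "((\<lambda>t. (x(i := t)) j) has_real_derivative (if i = j then 1 else 0)) (at (x i))" for j
    by (cases "i = j") auto
  then have "((\<lambda>t. a + (\<Sum>j<n. l j * (x(i := t)) j)) has_real_derivative
      0 + (\<Sum>j<n. l j * (if i = j then 1 else 0))) (at (x i))"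
    by (intro DERIV_add DERIV_const DERIV_sum DERIV_cmult)
  moreover have "(\<Sum>j<n. l j * (if i = j then 1 else 0)) = (\<Sum>j<n. if j = i then l i else 0)"
    by (rule sum.cong) auto
  then have "0 + (\<Sum>j<n. l j * (if i = j then 1 else 0)) = l i"
    using assms by simp
  ultimately show "((\<lambda>t. a + (\<Sum>j<n. l j * (x(i := t)) j)) has_real_derivative l i) (at (x i))" by simp
qed

lemma smooth_vec_on_affine:
  assumes "S \<subseteq> coord_space n"
  shows "smooth_vec_on n S (\<lambda>x i. a i + lin_map n l x i)"
  unfolding smooth_vec_on_def lin_map_def
  by (intro allI smooth_onI[OF assms] exI, rule local_smooth_extension_affine[OF assms])

lemma differential_affine:
  assumes "S \<subseteq> coord_space n" "x \<in> S" "determined_dir n S x v"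
  shows "differential n S (\<lambda>x i. a i + lin_map n l x i) x v = lin_map n l v"
proof
  fix i
  have "differential n S (\<lambda>x i. a i + lin_map n l x i) x v i =
      (\<Sum>k<n. v k * part_deriv k (\<lambda>x. a i + (\<Sum>j<n. l j i * x j)) x)"
    unfolding lin_map_def
    by (rule differential_eq[where F = "\<lambda>x i. a i + (\<Sum>j<n. l j i * x j)", OF assms(3)
        local_smooth_extension_affine[OF assms(1,2)]])
  also have "\<dots> = (\<Sum>k<n. l k i * v k)"
    by (intro sum.cong refl) (subst part_deriv_affine, auto)
  finally show "differential n S (\<lambda>x i. a i + lin_map n l x i) x v i = lin_map n l v i"
    unfolding lin_map_def .
qed

lemma smooth_vec_on_lin_map:
  "S \<subseteq> coord_space n \<Longrightarrow> smooth_vec_on n S (lin_map n l)"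
  using smooth_vec_on_affine[of S n "\<lambda>_. 0" l] by simp

lemma differential_lin_map:
  "S \<subseteq> coord_space n \<Longrightarrow> x \<in> S \<Longrightarrow> determined_dir n S x v \<Longrightarrow> differential n S (lin_map n l) x v = lin_map n l v"
  using differential_affine[of S n x v "\<lambda>_. 0" l] by simp

section \<open>Tangent vectors and alternating forms\<close>

locale smooth_mfd =
  fixes M :: "'a mfd"
  assumes smooth_manifold: "smooth_manifold M"
begin

abbreviation "overlap c d \<equiv> snd c ` (fst c \<inter> fst d)"

lemma is_chart: "c \<in> atlas M \<Longrightarrow> is_chart (mtop M) (mdim M) c"
  using smooth_manifold by (simp add: smooth_manifold_def)

lemma chart_openin: "c \<in> atlas M \<Longrightarrow> openin (mtop M) (fst c)"
  using is_chart by (simp add: is_chart_def)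

lemma overlap_openin: "c \<in> atlas M \<Longrightarrow> d \<in> atlas M \<Longrightarrow> openin (mtop M) (fst c \<inter> fst d)"
  using chart_openin by (intro openin_Int)

lemma chart_homeomorphic:
  "c \<in> atlas M \<Longrightarrow> homeomorphic_map (subtopology (mtop M) (fst c)) (subtopology (half_space (mdim M)) (snd c ` fst c)) (snd c)"
  using is_chart by (simp add: is_chart_def)

lemma chart_subset: "c \<in> atlas M \<Longrightarrow> fst c \<subseteq> topspace (mtop M)"
  using chart_openin openin_subset by blast

lemma obtain_chart: "p \<in> topspace (mtop M) \<Longrightarrow> \<exists>c\<in>atlas M. p \<in> fst c"
  using smooth_manifold by (auto simp: smooth_manifold_def)

lemma inv_chart_left: "c \<in> atlas M \<Longrightarrow> p \<in> fst c \<Longrightarrow> inv_chart c (snd c p) = p"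
  using homeomorphic_imp_injective_map[OF chart_homeomorphic, of c] chart_subset[of c]
  by (simp add: inv_chart_def Int_absorb1)

lemma chart_image_openin:
  assumes "c \<in> atlas M" "openin (mtop M) U" "U \<subseteq> fst c"
  shows "openin (half_space (mdim M)) (snd c ` U)"
proof -
  have "openin (subtopology (mtop M) (fst c)) U"
    using assms(2,3) chart_openin[OF assms(1)] by (simp add: openin_open_subtopology)
  then have "openin (subtopology (half_space (mdim M)) (snd c ` fst c)) (snd c ` U)"
    using homeomorphic_imp_open_map[OF chart_homeomorphic[OF assms(1)]] by (simp add: open_map_def)
  moreover have "openin (half_space (mdim M)) (snd c ` fst c)"
    using is_chart[OF assms(1)] by (simp add: is_chart_def)
  ultimately show ?thesis by (rule openin_trans_full)
qed

lemma chart_image_coord_space: "c \<in> atlas M \<Longrightarrow> snd c ` fst c \<subseteq> coord_space (mdim M)"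
  using is_chart[of c] openin_subset[of "half_space (mdim M)" "snd c ` fst c"]
  by (auto simp: is_chart_def half_space_def topspace_Euclidean_space)

lemma chart_in_coord_space: "c \<in> atlas M \<Longrightarrow> p \<in> fst c \<Longrightarrow> snd c p \<in> coord_space (mdim M)"
  using chart_image_coord_space by blast

lemma transition_smooth:
  "c \<in> atlas M \<Longrightarrow> d \<in> atlas M \<Longrightarrow> smooth_vec_on (mdim M) (overlap c d) (snd d \<circ> inv_chart c)"
  using smooth_manifold by (simp add: smooth_manifold_def)

lemma determined_dir_chart:
  assumes "c \<in> atlas M" "openin (mtop M) U" "U \<subseteq> fst c" "p \<in> U"
  shows "determined_dir (mdim M) (snd c ` U) (snd c p) v"
  by (rule determined_dir_half_space[OF chart_image_openin[OF assms(1-3)]]) (use assms(4) in blast)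

lemma transition_differential_in_coord_space:
  assumes "c \<in> atlas M" "d \<in> atlas M" "p \<in> fst c" "p \<in> fst d"
  shows "differential (mdim M) (overlap c d) (snd d \<circ> inv_chart c) (snd c p) u \<in> coord_space (mdim M)"
proof (rule differential_in_coord_space)
  show "overlap c d \<subseteq> coord_space (mdim M)" using chart_image_coord_space[OF assms(1)] by blast
  show "determined_dir (mdim M) (overlap c d) (snd c p) u"
    by (rule determined_dir_chart[OF assms(1) overlap_openin[OF assms(1,2)]]) (use assms in auto)
  show "(snd d \<circ> inv_chart c) y \<in> coord_space (mdim M)" if "y \<in> overlap c d" for y
    using that inv_chart_left[OF assms(1)] chart_in_coord_space[OF assms(2)] by auto
qed (use assms in auto)

text \<open>The cocycle rule for transition maps. The chain rule is applied on the triple overlap,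
  and \<open>differential_subset\<close> moves the differentials at \<open>snd c p\<close>
  there.\<close>

lemma transition_differential_trans:
  assumes c: "c \<in> atlas M" "p \<in> fst c" and d: "d \<in> atlas M" "p \<in> fst d" and e: "e \<in> atlas M" "p \<in> fst e"
  shows "differential (mdim M) (overlap d e) (snd e \<circ> inv_chart d) (snd d p)
      (differential (mdim M) (overlap c d) (snd d \<circ> inv_chart c) (snd c p) u) =
    differential (mdim M) (overlap c e) (snd e \<circ> inv_chart c) (snd c p) u"
proof -
  define S where "S = snd c ` (fst c \<inter> fst d \<inter> fst e)"
  have S: "S \<subseteq> overlap c d" "S \<subseteq> overlap c e" "snd c p \<in> S" using c d e by (auto simp: S_def)
  have op: "openin (mtop M) (fst c \<inter> fst d \<inter> fst e)" using c d e by (intro openin_Int chart_openin)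
  have det: "determined_dir (mdim M) S (snd c p) u"
    unfolding S_def by (rule determined_dir_chart[OF c(1) op]) (use c d e in auto)
  let ?F = "snd d \<circ> inv_chart c" and ?G = "snd e \<circ> inv_chart d"
  have F: "smooth_vec_on (mdim M) S ?F"
    using smooth_on_cong_subset[OF smooth_vec_onD[OF transition_smooth[OF c(1) d(1)]] S(1)]
    by (auto simp: smooth_vec_on_def)
  have Fcp: "?F (snd c p) = snd d p" using c inv_chart_left by simp
  have "differential (mdim M) S (\<lambda>y. ?G (?F y)) (snd c p) u =
      differential (mdim M) (overlap d e) ?G (?F (snd c p)) (differential (mdim M) S ?F (snd c p) u)"
  proof (rule differential_compose[OF F transition_smooth[OF d(1) e(1)] _ S(3) det])
    show "?F y \<in> overlap d e" if "y \<in> S" for y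
      using that inv_chart_left[OF c(1)] by (auto simp: S_def)
    show "determined_dir (mdim M) (overlap d e) (?F (snd c p)) w" for w
      unfolding Fcp by (rule determined_dir_chart[OF d(1) overlap_openin[OF d(1) e(1)]]) (use d e in auto)
  qed
  also have "differential (mdim M) S ?F (snd c p) u = differential (mdim M) (overlap c d) ?F (snd c p) u"
    by (rule differential_subset[OF transition_smooth[OF c(1) d(1)] S(1,3) det, symmetric]) simp
  also have "differential (mdim M) S (\<lambda>y. ?G (?F y)) (snd c p) u =
      differential (mdim M) (overlap c e) (snd e \<circ> inv_chart c) (snd c p) u"
    by (rule differential_subset[OF transition_smooth[OF c(1) e(1)] S(2,3) det, symmetric])
      (use inv_chart_left[OF c(1)] inv_chart_left[OF d(1)] in \<open>auto simp: S_def\<close>)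
  finally show ?thesis unfolding Fcp by (simp add: comp_def)
qed

lemma tvec_of_in_tangent_space:
  assumes c: "c \<in> atlas M" "p \<in> fst c"
  shows "tvec_of M c p u \<in> tangent_space M p"
proof -
  have "tvec_of M c p u e \<in> topspace (Euclidean_space (mdim M)) \<and>
      tvec_of M c p u = tvec_of M e p (tvec_of M c p u e)" if e: "e \<in> atlas M" "p \<in> fst e" for e
  proof
    have eq: "tvec_of M c p u e = differential (mdim M) (overlap c e) (snd e \<circ> inv_chart c) (snd c p) u"
      using e by (simp add: tvec_of_def)
    show "tvec_of M c p u e \<in> topspace (Euclidean_space (mdim M))"
      unfolding eq topspace_Euclidean_space by (rule transition_differential_in_coord_space[OF c(1) e(1) c(2) e(2)])
    show "tvec_of M c p u = tvec_of M e p (tvec_of M c p u e)"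
    proof
      fix d
      show "tvec_of M c p u d = tvec_of M e p (tvec_of M c p u e) d"
        unfolding eq using transition_differential_trans[OF c e, of d u] by (auto simp: tvec_of_def)
    qed
  qed
  then show ?thesis by (simp add: tangent_space_def)
qed

lemma tangent_space_tvec_of:
  "v \<in> tangent_space M p \<Longrightarrow> c \<in> atlas M \<Longrightarrow> p \<in> fst c \<Longrightarrow> tvec_of M c p (v c) = v"
  by (auto simp: tangent_space_def)

lemma tvec_of_lincomb:
  "tvec_of M c p (\<lambda>i. a * u i + b * w i) = (\<lambda>d j. a * tvec_of M c p u d j + b * tvec_of M c p w d j)"
  by (auto simp: tvec_of_def differential_lincomb fun_eq_iff)

lemma tvec_of_eq_sum:
  "tvec_of M c p u = (\<lambda>d i. \<Sum>j<mdim M. u j * tvec_of M c p (unit_vec j) d i)"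
proof (intro ext)
  fix d i
  show "tvec_of M c p u d i = (\<Sum>j<mdim M. u j * tvec_of M c p (unit_vec j) d i)"
    using differential_eq_sum[of "mdim M" "overlap c d" "snd d \<circ> inv_chart c" "snd c p" u i]
    by (cases "d \<in> atlas M \<and> p \<in> fst d") (auto simp: tvec_of_def)
qed

lemma tangent_space_lincomb:
  assumes "u \<in> tangent_space M p" "w \<in> tangent_space M p"
  shows "(\<lambda>c j. a * u c j + b * w c j) \<in> tangent_space M p"
  unfolding tangent_space_def
proof (intro CollectI ballI impI conjI)
  fix c assume c: "c \<in> atlas M" "p \<in> fst c"
  show "(\<lambda>j. a * u c j + b * w c j) \<in> topspace (Euclidean_space (mdim M))"
    using assms c by (auto simp: tangent_space_def topspace_Euclidean_space)
  show "(\<lambda>c j. a * u c j + b * w c j) = tvec_of M c p (\<lambda>j. a * u c j + b * w c j)"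
    by (simp add: tvec_of_lincomb tangent_space_tvec_of[OF assms(1) c] tangent_space_tvec_of[OF assms(2) c])
qed

end

section \<open>Alternating multilinear functions in coordinates\<close>

lemma alternating_multilinear_lincomb:
  assumes f: "alternating_multilinear k T f" and us: "set us \<subseteq> T" "set ws \<subseteq> T" "length us + Suc (length ws) = k"
    and x: "x \<in> T" "y \<in> T"
  shows "f (us @ (\<lambda>c j. a * x c j + b * y c j) # ws) = a * f (us @ x # ws) + b * f (us @ y # ws)"
proof -
  have "f ((us @ x # ws)[length us := (\<lambda>c j. a * x c j + b * y c j)]) =
      a * f ((us @ x # ws)[length us := x]) + b * f ((us @ x # ws)[length us := y])"
    by (rule conjunct1[OF conjunct2[OF f[unfolded alternating_multilinear_def]], rule_format]) (use us x in auto)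
  then show ?thesis by (simp only: list_update_length)
qed

text \<open>Membership and value are proved together: the induction step applies linearity to the
  partial sum, which has to lie in \<open>T\<close>.\<close>

lemma alternating_multilinear_sum:
  fixes E :: "nat \<Rightarrow> 'a tvec"
  assumes f: "alternating_multilinear k T f" and us: "set us \<subseteq> T" "set ws \<subseteq> T" "length us + Suc (length ws) = k"
    and T: "\<And>x y a b. x \<in> T \<Longrightarrow> y \<in> T \<Longrightarrow> (\<lambda>c j. a * x c j + b * y c j) \<in> T" "T \<noteq> {}"
    and E: "\<And>j. j < m \<Longrightarrow> E j \<in> T"
  shows "(\<lambda>c i. \<Sum>j<m. a j * E j c i) \<in> T \<and>
    f (us @ (\<lambda>c i. \<Sum>j<m. a j * E j c i) # ws) = (\<Sum>j<m. a j * f (us @ E j # ws))"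
  using E
proof (induction m)
  case 0
  \<comment> \<open>Closure of \<open>T\<close> is given for combinations of two vectors, so the
    empty sum is obtained from some element with both coefficients 0.\<close>
  obtain x where x: "x \<in> T" using T(2) by blast
  show ?case
    using T(1)[OF x x, of 0 0] alternating_multilinear_lincomb[OF f us x x, of 0 0] by simp
next
  case (Suc m)
  let ?s = "\<lambda>c i. \<Sum>j<m. a j * E j c i"
  have IH: "?s \<in> T" "f (us @ ?s # ws) = (\<Sum>j<m. a j * f (us @ E j # ws))" using Suc by auto
  have Em: "E m \<in> T" using Suc.prems by simp
  show ?case
    using T(1)[OF IH(1) Em, of 1 "a m"] alternating_multilinear_lincomb[OF f us IH(1) Em, of 1 "a m"] IH(2) by simp
qed

text \<open>The list \<open>js\<close> picks one of the vectors \<open>E j\<close> for each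
  argument, and \<open>prod_list\<close> multiplies the corresponding coefficients. The induction
  moves the arguments already expanded into \<open>us\<close>.\<close>

lemma alternating_multilinear_expand:
  fixes E :: "nat \<Rightarrow> 'a tvec" and as :: "(nat \<Rightarrow> real) list"
  assumes f: "alternating_multilinear k T f"
    and T: "\<And>x y a b. x \<in> T \<Longrightarrow> y \<in> T \<Longrightarrow> (\<lambda>c j. a * x c j + b * y c j) \<in> T" "T \<noteq> {}"
    and E: "\<And>j. j < n \<Longrightarrow> E j \<in> T"
    and "set us \<subseteq> T" "length us + length as = k"
  shows "f (us @ map (\<lambda>a c i. \<Sum>j<n. a j * E j c i) as) =
    (\<Sum>js\<in>{js. set js \<subseteq> {..<n} \<and> length js = length as}. prod_list (map2 (\<lambda>a j. a j) as js) * f (us @ map E js))"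
  using assms(5,6)
proof (induction as arbitrary: us)
  case Nil
  have "{js. set js \<subseteq> {..<n} \<and> js = []} = {[]}" by auto
  then show ?case by simp
next
  case (Cons a as)
  let ?v = "\<lambda>a c i. \<Sum>j<n. a j * E j c i"
  let ?L = "{js. set js \<subseteq> {..<n} \<and> length js = length as}"
  have vT: "?v b \<in> T" for b
  proof -
    \<comment> \<open>The zero function of one argument serves only to extract the membership part
      of \<open>alternating_multilinear_sum\<close>.\<close>
    have "alternating_multilinear 1 T (\<lambda>_. 0)" by (simp add: alternating_multilinear_def)
    then show ?thesis
      by (rule conjunct1[OF alternating_multilinear_sum[where f = "\<lambda>_. 0" and us = "[]" and ws = "[]", OF _ _ _ _ T E]])
        simp_all
  qed
  have "f (us @ map ?v (a # as)) = f (us @ ?v a # map ?v as)" by simp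
  also have "\<dots> = (\<Sum>j<n. a j * f (us @ E j # map ?v as))"
    by (rule conjunct2[OF alternating_multilinear_sum[OF f Cons.prems(1) _ _ T E]])
      (use vT Cons.prems(2) in auto)
  also have "\<dots> = (\<Sum>j<n. \<Sum>js\<in>?L. a j * (prod_list (map2 (\<lambda>a j. a j) as js) * f (us @ E j # map E js)))"
  proof (rule sum.cong[OF refl])
    fix j assume "j \<in> {..<n}"
    then have "f ((us @ [E j]) @ map ?v as) =
        (\<Sum>js\<in>?L. prod_list (map2 (\<lambda>a j. a j) as js) * f ((us @ [E j]) @ map E js))"
      using Cons.prems E by (intro Cons.IH) auto
    then show "a j * f (us @ E j # map ?v as) =
        (\<Sum>js\<in>?L. a j * (prod_list (map2 (\<lambda>a j. a j) as js) * f (us @ E j # map E js)))"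
      by (simp add: sum_distrib_left)
  qed
  also have "\<dots> = (\<Sum>(j, js)\<in>{..<n} \<times> ?L. a j * (prod_list (map2 (\<lambda>a j. a j) as js) * f (us @ E j # map E js)))"
    by (rule sum.cartesian_product)
  also have "\<dots> = (\<Sum>js\<in>(\<lambda>(j, js). j # js) ` ({..<n} \<times> ?L). prod_list (map2 (\<lambda>a j. a j) (a # as) js) * f (us @ map E js))"
    by (subst sum.reindex) (auto simp: inj_on_def case_prod_unfold mult.assoc)
  also have "(\<lambda>(j, js). j # js) ` ({..<n} \<times> ?L) = {js. set js \<subseteq> {..<n} \<and> length js = length (a # as)}"
    by (auto simp: image_iff length_Suc_conv)
  finally show ?case .
qed

section \<open>Smooth simplices\<close>

lemma smooth_vec_on_cong_subset:
  assumes "smooth_vec_on n S F" "S' \<subseteq> S" "\<And>y. y \<in> S' \<Longrightarrow> F y = F' y"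
  shows "smooth_vec_on n S' F'"
  unfolding smooth_vec_on_def
proof
  fix j
  show "smooth_on n S' (\<lambda>x. F' x j)"
    by (rule smooth_on_cong_subset[OF smooth_vec_onD[OF assms(1)] assms(2)]) (simp add: assms(3))
qed

lemma smooth_vec_on_imp_continuous_on: "smooth_vec_on n S F \<Longrightarrow> continuous_on S F"
  by (rule continuous_on_coordinatewise_then_product) (rule smooth_on_imp_continuous_on[OF smooth_vec_onD])

lemma continuous_on_prod_list_map2:
  fixes D :: "'b::t2_space \<Rightarrow> 'c \<Rightarrow> 'd \<Rightarrow> real"
  assumes "\<And>v j. v \<in> set vs \<Longrightarrow> continuous_on S (\<lambda>y. D y v j)"
  shows "continuous_on S (\<lambda>y. prod_list (map2 (\<lambda>v j. D y v j) vs js))"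
  using assms
proof (induction vs arbitrary: js)
  case (Cons v vs)
  show ?case
  proof (cases js)
    case js: (Cons j js')
    have "continuous_on S (\<lambda>y. D y v j * prod_list (map2 (\<lambda>v j. D y v j) vs js'))"
      by (rule continuous_on_mult[OF Cons.prems Cons.IH]) (use Cons.prems in auto)
    then show ?thesis by (simp add: js)
  qed simp
qed simp

section \<open>Affine maps between standard simplices\<close>

lemma lin_map_in_standard_simplex:
  assumes "\<And>j. j \<le> p \<Longrightarrow> l j \<in> standard_simplex q" "x \<in> standard_simplex p"
  shows "lin_map (Suc p) l x \<in> standard_simplex q"
proof -
  let ?y = "lin_map (Suc p) l x"
  have x: "\<And>j. 0 \<le> x j" "(\<Sum>j\<le>p. x j) = 1" using assms(2) by (auto simp: standard_simplex_def)
  have l: "\<And>i j. j \<le> p \<Longrightarrow> 0 \<le> l j i" "\<And>i j. j \<le> p \<Longrightarrow> i > q \<Longrightarrow> l j i = 0" "\<And>j. j \<le> p \<Longrightarrow> (\<Sum>i\<le>q. l j i) = 1"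
    using assms(1) by (auto simp: standard_simplex_def)
  have y0: "0 \<le> ?y i" for i
    unfolding lin_map_def using x l by (intro sum_nonneg mult_nonneg_nonneg) auto
  have yq: "?y i = 0" if "i > q" for i
    unfolding lin_map_def using l that by (intro sum.neutral) auto
  have "(\<Sum>i\<le>q. ?y i) = (\<Sum>j<Suc p. \<Sum>i\<le>q. l j i * x j)"
    unfolding lin_map_def by (rule sum.swap)
  also have "\<dots> = (\<Sum>j<Suc p. x j)"
    using l(3) by (intro sum.cong) (auto simp flip: sum_distrib_right)
  also have "\<dots> = 1" using x(2) by (simp add: lessThan_Suc_atMost)
  finally have ys: "(\<Sum>i\<le>q. ?y i) = 1" .
  have "?y i \<le> 1" for i
  proof (cases "i \<le> q")
    case True
    then have "?y i \<le> (\<Sum>i\<le>q. ?y i)" by (intro member_le_sum) (auto simp: y0)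
    then show ?thesis using ys by simp
  qed (simp add: yq)
  then show ?thesis using y0 yq ys by (simp add: standard_simplex_def)
qed

lemma lin_map_sum_zero:
  assumes "\<And>j. j \<le> p \<Longrightarrow> l j \<in> standard_simplex q" "(\<Sum>j\<le>p. v j) = 0"
  shows "(\<Sum>i\<le>q. lin_map (Suc p) l v i) = 0"
proof -
  have "(\<Sum>i\<le>q. lin_map (Suc p) l v i) = (\<Sum>j<Suc p. \<Sum>i\<le>q. l j i * v j)"
    unfolding lin_map_def by (rule sum.swap)
  also have "\<dots> = (\<Sum>j<Suc p. v j)"
    using assms(1) by (intro sum.cong) (auto simp: standard_simplex_def simp flip: sum_distrib_right)
  finally show ?thesis using assms(2) by (simp add: lessThan_Suc_atMost)
qed

text \<open>For a simplex \<open>s\<close> this is its restriction to the affine simplex with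
  vertices \<open>l j\<close>. Faces and contractions are both of this form, so smoothness and
  differentials are treated once for all of them.\<close>

definition affine_subsimplex ::
    "nat \<Rightarrow> (nat \<Rightarrow> nat \<Rightarrow> real) \<Rightarrow> ((nat \<Rightarrow> real) \<Rightarrow> 'a) \<Rightarrow> (nat \<Rightarrow> real) \<Rightarrow> 'a" where
  "affine_subsimplex p l s = restrict (s \<circ> lin_map (Suc p) l) (standard_simplex p)"

lemma continuous_on_lin_map: "continuous_on S (lin_map n l)"
  unfolding lin_map_def
  by (intro continuous_on_coordinatewise_then_product continuous_on_sum continuous_on_mult continuous_on_const
      continuous_on_subset[OF continuous_on_product_coordinates]) simp_all

lemma singular_simplex_iff_top_of_set:
  "singular_simplex p T s \<longleftrightarrow> continuous_map (top_of_set (standard_simplex p)) T s \<and> s \<in> extensional (standard_simplex p)"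
  by (simp add: singular_simplex_def euclidean_product_topology)

section \<open>Differentials of smooth simplices and pullbacks of forms\<close>

context smooth_mfd
begin

abbreviation "simplex_chart p s c \<equiv> {x \<in> standard_simplex p. s x \<in> fst c}"

lemma simplex_chart_openin:
  assumes "singular_simplex p (mtop M) s" "c \<in> atlas M"
  shows "openin (top_of_set (standard_simplex p)) (simplex_chart p s c)"
  using openin_continuous_map_preimage[of "top_of_set (standard_simplex p)" "mtop M" s "fst c"]
    assms(1) chart_openin[OF assms(2)]
  by (simp add: singular_simplex_iff_top_of_set)

lemma simplex_in_topspace:
  "singular_simplex p (mtop M) s \<Longrightarrow> x \<in> standard_simplex p \<Longrightarrow> s x \<in> topspace (mtop M)"
  by (auto simp: singular_simplex_iff_top_of_set continuous_map_def)

lemma smooth_simplex_singular: "smooth_simplex M p s \<Longrightarrow> singular_simplex p (mtop M) s"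
  by (simp add: smooth_simplex_def)

lemma smooth_simplex_chart:
  "smooth_simplex M p s \<Longrightarrow> c \<in> atlas M \<Longrightarrow> smooth_vec_on (Suc p) (simplex_chart p s c) (snd c \<circ> s)"
  by (simp add: smooth_simplex_def)

lemma determined_dir_simplex_chart:
  assumes "singular_simplex p (mtop M) s" "c \<in> atlas M" "x \<in> simplex_chart p s c" "(\<Sum>i\<le>p. v i) = 0"
  shows "determined_dir (Suc p) (simplex_chart p s c) x v"
  by (rule determined_dir_simplex[OF simplex_chart_openin[OF assms(1,2)] assms(3,4)])

text \<open>The chain rule for the transition map from \<open>c\<close> to \<open>d\<close>, on the
  part of the simplex that lies in both charts. It shows that the coordinate vectors in the various
  charts belong to one tangent vector.\<close>

lemma simplex_differential_tvec_of:
  assumes s: "smooth_simplex M p s" and x: "x \<in> standard_simplex p" and c: "c \<in> atlas M" "s x \<in> fst c"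
    and v: "(\<Sum>i\<le>p. v i) = 0"
  shows "simplex_differential M p s x v =
    tvec_of M c (s x) (differential (Suc p) (simplex_chart p s c) (snd c \<circ> s) x v)"
proof
  fix d
  show "simplex_differential M p s x v d =
    tvec_of M c (s x) (differential (Suc p) (simplex_chart p s c) (snd c \<circ> s) x v) d"
  proof (cases "d \<in> atlas M \<and> s x \<in> fst d")
    case True
    then have d: "d \<in> atlas M" "s x \<in> fst d" by auto
    note sing = smooth_simplex_singular[OF s]
    define S where "S = simplex_chart p s c \<inter> simplex_chart p s d"
    have S: "S \<subseteq> simplex_chart p s c" "S \<subseteq> simplex_chart p s d" "x \<in> S" using x c d by (auto simp: S_def)
    have det: "determined_dir (Suc p) S x v"
      by (rule determined_dir_simplex[OF _ S(3) v])
        (simp only: S_def openin_Int simplex_chart_openin[OF sing c(1)] simplex_chart_openin[OF sing d(1)])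
    have F: "smooth_vec_on (Suc p) S (snd c \<circ> s)"
      by (rule smooth_vec_on_cong_subset[OF smooth_simplex_chart[OF s c(1)] S(1)]) simp
    have "differential (Suc p) (simplex_chart p s d) (snd d \<circ> s) x v =
        differential (Suc p) S (\<lambda>y. (snd d \<circ> inv_chart c) ((snd c \<circ> s) y)) x v"
      by (rule differential_subset[OF smooth_simplex_chart[OF s d(1)] S(2,3) det])
        (auto simp: S_def inv_chart_left[OF c(1)])
    also have "\<dots> = differential (mdim M) (overlap c d) (snd d \<circ> inv_chart c) ((snd c \<circ> s) x)
        (differential (Suc p) S (snd c \<circ> s) x v)"
      by (rule differential_compose[OF F transition_smooth[OF c(1) d(1)] _ S(3) det])
        (auto simp: S_def c d intro: determined_dir_chart[OF c(1) overlap_openin[OF c(1) d(1)]])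
    also have "differential (Suc p) S (snd c \<circ> s) x v = differential (Suc p) (simplex_chart p s c) (snd c \<circ> s) x v"
      by (rule differential_subset[OF smooth_simplex_chart[OF s c(1)] S(1,3) det, symmetric]) simp
    finally show ?thesis using d by (simp add: simplex_differential_def tvec_of_def comp_def)
  next
    case False
    then show ?thesis by (auto simp: simplex_differential_def tvec_of_def)
  qed
qed

lemma simplex_differential_in_tangent_space:
  assumes "smooth_simplex M p s" "x \<in> standard_simplex p" "(\<Sum>i\<le>p. v i) = 0"
  shows "simplex_differential M p s x v \<in> tangent_space M (s x)"
proof -
  obtain c where "c \<in> atlas M" "s x \<in> fst c"
    using obtain_chart[OF simplex_in_topspace[OF smooth_simplex_singular[OF assms(1)] assms(2)]] by blast
  then show ?thesis
    using simplex_differential_tvec_of[OF assms(1,2)] assms(3) tvec_of_in_tangent_space by simp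
qed

lemma simplex_differential_lincomb:
  "simplex_differential M p s x (\<lambda>i. a * u i + b * w i) =
     (\<lambda>c j. a * simplex_differential M p s x u c j + b * simplex_differential M p s x w c j)"
  by (auto simp: simplex_differential_def differential_lincomb fun_eq_iff)

lemma form_alternating:
  "is_form M k \<omega> \<Longrightarrow> p \<in> topspace (mtop M) \<Longrightarrow> alternating_multilinear k (tangent_space M p) (\<omega> p)"
  by (simp add: is_form_def)

text \<open>The coefficients on the right are the functions that \<open>is_form\<close> requires to
  be smooth; through them smoothness of a form yields continuity of its pullbacks.\<close>

lemma form_expand:
  assumes \<omega>: "is_form M k \<omega>" and c: "c \<in> atlas M" "p \<in> fst c" and us: "length us = k"
  shows "\<omega> p (map (tvec_of M c p) us) =
    (\<Sum>js\<in>{js. set js \<subseteq> {..<mdim M} \<and> length js = k}.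
       prod_list (map2 (\<lambda>a j. a j) us js) * \<omega> p (map (\<lambda>j. tvec_of M c p (unit_vec j)) js))"
proof -
  have "p \<in> topspace (mtop M)" using c chart_subset by blast
  note f = form_alternating[OF \<omega> this]
  have "tangent_space M p \<noteq> {}" using tvec_of_in_tangent_space[OF c] by blast
  note * = alternating_multilinear_expand[where us = "[]" and as = us and n = "mdim M" and
      E = "\<lambda>j. tvec_of M c p (unit_vec j)", OF f tangent_space_lincomb this tvec_of_in_tangent_space[OF c]]
  have "map (tvec_of M c p) us = map (\<lambda>a c' i. \<Sum>j<mdim M. a j * tvec_of M c p (unit_vec j) c' i) us"
    by (rule map_cong[OF refl]) (rule tvec_of_eq_sum)
  then have "\<omega> p (map (tvec_of M c p) us) = \<omega> p ([] @ map (\<lambda>a c' i. \<Sum>j<mdim M. a j * tvec_of M c p (unit_vec j) c' i) us)"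
    by (simp only: append_Nil)
  also have "\<dots> = (\<Sum>js\<in>{js. set js \<subseteq> {..<mdim M} \<and> length js = length us}.
      prod_list (map2 (\<lambda>a j. a j) us js) * \<omega> p ([] @ map (\<lambda>j. tvec_of M c p (unit_vec j)) js))"
    by (rule *) (use us in simp_all)
  finally show ?thesis by (simp only: append_Nil us)
qed

text \<open>Locally the simplex runs in one chart \<open>c\<close>. There the expansion writes the
  pullback as a polynomial in the continuous components \<open>D y v\<close> of the differential,
  with coefficients that are smooth functions on the chart composed with the simplex.\<close>

lemma continuous_on_form_pullback:
  assumes \<omega>: "is_form M k \<omega>" and s: "smooth_simplex M p s" and vs: "length vs = k" "\<And>v. v \<in> set vs \<Longrightarrow> (\<Sum>i\<le>p. v i) = 0"
  shows "continuous_on (standard_simplex p) (\<lambda>y. \<omega> (s y) (map (simplex_differential M p s y) vs))"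
proof (rule continuous_on_local)
  fix y0 assume y0: "y0 \<in> standard_simplex p"
  note sing = smooth_simplex_singular[OF s]
  obtain c where c: "c \<in> atlas M" "s y0 \<in> fst c" using obtain_chart[OF simplex_in_topspace[OF sing y0]] by blast
  define D where "D y v = differential (Suc p) (simplex_chart p s c) (snd c \<circ> s) y v" for y v
  define J where "J = {js. set js \<subseteq> {..<mdim M} \<and> length js = k}"
  define \<phi> where "\<phi> js x = \<omega> (inv_chart c x) (map (\<lambda>j. tvec_of M c (inv_chart c x) (unit_vec j)) js)" for js x
  have eq: "\<omega> (s y) (map (simplex_differential M p s y) vs) =
      (\<Sum>js\<in>J. prod_list (map2 (\<lambda>v j. D y v j) vs js) * \<phi> js ((snd c \<circ> s) y))"
    if y: "y \<in> simplex_chart p s c" for y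
  proof -
    have "map (simplex_differential M p s y) vs = map (tvec_of M c (s y)) (map (D y) vs)"
      using simplex_differential_tvec_of[OF s _ c(1)] y vs(2) by (simp add: D_def)
    then have "\<omega> (s y) (map (simplex_differential M p s y) vs) =
        (\<Sum>js\<in>J. prod_list (map2 (\<lambda>a j. a j) (map (D y) vs) js) * \<omega> (s y) (map (\<lambda>j. tvec_of M c (s y) (unit_vec j)) js))"
      using form_expand[OF \<omega> c(1), of "s y" "map (D y) vs"] y vs(1) by (simp only: J_def) simp
    also have "\<dots> = (\<Sum>js\<in>J. prod_list (map2 (\<lambda>v j. D y v j) vs js) * \<phi> js ((snd c \<circ> s) y))"
      using inv_chart_left[OF c(1), of "s y"] y
      by (intro sum.cong refl) (simp add: \<phi>_def zip_map1 case_prod_unfold comp_def)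
    finally show ?thesis .
  qed
  have "continuous_on (simplex_chart p s c) (\<lambda>y. \<Sum>js\<in>J. prod_list (map2 (\<lambda>v j. D y v j) vs js) * \<phi> js ((snd c \<circ> s) y))"
  proof (intro continuous_on_sum continuous_on_mult continuous_on_prod_list_map2)
    fix v j assume "v \<in> set vs"
    then show "continuous_on (simplex_chart p s c) (\<lambda>y. D y v j)"
      unfolding D_def using determined_dir_simplex_chart[OF sing c(1)] vs(2)
      by (intro continuous_on_differential[OF smooth_simplex_chart[OF s c(1)]]) auto
  next
    fix js assume "js \<in> J"
    then have "smooth_on (mdim M) (snd c ` fst c) (\<phi> js)"
      using \<omega> c(1) unfolding \<phi>_def[abs_def] by (auto simp: J_def is_form_def)
    then have "continuous_on (snd c ` fst c) (\<phi> js)" by (rule smooth_on_imp_continuous_on)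
    then show "continuous_on (simplex_chart p s c) (\<lambda>y. \<phi> js ((snd c \<circ> s) y))"
      by (rule continuous_on_compose2[OF _ smooth_vec_on_imp_continuous_on[OF smooth_simplex_chart[OF s c(1)]]]) auto
  qed
  then have "continuous_on (simplex_chart p s c) (\<lambda>y. \<omega> (s y) (map (simplex_differential M p s y) vs))"
    by (rule continuous_on_eq) (simp only: eq)
  then show "\<exists>T. openin (top_of_set (standard_simplex p)) T \<and> y0 \<in> T \<and>
      continuous_on T (\<lambda>y. \<omega> (s y) (map (simplex_differential M p s y) vs))"
    using simplex_chart_openin[OF sing c(1)] y0 c(2) by blast
qed

lemma affine_subsimplex_chart:
  assumes s: "smooth_simplex M q s" and l: "\<And>j. j \<le> p \<Longrightarrow> l j \<in> standard_simplex q" and c: "c \<in> atlas M"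
  shows "smooth_vec_on (Suc p) (simplex_chart p (affine_subsimplex p l s) c) (snd c \<circ> affine_subsimplex p l s)"
    and "y \<in> simplex_chart p (affine_subsimplex p l s) c \<Longrightarrow> lin_map (Suc p) l y \<in> simplex_chart q s c"
    and "simplex_chart p (affine_subsimplex p l s) c \<subseteq> coord_space (Suc p)"
proof -
  let ?S = "simplex_chart p (affine_subsimplex p l s) c"
  show sub: "?S \<subseteq> coord_space (Suc p)" using standard_simplex_subset_coord_space by blast
  show L: "lin_map (Suc p) l y \<in> simplex_chart q s c" if "y \<in> ?S" for y
    using that lin_map_in_standard_simplex[OF l] by (auto simp: affine_subsimplex_def)
  have "smooth_vec_on (Suc p) ?S (\<lambda>y. (snd c \<circ> s) (lin_map (Suc p) l y))"
    using smooth_vec_on_compose[OF smooth_vec_on_lin_map[OF sub, of l] smooth_simplex_chart[OF s c]] L by blast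
  then show "smooth_vec_on (Suc p) ?S (snd c \<circ> affine_subsimplex p l s)"
    by (rule smooth_vec_on_cong_subset) (auto simp: affine_subsimplex_def)
qed

lemma smooth_simplex_affine_subsimplex:
  assumes s: "smooth_simplex M q s" and l: "\<And>j. j \<le> p \<Longrightarrow> l j \<in> standard_simplex q"
  shows "smooth_simplex M p (affine_subsimplex p l s)"
  unfolding smooth_simplex_def singular_simplex_iff_top_of_set
proof (intro conjI ballI affine_subsimplex_chart(1)[OF s l])
  have "continuous_map (top_of_set (standard_simplex p)) (top_of_set (standard_simplex q)) (lin_map (Suc p) l)"
    using continuous_on_lin_map lin_map_in_standard_simplex[OF l] by auto
  then have "continuous_map (top_of_set (standard_simplex p)) (mtop M) (s \<circ> lin_map (Suc p) l)"
    by (rule continuous_map_compose)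
      (use smooth_simplex_singular[OF s] in \<open>simp add: singular_simplex_iff_top_of_set\<close>)
  then show "continuous_map (top_of_set (standard_simplex p)) (mtop M) (affine_subsimplex p l s)"
    by (rule continuous_map_eq) (auto simp: affine_subsimplex_def)
  show "affine_subsimplex p l s \<in> extensional (standard_simplex p)" by (simp add: affine_subsimplex_def)
qed

text \<open>The differential of the linear map is the map itself, and it preserves vectors with
  coordinate sum 0, so the image direction is again determined in the q-simplex.\<close>

lemma simplex_differential_affine_subsimplex:
  assumes s: "smooth_simplex M q s" and l: "\<And>j. j \<le> p \<Longrightarrow> l j \<in> standard_simplex q"
    and x: "x \<in> standard_simplex p" and v: "(\<Sum>i\<le>p. v i) = 0"
  shows "simplex_differential M p (affine_subsimplex p l s) x v =
    simplex_differential M q s (lin_map (Suc p) l x) (lin_map (Suc p) l v)"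
proof
  fix c
  let ?r = "affine_subsimplex p l s"
  have rx: "?r x = s (lin_map (Suc p) l x)" using x by (simp add: affine_subsimplex_def)
  show "simplex_differential M p ?r x v c = simplex_differential M q s (lin_map (Suc p) l x) (lin_map (Suc p) l v) c"
  proof (cases "c \<in> atlas M \<and> ?r x \<in> fst c")
    case True
    then have c: "c \<in> atlas M" "?r x \<in> fst c" by auto
    note r = smooth_simplex_affine_subsimplex[OF s l]
    let ?S = "simplex_chart p ?r c"
    have xS: "x \<in> ?S" using x c by simp
    have det: "determined_dir (Suc p) ?S x v"
      by (rule determined_dir_simplex_chart[OF smooth_simplex_singular[OF r] c(1) xS v]) simp
    note sub = affine_subsimplex_chart(3)[OF s l c(1)]
    have dl: "differential (Suc p) ?S (lin_map (Suc p) l) x v = lin_map (Suc p) l v"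
      by (rule differential_lin_map[OF sub xS det]) simp
    have "differential (Suc p) ?S (snd c \<circ> ?r) x v = differential (Suc p) ?S (\<lambda>y. (snd c \<circ> s) (lin_map (Suc p) l y)) x v"
      by (rule differential_subset[OF smooth_simplex_chart[OF r c(1)] order_refl xS det]) (auto simp: affine_subsimplex_def)
    also have "\<dots> = differential (Suc q) (simplex_chart q s c) (snd c \<circ> s) (lin_map (Suc p) l x)
        (differential (Suc p) ?S (lin_map (Suc p) l) x v)"
    proof (rule differential_compose[OF smooth_vec_on_lin_map[OF sub] smooth_simplex_chart[OF s c(1)] _ xS det])
      show L: "lin_map (Suc p) l y \<in> simplex_chart q s c" if "y \<in> ?S" for y
        by (rule affine_subsimplex_chart(2)[OF s l c(1) that])
      show "determined_dir (Suc q) (simplex_chart q s c) (lin_map (Suc p) l x) (differential (Suc p) ?S (lin_map (Suc p) l) x v)"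
        unfolding dl
        by (rule determined_dir_simplex_chart[OF smooth_simplex_singular[OF s] c(1) L[OF xS] lin_map_sum_zero[OF l v]])
    qed simp_all
    finally show ?thesis using c rx dl by (simp add: simplex_differential_def)
  next
    case False
    then show ?thesis using rx by (auto simp: simplex_differential_def)
  qed
qed

end

text \<open>The i-th face omits the vertex i. The formula for faces of oriented simplices is applied
  to the identity, which is the oriented simplex with vertices \<open>unit_vec\<close>.\<close>

lemma singular_face_eq_affine_subsimplex:
  assumes "1 \<le> p" "i \<le> p"
  shows "singular_face p i s = affine_subsimplex (p - 1) (\<lambda>j. unit_vec (if j < i then j else Suc j)) s"
proof -
  let ?l = "\<lambda>j. if j < i then unit_vec j else unit_vec (Suc j)"
  have "simplical_face i x = lin_map (Suc (p - 1)) ?l x" if x: "x \<in> standard_simplex (p - 1)" for x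
  proof -
    have f: "simplical_face i x \<in> standard_simplex p"
      using simplical_face_in_standard_simplex[OF assms, of x] x by simp
    then have "simplical_face i x \<in> coord_space (Suc p)" using standard_simplex_subset_coord_space by blast
    then have "simplical_face i x = lin_map (Suc p) unit_vec (simplical_face i x)" by (simp add: lin_map_unit_vec)
    also have "\<dots> = singular_face p i (oriented_simplex p unit_vec) x"
      using f x by (simp add: singular_face_def oriented_simplex_def lin_map_def lessThan_Suc_atMost)
    also have "\<dots> = lin_map (Suc (p - 1)) ?l x"
      using x unfolding singular_face_oriented_simplex[OF assms]
      by (simp add: oriented_simplex_def lin_map_def lessThan_Suc_atMost)
    finally show ?thesis .
  qed
  then show ?thesis
    unfolding singular_face_def affine_subsimplex_def if_distrib[of unit_vec] by (intro ext) (simp add: restrict_def)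
qed

text \<open>Smoothness of \<rho> is given in pairs of charts, so the part of the simplex over a
  chart of \<open>M\<close> is cut down further by a chart of \<open>A\<close> around
  \<open>s x\<close>.\<close>

lemma smooth_simplex_map:
  assumes "smooth_manifold A" "smooth_manifold M" and \<rho>: "smooth_map A M \<rho>" and s: "smooth_simplex A p s"
  shows "smooth_simplex M p (simplex_map p \<rho> s)"
proof -
  interpret A: smooth_mfd A by unfold_locales fact
  interpret M: smooth_mfd M by unfold_locales fact
  note sing = A.smooth_simplex_singular[OF s]
  have sing': "singular_simplex p (mtop M) (simplex_map p \<rho> s)"
    by (rule singular_simplex_simplex_map[OF sing]) (use \<rho> in \<open>simp add: smooth_map_def\<close>)
  have "smooth_on (Suc p) {x \<in> standard_simplex p. simplex_map p \<rho> s x \<in> fst d} (\<lambda>x. (snd d \<circ> simplex_map p \<rho> s) x j)"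
    (is "smooth_on _ ?S _") if d: "d \<in> atlas M" for d j
  proof (rule smooth_on_local)
    fix x assume x: "x \<in> ?S"
    obtain c where c: "c \<in> atlas A" "s x \<in> fst c" using A.obtain_chart[OF A.simplex_in_topspace[OF sing, of x]] x by blast
    define T where "T = ?S \<inter> {x \<in> standard_simplex p. s x \<in> fst c}"
    have "openin (top_of_set ?S) T"
      using A.simplex_chart_openin[OF sing c(1)] unfolding T_def openin_open by auto
    moreover have "x \<in> T" using x c by (simp add: T_def)
    moreover have "smooth_vec_on (Suc p) T (snd d \<circ> simplex_map p \<rho> s)"
    proof -
      have s': "smooth_vec_on (Suc p) T (snd c \<circ> s)"
        by (rule smooth_vec_on_cong_subset[OF A.smooth_simplex_chart[OF s c(1)]]) (auto simp: T_def)
      have r: "smooth_vec_on (mdim A) (snd c ` {p \<in> fst c. \<rho> p \<in> fst d}) (snd d \<circ> \<rho> \<circ> inv_chart c)"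
        using \<rho> c(1) d by (simp add: smooth_map_def)
      have "smooth_vec_on (Suc p) T (\<lambda>y. (snd d \<circ> \<rho> \<circ> inv_chart c) ((snd c \<circ> s) y))"
        by (rule smooth_vec_on_compose[OF s' r]) (auto simp: T_def simplex_map_def)
      then show ?thesis
        by (rule smooth_vec_on_cong_subset) (auto simp: T_def simplex_map_def A.inv_chart_left[OF c(1)])
    qed
    ultimately show "\<exists>T. openin (top_of_set ?S) T \<and> x \<in> T \<and> smooth_on (Suc p) T (\<lambda>x. (snd d \<circ> simplex_map p \<rho> s) x j)"
      by (auto simp: smooth_vec_on_def)
  qed
  then show ?thesis using sing' by (auto simp: smooth_simplex_def smooth_vec_on_def)
qed

section \<open>Integration over simplices\<close>

abbreviation param_measure :: "nat \<Rightarrow> (nat \<Rightarrow> real) measure" where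
  "param_measure k \<equiv> Pi\<^sub>M {1..k} (\<lambda>_. lborel)"

abbreviation param_simplex :: "nat \<Rightarrow> (nat \<Rightarrow> real) set" where
  "param_simplex k \<equiv> {t. (\<forall>j\<in>{1..k}. 0 \<le> t j) \<and> (\<Sum>j\<in>{1..k}. t j) \<le> 1}"

lemma atMost_eq_insert_0: "{..k} = insert 0 {1..k::nat}"
  by auto

lemma barycentric_in_standard_simplex_iff: "barycentric k t \<in> standard_simplex k \<longleftrightarrow> t \<in> param_simplex k"
proof -
  have s: "(\<Sum>i\<le>k. barycentric k t i) = 1"
    unfolding atMost_eq_insert_0 by (simp add: barycentric_def)
  show ?thesis
  proof
    assume b: "barycentric k t \<in> standard_simplex k"
    then have b': "\<And>i. 0 \<le> barycentric k t i" by (simp add: standard_simplex_def)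
    have "0 \<le> t j" if "j \<in> {1..k}" for j using b'[of j] that by (simp add: barycentric_def)
    moreover have "(\<Sum>j\<in>{1..k}. t j) \<le> 1" using b'[of 0] by (simp add: barycentric_def)
    ultimately show "t \<in> param_simplex k" by blast
  next
    assume t: "t \<in> param_simplex k"
    have nn: "0 \<le> barycentric k t i" for i using t by (auto simp: barycentric_def)
    have "barycentric k t i \<le> 1" for i
    proof (cases "i \<le> k")
      case True
      then have "barycentric k t i \<le> (\<Sum>i\<le>k. barycentric k t i)" by (intro member_le_sum) (auto simp: nn)
      then show ?thesis using s by simp
    qed (simp add: barycentric_def)
    then show "barycentric k t \<in> standard_simplex k"
      using nn s by (auto simp: standard_simplex_def) (simp add: barycentric_def)
  qed
qed

lemma measurable_barycentric: "barycentric k \<in> borel_measurable (param_measure k)"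
proof (rule measurable_coordinatewise_then_product)
  fix i
  have c: "(\<lambda>t. t j) \<in> borel_measurable (param_measure k)" if "j \<in> {1..k}" for j
    using measurable_component_singleton[OF that, of "\<lambda>_. lborel"] by simp
  show "(\<lambda>t. barycentric k t i) \<in> borel_measurable (param_measure k)"
  proof (cases "i = 0")
    case True
    have "(\<lambda>t. 1 - (\<Sum>j\<in>{1..k}. t j)) \<in> borel_measurable (param_measure k)"
      by (intro borel_measurable_diff borel_measurable_sum borel_measurable_const c)
    then show ?thesis by (simp add: barycentric_def True)
  next
    case False
    then show ?thesis using c[of i] by (cases "i \<le> k") (simp_all add: barycentric_def)
  qed
qed

lemma compact_standard_simplex: "compact (standard_simplex k)"
  using compactin_standard_simplex[of k] by (simp add: euclidean_product_topology)

text \<open>\<open>param_simplex k\<close> contains functions with arbitrary values outside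
  \<open>{1..k}\<close>, while the points of the product measure are extensional; hence the
  intersection with the space.\<close>

lemma param_simplex_measurable: "param_simplex k \<inter> space (param_measure k) \<in> sets (param_measure k)"
proof -
  have "barycentric k -` standard_simplex k \<inter> space (param_measure k) \<in> sets (param_measure k)"
    by (rule measurable_sets[OF measurable_barycentric]) (simp add: borel_compact compact_standard_simplex)
  moreover have "barycentric k -` standard_simplex k = param_simplex k"
    using barycentric_in_standard_simplex_iff by blast
  ultimately show ?thesis by simp
qed

lemma emeasure_param_box:
  assumes "0 \<le> a"
  shows "emeasure (param_measure k) (Pi\<^sub>E {1..k} (\<lambda>_. {0..a})) = ennreal a ^ k"
    and "Pi\<^sub>E {1..k} (\<lambda>_. {0..a}) \<in> sets (param_measure k)"
proof -
  interpret product_sigma_finite "\<lambda>_::nat. lborel :: real measure" by unfold_locales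
  show "emeasure (param_measure k) (Pi\<^sub>E {1..k} (\<lambda>_. {0..a})) = ennreal a ^ k"
    using assms by (subst emeasure_PiM) auto
  show "Pi\<^sub>E {1..k} (\<lambda>_. {0..a}) \<in> sets (param_measure k)"
    by (rule sets_PiM_I_finite) auto
qed

lemma emeasure_param_simplex_finite: "emeasure (param_measure k) (param_simplex k \<inter> space (param_measure k)) < \<infinity>"
proof -
  have "param_simplex k \<inter> space (param_measure k) \<subseteq> Pi\<^sub>E {1..k} (\<lambda>_. {0..1})"
  proof
    fix t assume t: "t \<in> param_simplex k \<inter> space (param_measure k)"
    have "t j \<le> 1" if "j \<in> {1..k}" for j
      using member_le_sum[of j "{1..k}" t] t that by force
    then show "t \<in> Pi\<^sub>E {1..k} (\<lambda>_. {0..1})" using t by (auto simp: space_PiM PiE_iff)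
  qed
  then have "emeasure (param_measure k) (param_simplex k \<inter> space (param_measure k)) \<le>
      emeasure (param_measure k) (Pi\<^sub>E {1..k} (\<lambda>_. {0..1}))"
    by (rule emeasure_mono) (rule emeasure_param_box(2), simp)
  also have "\<dots> = 1" by (subst emeasure_param_box(1)) auto
  finally show ?thesis by (simp add: order_le_less_trans)
qed

definition param_volume :: "nat \<Rightarrow> real" where
  "param_volume k = measure (param_measure k) (param_simplex k \<inter> space (param_measure k))"

lemma param_volume_pos: "param_volume k > 0"
proof -
  \<comment> \<open>Then k coordinates of at most this size sum to at most k / (k + 1), so the cube
    lies in the simplex; the added 1 also avoids a zero denominator for k = 0.\<close>
  let ?a = "1 / (real k + 1)"
  have "Pi\<^sub>E {1..k} (\<lambda>_. {0..?a}) \<subseteq> param_simplex k \<inter> space (param_measure k)"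
  proof
    fix t assume t: "t \<in> Pi\<^sub>E {1..k} (\<lambda>_. {0..?a})"
    have "(\<Sum>j\<in>{1..k}. t j) \<le> (\<Sum>j\<in>{1..k}. ?a)" using t by (intro sum_mono) auto
    also have "\<dots> \<le> 1" by (simp add: field_simps)
    finally show "t \<in> param_simplex k \<inter> space (param_measure k)" using t by (auto simp: space_PiM PiE_iff)
  qed
  then have "emeasure (param_measure k) (Pi\<^sub>E {1..k} (\<lambda>_. {0..?a})) \<le>
      emeasure (param_measure k) (param_simplex k \<inter> space (param_measure k))"
    using param_simplex_measurable by (rule emeasure_mono)
  moreover have "emeasure (param_measure k) (Pi\<^sub>E {1..k} (\<lambda>_. {0..?a})) = ennreal (?a ^ k)"
    by (subst emeasure_param_box(1)) (simp_all add: ennreal_power)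
  moreover have "0 < ennreal (?a ^ k)" by (simp only: ennreal_less_zero_iff) simp
  ultimately have "0 < emeasure (param_measure k) (param_simplex k \<inter> space (param_measure k))"
    by (simp only: less_le_trans)
  then show ?thesis
    unfolding param_volume_def measure_def using emeasure_param_simplex_finite[of k]
    by (simp add: enn2real_positive_iff)
qed

abbreviation bary_integral :: "nat \<Rightarrow> ((nat \<Rightarrow> real) \<Rightarrow> real) \<Rightarrow> real" where
  "bary_integral k G \<equiv> (LINT t : param_simplex k | param_measure k. G (barycentric k t))"

lemma standard_simplex_bounded:
  fixes G :: "(nat \<Rightarrow> real) \<Rightarrow> real"
  assumes "continuous_on (standard_simplex k) G"
  shows "\<exists>B. \<forall>x\<in>standard_simplex k. \<bar>G x\<bar> \<le> B"
proof -
  have "bounded (G ` standard_simplex k)"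
    by (rule compact_imp_bounded[OF compact_continuous_image[OF assms compact_standard_simplex]])
  then show ?thesis by (auto simp: bounded_iff)
qed

lemma bary_integral_bound_integrable:
  "integrable (param_measure k) (\<lambda>t. B * indicator (param_simplex k \<inter> space (param_measure k)) t :: real)"
  by (intro integrable_mult_right integrable_real_indicator param_simplex_measurable emeasure_param_simplex_finite)

lemma bary_integrable:
  fixes G :: "(nat \<Rightarrow> real) \<Rightarrow> real"
  assumes G: "continuous_on (standard_simplex k) G"
  shows "set_integrable (param_measure k) (param_simplex k) (\<lambda>t. G (barycentric k t))"
proof -
  have eq: "(\<lambda>t. indicator (param_simplex k) t *\<^sub>R G (barycentric k t)) =
      (\<lambda>t. (\<lambda>y. indicator (standard_simplex k) y *\<^sub>R G y) (barycentric k t))"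
    using barycentric_in_standard_simplex_iff[of k] by (auto simp: indicator_def fun_eq_iff)
  have "(\<lambda>y. indicator (standard_simplex k) y *\<^sub>R G y) \<in> borel_measurable borel"
    by (rule borel_measurable_continuous_on_indicator[OF _ G]) (simp add: borel_compact compact_standard_simplex)
  then have m: "(\<lambda>t. indicator (param_simplex k) t *\<^sub>R G (barycentric k t)) \<in> borel_measurable (param_measure k)"
    unfolding eq by (rule measurable_compose[OF measurable_barycentric])
  obtain B where B: "\<forall>x\<in>standard_simplex k. \<bar>G x\<bar> \<le> B" using standard_simplex_bounded[OF G] by blast
  show ?thesis
    unfolding set_integrable_def
  proof (rule Bochner_Integration.integrable_bound[OF bary_integral_bound_integrable[of k B] m])
    show "AE t in param_measure k. norm (indicator (param_simplex k) t *\<^sub>R G (barycentric k t)) \<le>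
        norm (B * indicator (param_simplex k \<inter> space (param_measure k)) t :: real)"
    proof (rule AE_I2)
      fix t assume t: "t \<in> space (param_measure k)"
      show "norm (indicator (param_simplex k) t *\<^sub>R G (barycentric k t)) \<le>
        norm (B * indicator (param_simplex k \<inter> space (param_measure k)) t :: real)"
      proof (cases "t \<in> param_simplex k")
        case True
        then have "\<bar>G (barycentric k t)\<bar> \<le> B"
          by (intro B[rule_format]) (simp only: barycentric_in_standard_simplex_iff)
        then have "\<bar>G (barycentric k t)\<bar> \<le> \<bar>B\<bar>" by linarith
        moreover have "t \<in> param_simplex k \<inter> space (param_measure k)" using True t by blast
        ultimately show ?thesis using True by (simp only: indicator_simps) simp
      next
        case False
        show ?thesis unfolding indicator_simps(2)[OF False] by simp
      qed
    qed
  qed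
qed

lemma bary_integral_const: "bary_integral k (\<lambda>_. c) = c * param_volume k"
proof -
  have "bary_integral k (\<lambda>_. c) = (LINT t|param_measure k. c * indicator (param_simplex k \<inter> space (param_measure k)) t)"
    unfolding set_lebesgue_integral_def
    by (rule Bochner_Integration.integral_cong) (auto simp: indicator_def)
  then show ?thesis by (simp add: param_volume_def)
qed

lemma bary_integral_cong:
  assumes "\<And>y. y \<in> standard_simplex k \<Longrightarrow> G y = G' y"
  shows "bary_integral k G = bary_integral k G'"
  unfolding set_lebesgue_integral_def
proof (rule Bochner_Integration.integral_cong[OF refl])
  fix t
  show "indicator (param_simplex k) t *\<^sub>R G (barycentric k t) = indicator (param_simplex k) t *\<^sub>R G' (barycentric k t)"
  proof (cases "t \<in> param_simplex k")
    case True
    then have "G (barycentric k t) = G' (barycentric k t)"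
      by (intro assms) (simp only: barycentric_in_standard_simplex_iff)
    then show ?thesis by (simp only:)
  next
    case False
    show ?thesis unfolding indicator_simps(2)[OF False] by simp
  qed
qed

text \<open>Dominated convergence along sequences; the constant \<open>B\<close> is an integrable
  majorant because the simplex has finite volume.\<close>

lemma continuous_on_bary_integral:
  assumes G: "\<And>u. u \<in> S \<Longrightarrow> continuous_on (standard_simplex k) (G u)"
    and cont: "\<And>y. y \<in> standard_simplex k \<Longrightarrow> continuous_on S (\<lambda>u. G u y)"
    and B: "\<And>u y. u \<in> S \<Longrightarrow> y \<in> standard_simplex k \<Longrightarrow> \<bar>G u y\<bar> \<le> B"
  shows "continuous_on S (\<lambda>u::real. bary_integral k (G u))"
  unfolding continuous_on_sequentially
proof (intro allI ballI impI)
  fix u :: "nat \<Rightarrow> real" and a assume a: "a \<in> S" and "(\<forall>n. u n \<in> S) \<and> u \<longlonglongrightarrow> a"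
  then have u: "\<And>n. u n \<in> S" "u \<longlonglongrightarrow> a" by auto
  let ?f = "\<lambda>u t. indicator (param_simplex k) t *\<^sub>R G u (barycentric k t)"
  have m: "?f u \<in> borel_measurable (param_measure k)" if "u \<in> S" for u
    using bary_integrable[OF G[OF that]] by (simp add: set_integrable_def)
  have "(\<lambda>n. integral\<^sup>L (param_measure k) (?f (u n))) \<longlonglongrightarrow> integral\<^sup>L (param_measure k) (?f a)"
  proof (rule integral_dominated_convergence[OF m[OF a] m[OF u(1)] bary_integral_bound_integrable[of k B]])
    show "AE t in param_measure k. (\<lambda>n. ?f (u n) t) \<longlonglongrightarrow> ?f a t"
    proof (rule AE_I2)
      fix t
      show "(\<lambda>n. ?f (u n) t) \<longlonglongrightarrow> ?f a t"
      proof (cases "t \<in> param_simplex k")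
        case True
        then have "continuous_on S (\<lambda>u. G u (barycentric k t))"
          by (intro cont) (simp only: barycentric_in_standard_simplex_iff)
        then have "(\<lambda>n. G (u n) (barycentric k t)) \<longlonglongrightarrow> G a (barycentric k t)"
          using a u unfolding continuous_on_sequentially comp_def by blast
        then show ?thesis using True by (simp only: indicator_simps) simp
      next
        case False
        show ?thesis unfolding indicator_simps(2)[OF False] by simp
      qed
    qed
    show "AE t in param_measure k. norm (?f (u n) t) \<le> B * indicator (param_simplex k \<inter> space (param_measure k)) t" for n
    proof (rule AE_I2)
      fix t assume t: "t \<in> space (param_measure k)"
      show "norm (?f (u n) t) \<le> B * indicator (param_simplex k \<inter> space (param_measure k)) t"
      proof (cases "t \<in> param_simplex k")
        case True
        then have "\<bar>G (u n) (barycentric k t)\<bar> \<le> B"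
          by (intro B[OF u(1)]) (simp only: barycentric_in_standard_simplex_iff)
        moreover have "t \<in> param_simplex k \<inter> space (param_measure k)" using True t by blast
        ultimately show ?thesis using True by (simp only: indicator_simps) simp
      next
        case False
        then have "t \<notin> param_simplex k \<inter> space (param_measure k)" by blast
        then show ?thesis unfolding indicator_simps(2)[OF False] by simp
      qed
    qed
  qed
  then show "((\<lambda>u. bary_integral k (G u)) \<circ> u) \<longlonglongrightarrow> bary_integral k (G a)"
    unfolding set_lebesgue_integral_def comp_def .
qed

text \<open>The image of the interval is connected, so a nonconstant function would put some
  \<open>{a..b}\<close> with a < b into \<Lambda>. Differences then give all of
  \<open>{0..b - a}\<close>, multiples of these give every nonnegative number, and negatives the
  whole line.\<close>

lemma constant_if_values_in_proper_subgroup: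
  fixes \<phi> :: "real \<Rightarrow> real"
  assumes \<Lambda>: "\<And>x y. x \<in> \<Lambda> \<Longrightarrow> y \<in> \<Lambda> \<Longrightarrow> x - y \<in> \<Lambda>" "\<Lambda> \<noteq> UNIV"
    and \<phi>: "continuous_on {0..1} \<phi>" "\<And>t. t \<in> {0..1} \<Longrightarrow> \<phi> t \<in> \<Lambda>" and t: "t \<in> {0..1}"
  shows "\<phi> t = \<phi> 0"
proof (rule ccontr)
  assume ne: "\<phi> t \<noteq> \<phi> 0"
  have conn: "connected (\<phi> ` {0..1})" by (rule connected_continuous_image[OF \<phi>(1)]) simp
  define a where "a = min (\<phi> t) (\<phi> 0)"
  define b where "b = max (\<phi> t) (\<phi> 0)"
  have ab: "a < b" "a \<in> \<phi> ` {0..1}" "b \<in> \<phi> ` {0..1}"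
    using ne t by (auto simp: a_def b_def min_def max_def)
  have "{a..b} \<subseteq> \<phi> ` {0..1}" by (rule connected_contains_Icc[OF conn ab(2,3)])
  then have "{a..b} \<subseteq> \<Lambda>" using \<phi>(2) by auto
  have "a \<in> \<Lambda>" using \<open>{a..b} \<subseteq> \<Lambda>\<close> ab(1) by force
  then have z: "0 \<in> \<Lambda>" using \<Lambda>(1)[of a a] by simp
  have neg: "- x \<in> \<Lambda>" if "x \<in> \<Lambda>" for x using \<Lambda>(1)[OF z that] by simp
  have add: "x + y \<in> \<Lambda>" if "x \<in> \<Lambda>" "y \<in> \<Lambda>" for x y using \<Lambda>(1)[OF that(1) neg[OF that(2)]] by simp
  have small: "x \<in> \<Lambda>" if "0 \<le> x" "x \<le> b - a" for x
  proof -
    have "a + x \<in> \<Lambda>" using \<open>{a..b} \<subseteq> \<Lambda>\<close> that by force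
    from \<Lambda>(1)[OF this \<open>a \<in> \<Lambda>\<close>] show ?thesis by simp
  qed
  have mult: "real n * x \<in> \<Lambda>" if "x \<in> \<Lambda>" for n x
    by (induction n) (use z add that in \<open>auto simp: algebra_simps\<close>)
  have nonneg: "x \<in> \<Lambda>" if "0 \<le> x" for x
  proof -
    obtain n :: nat where n: "x / (b - a) < real n" using reals_Archimedean2 by blast
    then have n0: "real n > 0" using that ab(1) by (smt (verit) divide_nonneg_pos)
    have "x < real n * (b - a)" using n ab(1) by (simp add: pos_divide_less_eq)
    then have "x / real n \<le> b - a" using n0 by (simp add: pos_divide_le_eq mult.commute)
    then have "x / real n \<in> \<Lambda>" using that n0 by (intro small) auto
    from mult[OF this, of n] show ?thesis using n0 by simp
  qed
  have "x \<in> \<Lambda>" for x using nonneg[of x] neg[OF nonneg[of "- x"]] by (cases "0 \<le> x") auto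
  then show False using \<Lambda>(2) by blast
qed

section \<open>Contraction of a simplex to a vertex\<close>

lemma unit_vec_in_standard_simplex: "j \<le> p \<Longrightarrow> unit_vec j \<in> standard_simplex p"
  by (simp add: unit_vec_def)

lemma standard_simplex_diff_sum_zero:
  "u \<in> standard_simplex q \<Longrightarrow> w \<in> standard_simplex q \<Longrightarrow> (\<Sum>i\<le>q. u i - w i) = 0"
  by (simp add: standard_simplex_def sum_subtractf)

lemma lin_map_apply_unit_vec:
  assumes "m < n"
  shows "lin_map n l (unit_vec m) = l m"
proof
  fix i
  have "lin_map n l (unit_vec m) i = (\<Sum>j<n. if j = m then l m i else 0)"
    unfolding lin_map_def by (rule sum.cong) (auto simp: unit_vec_def)
  then show "lin_map n l (unit_vec m) i = l m i" using assms by simp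
qed

lemma lin_map_diff: "lin_map n l (\<lambda>i. u i - w i) = (\<lambda>i. lin_map n l u i - lin_map n l w i)"
  by (simp add: lin_map_def right_diff_distrib sum_subtractf)

lemma lin_map_lin_map: "lin_map n l (lin_map m l' x) = lin_map m (\<lambda>j. lin_map n l (l' j)) x"
proof
  fix i
  have "lin_map n l (lin_map m l' x) i = (\<Sum>k<n. \<Sum>j<m. l k i * (l' j k * x j))"
    by (simp add: lin_map_def sum_distrib_left)
  also have "\<dots> = (\<Sum>j<m. \<Sum>k<n. l k i * (l' j k * x j))" by (rule sum.swap)
  also have "\<dots> = lin_map m (\<lambda>j. lin_map n l (l' j)) x i"
    by (simp add: lin_map_def sum_distrib_right mult.assoc)
  finally show "lin_map n l (lin_map m l' x) i = \<dots>" .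
qed

lemma affine_subsimplex_affine_subsimplex:
  assumes "\<And>j. j \<le> p \<Longrightarrow> l' j \<in> standard_simplex q"
  shows "affine_subsimplex p l' (affine_subsimplex q l s) = affine_subsimplex p (\<lambda>j. lin_map (Suc q) l (l' j)) s"
  using lin_map_in_standard_simplex[OF assms]
  by (auto simp: affine_subsimplex_def restrict_def lin_map_lin_map)

lemma lin_map_cong: "(\<And>j. j < n \<Longrightarrow> l j = l' j) \<Longrightarrow> lin_map n l = lin_map n l'"
  unfolding lin_map_def by (intro ext sum.cong) auto

lemma affine_subsimplex_cong: "(\<And>j. j \<le> p \<Longrightarrow> l j = l' j) \<Longrightarrow> affine_subsimplex p l s = affine_subsimplex p l' s"
  unfolding affine_subsimplex_def using lin_map_cong[of "Suc p" l l'] by simp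

text \<open>The homotopy that contracts the simplex with vertices \<open>l j\<close> to the vertex \<open>unit_vec 0\<close>.\<close>

definition contraction :: "real \<Rightarrow> (nat \<Rightarrow> nat \<Rightarrow> real) \<Rightarrow> nat \<Rightarrow> nat \<Rightarrow> real" where
  "contraction t l j i = (1 - t) * unit_vec 0 i + t * l j i"

lemma contraction_in_standard_simplex:
  "l j \<in> standard_simplex q \<Longrightarrow> t \<in> {0..1} \<Longrightarrow> contraction t l j \<in> standard_simplex q"
  using convex_standard_simplex[OF unit_vec_in_standard_simplex[of 0 q], of "l j" t]
  by (simp add: contraction_def[abs_def])

lemma contraction_1 [simp]: "contraction 1 l = l"
  by (simp add: contraction_def[abs_def])

lemma lin_map_contraction:
  assumes "x \<in> standard_simplex p"
  shows "lin_map (Suc p) (contraction t l) x i = (1 - t) * unit_vec 0 i + t * lin_map (Suc p) l x i"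
proof -
  have "(\<Sum>j<Suc p. x j) = 1" using assms by (simp add: standard_simplex_def lessThan_Suc_atMost)
  moreover have "lin_map (Suc p) (contraction t l) x i =
      (1 - t) * unit_vec 0 i * (\<Sum>j<Suc p. x j) + t * lin_map (Suc p) l x i"
    unfolding lin_map_def contraction_def
    by (simp add: distrib_right sum.distrib sum_distrib_left mult.assoc del: sum.lessThan_Suc)
  ultimately show ?thesis by simp
qed

abbreviation shrink :: "nat \<Rightarrow> real \<Rightarrow> ((nat \<Rightarrow> real) \<Rightarrow> 'a) \<Rightarrow> (nat \<Rightarrow> real) \<Rightarrow> 'a" where
  "shrink p t s \<equiv> affine_subsimplex p (contraction t unit_vec) s"

text \<open>A face of the contracted simplex is a contracted face, but contracted towards the vertex
  0 of the whole simplex, which is not on the face for i = 0. This is why \<open>contraction\<close>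
  is defined for arbitrary vertices \<open>l\<close>.\<close>

lemma singular_face_shrink:
  assumes "1 \<le> q" "i \<le> q"
  shows "singular_face q i (shrink q t s) =
    affine_subsimplex (q - 1) (contraction t (\<lambda>j. unit_vec (if j < i then j else Suc j))) s"
proof -
  have le: "(if j < i then j else Suc j) \<le> q" if "j \<le> q - 1" for j using that assms by auto
  have "singular_face q i (shrink q t s) =
      affine_subsimplex (q - 1) (\<lambda>j. lin_map (Suc q) (contraction t unit_vec) (unit_vec (if j < i then j else Suc j))) s"
    unfolding singular_face_eq_affine_subsimplex[OF assms]
    by (rule affine_subsimplex_affine_subsimplex) (rule unit_vec_in_standard_simplex[OF le])
  also have "\<dots> = affine_subsimplex (q - 1) (contraction t (\<lambda>j. unit_vec (if j < i then j else Suc j))) s"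
  proof (rule affine_subsimplex_cong)
    fix j assume "j \<le> q - 1"
    then have "lin_map (Suc q) (contraction t unit_vec) (unit_vec (if j < i then j else Suc j)) =
        contraction t unit_vec (if j < i then j else Suc j)"
      by (intro lin_map_apply_unit_vec) (use le in \<open>simp add: less_Suc_eq_le\<close>)
    then show "lin_map (Suc q) (contraction t unit_vec) (unit_vec (if j < i then j else Suc j)) =
        contraction t (\<lambda>j. unit_vec (if j < i then j else Suc j)) j"
      by (simp add: contraction_def[abs_def])
  qed
  finally show ?thesis .
qed

lemma shrink_1: "singular_simplex p T s \<Longrightarrow> shrink p 1 s = s"
proof
  fix x assume s: "singular_simplex p T s"
  show "shrink p 1 s x = s x"
  proof (cases "x \<in> standard_simplex p")
    case True
    then have "x \<in> coord_space (Suc p)" using standard_simplex_subset_coord_space by blast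
    then show ?thesis using True by (simp add: affine_subsimplex_def lin_map_unit_vec)
  next
    case False
    then show ?thesis using s by (simp add: affine_subsimplex_def singular_simplex_def extensional_def)
  qed
qed

text \<open>Contraction acts before \<open>s\<close> and \<rho> acts after it; for t in the unit
  interval the contracted point stays in the simplex, where the restrictions have no effect. So a
  simplex of \<open>A\<close> and its image in \<open>M\<close> can be contracted
  simultaneously.\<close>

lemma simplex_map_shrink:
  assumes "t \<in> {0..1}"
  shows "simplex_map p \<rho> (shrink p t s) = shrink p t (simplex_map p \<rho> s)"
proof
  fix x
  have "lin_map (Suc p) (contraction t unit_vec) x \<in> standard_simplex p" if "x \<in> standard_simplex p"
    by (rule lin_map_in_standard_simplex[OF contraction_in_standard_simplex[OF unit_vec_in_standard_simplex] that])
      (use assms in auto)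
  then show "simplex_map p \<rho> (shrink p t s) x = shrink p t (simplex_map p \<rho> s) x"
    by (auto simp: simplex_map_def affine_subsimplex_def)
qed

lemma vanishes_at_0:
  fixes K :: "real \<Rightarrow> real"
  assumes "continuous_on {0..1} K" "\<And>t. 0 < t \<Longrightarrow> t \<le> 1 \<Longrightarrow> K t = 0"
  shows "K 0 = 0"
proof -
  have "(\<lambda>n. K (inverse (real (Suc n)))) \<longlonglongrightarrow> K 0"
  proof -
    have *: "inverse (real (Suc n)) \<in> {0..1}" for n by (simp add: inverse_le_1_iff)
    have "(\<forall>n. inverse (real (Suc n)) \<in> {0..1::real}) \<and> (\<lambda>n. inverse (real (Suc n))) \<longlonglongrightarrow> 0"
      using * LIMSEQ_inverse_real_of_nat by blast
    then show ?thesis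
      using assms(1) unfolding continuous_on_sequentially comp_def by auto
  qed
  moreover have "K (inverse (real (Suc n))) = 0" for n
    by (rule assms(2)) (simp_all add: inverse_le_1_iff)
  ultimately show ?thesis by (simp add: LIMSEQ_const_iff)
qed

section \<open>Integrals along the contraction\<close>

context smooth_mfd
begin

text \<open>The form at \<open>s y\<close> on the images of the edges at vertex 0 of the simplex
  with vertices \<open>l\<close>. For p = q and \<open>l = unit_vec\<close> it is the integrand of
  \<open>integral_simplex\<close>.\<close>

abbreviation form_on_edges :: "nat \<Rightarrow> nat \<Rightarrow> 'a form \<Rightarrow> ((nat \<Rightarrow> real) \<Rightarrow> 'a) \<Rightarrow> (nat \<Rightarrow> nat \<Rightarrow> real) \<Rightarrow> (nat \<Rightarrow> real) \<Rightarrow> real" where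
  "form_on_edges p q \<omega> s l y \<equiv> \<omega> (s y) (map (\<lambda>j. simplex_differential M q s y (\<lambda>i. l j i - l 0 i)) [1..<Suc p])"

lemma integral_simplex_eq: "integral_simplex M k \<omega> s = bary_integral k (form_on_edges k k \<omega> s unit_vec)"
  by (simp add: integral_simplex_def)

lemma continuous_on_form_on_edges:
  assumes "is_form M p \<omega>" "smooth_simplex M q s" "\<And>j. j \<le> p \<Longrightarrow> l j \<in> standard_simplex q"
  shows "continuous_on (standard_simplex q) (form_on_edges p q \<omega> s l)"
proof -
  have "continuous_on (standard_simplex q)
      (\<lambda>y. \<omega> (s y) (map (simplex_differential M q s y) (map (\<lambda>j i. l j i - l 0 i) [1..<Suc p])))"
    by (rule continuous_on_form_pullback[OF assms(1,2)])
      (use assms(3) in \<open>auto intro!: standard_simplex_diff_sum_zero\<close>)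
  then show ?thesis by (simp only: map_map comp_def)
qed

lemma integral_simplex_add:
  assumes "is_form M k \<omega>" "is_form M k \<eta>" "smooth_simplex M k s"
  shows "integral_simplex M k (\<lambda>p vs. \<omega> p vs + \<eta> p vs) s = integral_simplex M k \<omega> s + integral_simplex M k \<eta> s"
  unfolding integral_simplex_eq
  by (intro set_integral_add bary_integrable continuous_on_form_on_edges assms unit_vec_in_standard_simplex)

lemma form_scale:
  assumes \<omega>: "is_form M k \<omega>" and p: "p \<in> topspace (mtop M)"
    and "set us \<subseteq> tangent_space M p" "set vs \<subseteq> tangent_space M p" "length us + length vs = k"
  shows "\<omega> p (us @ map (\<lambda>v c i. t * v c i) vs) = t ^ length vs * \<omega> p (us @ vs)"
  using assms(3-5)
proof (induction vs arbitrary: us)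
  case (Cons v vs)
  note f = form_alternating[OF \<omega> p]
  have sc: "(\<lambda>c i. t * v c i) \<in> tangent_space M p" if "v \<in> tangent_space M p" for v
    using tangent_space_lincomb[OF that that, of t 0] by simp
  have "\<omega> p (us @ map (\<lambda>v c i. t * v c i) (v # vs)) = \<omega> p (us @ (\<lambda>c i. t * v c i) # map (\<lambda>v c i. t * v c i) vs)"
    by simp
  also have "\<dots> = t * \<omega> p (us @ v # map (\<lambda>v c i. t * v c i) vs)"
    using alternating_multilinear_lincomb[OF f Cons.prems(1) _ _, of "map (\<lambda>v c i. t * v c i) vs" v v t 0]
      Cons.prems sc by auto
  also have "\<dots> = t * \<omega> p ((us @ [v]) @ map (\<lambda>v c i. t * v c i) vs)" by simp
  also have "\<dots> = t * (t ^ length vs * \<omega> p ((us @ [v]) @ vs))"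
    by (subst Cons.IH) (use Cons.prems in auto)
  finally show ?case by simp
qed simp

text \<open>Contraction multiplies every edge by t, and the form is linear in each of its p
  arguments, whence the factor t^p. What remains is the integrand on the original edges, at base
  points moved towards the vertex.\<close>

lemma integral_simplex_contraction:
  assumes \<omega>: "is_form M p \<omega>" and s: "smooth_simplex M q s" and l: "\<And>j. j \<le> p \<Longrightarrow> l j \<in> standard_simplex q"
    and t: "t \<in> {0..1}"
  shows "integral_simplex M p \<omega> (affine_subsimplex p (contraction t l) s) =
    t ^ p * bary_integral p (\<lambda>x. form_on_edges p q \<omega> s l (lin_map (Suc p) (contraction t l) x))"
proof -
  note c = contraction_in_standard_simplex[OF l t]
  have eq: "form_on_edges p p \<omega> (affine_subsimplex p (contraction t l) s) unit_vec x =
      t ^ p * form_on_edges p q \<omega> s l (lin_map (Suc p) (contraction t l) x)" if x: "x \<in> standard_simplex p" for x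
  proof -
    let ?y = "lin_map (Suc p) (contraction t l) x"
    have y: "?y \<in> standard_simplex q" by (rule lin_map_in_standard_simplex[OF c x])
    have "simplex_differential M p (affine_subsimplex p (contraction t l) s) x (\<lambda>i. unit_vec j i - unit_vec 0 i) =
        (\<lambda>c i. t * simplex_differential M q s ?y (\<lambda>i. l j i - l 0 i) c i)" if j: "j \<in> set [1..<Suc p]" for j
    proof -
      have v0: "(\<Sum>i\<le>p. unit_vec j i - unit_vec 0 i) = 0"
        by (rule standard_simplex_diff_sum_zero) (use j in \<open>auto intro: unit_vec_in_standard_simplex\<close>)
      have "simplex_differential M p (affine_subsimplex p (contraction t l) s) x (\<lambda>i. unit_vec j i - unit_vec 0 i) =
          simplex_differential M q s ?y (lin_map (Suc p) (contraction t l) (\<lambda>i. unit_vec j i - unit_vec 0 i))"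
        by (rule simplex_differential_affine_subsimplex[OF s c x v0])
      \<comment> \<open>Written as a combination of two vectors to fit
        \<open>simplex_differential_lincomb\<close>.\<close>
      also have "lin_map (Suc p) (contraction t l) (\<lambda>i. unit_vec j i - unit_vec 0 i) =
          (\<lambda>i. t * (l j i - l 0 i) + 0 * (l j i - l 0 i))"
        using j unfolding lin_map_diff
        by (subst (1 2) lin_map_apply_unit_vec) (auto simp: contraction_def right_diff_distrib)
      finally show ?thesis unfolding simplex_differential_lincomb by simp
    qed
    then have "map (\<lambda>j. simplex_differential M p (affine_subsimplex p (contraction t l) s) x (\<lambda>i. unit_vec j i - unit_vec 0 i)) [1..<Suc p] =
        map (\<lambda>v c i. t * v c i) (map (\<lambda>j. simplex_differential M q s ?y (\<lambda>i. l j i - l 0 i)) [1..<Suc p])"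
      unfolding map_map comp_def by (intro map_cong refl)
    moreover have "affine_subsimplex p (contraction t l) s x = s ?y" using x by (simp add: affine_subsimplex_def)
    moreover have "\<omega> (s ?y) ([] @ map (\<lambda>v c i. t * v c i) (map (\<lambda>j. simplex_differential M q s ?y (\<lambda>i. l j i - l 0 i)) [1..<Suc p])) =
        t ^ length (map (\<lambda>j. simplex_differential M q s ?y (\<lambda>i. l j i - l 0 i)) [1..<Suc p]) *
        \<omega> (s ?y) ([] @ map (\<lambda>j. simplex_differential M q s ?y (\<lambda>i. l j i - l 0 i)) [1..<Suc p])"
    proof (rule form_scale[OF \<omega> simplex_in_topspace[OF smooth_simplex_singular[OF s] y]])
      show "set (map (\<lambda>j. simplex_differential M q s ?y (\<lambda>i. l j i - l 0 i)) [1..<Suc p]) \<subseteq> tangent_space M (s ?y)"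
        using l by (auto intro!: simplex_differential_in_tangent_space[OF s y] standard_simplex_diff_sum_zero)
    qed auto
    ultimately show ?thesis by (simp only: append_Nil length_map length_upt diff_Suc_1)
  qed
  show ?thesis
    unfolding integral_simplex_eq using bary_integral_cong[OF eq] by (simp only: set_integral_mult_right)
qed

text \<open>The integral over the contracted simplex without its factor t^p. At t = 0 all base
  points have reached the vertex and the integrand is constant, so the value of the form at the
  vertex can be recovered from the integrals.\<close>

lemma continuous_on_bary_integral_contraction:
  assumes \<omega>: "is_form M p \<omega>" and s: "smooth_simplex M q s" and l: "\<And>j. j \<le> p \<Longrightarrow> l j \<in> standard_simplex q"
  shows "continuous_on {0..1} (\<lambda>t. bary_integral p (\<lambda>x. form_on_edges p q \<omega> s l (lin_map (Suc p) (contraction t l) x)))"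
    and "bary_integral p (\<lambda>x. form_on_edges p q \<omega> s l (lin_map (Suc p) (contraction 0 l) x)) =
      form_on_edges p q \<omega> s l (unit_vec 0) * param_volume p"
proof -
  define G where "G = form_on_edges p q \<omega> s l"
  have G: "continuous_on (standard_simplex q) G"
    unfolding G_def by (rule continuous_on_form_on_edges[OF \<omega> s l])
  obtain B where B: "\<forall>x\<in>standard_simplex q. \<bar>G x\<bar> \<le> B" using standard_simplex_bounded[OF G] by blast
  have L: "lin_map (Suc p) (contraction t l) x \<in> standard_simplex q" if "t \<in> {0..1}" "x \<in> standard_simplex p" for t x
    by (rule lin_map_in_standard_simplex[OF contraction_in_standard_simplex[OF l that(1)] that(2)])
  have "continuous_on {0..1} (\<lambda>t. bary_integral p (\<lambda>x. G (lin_map (Suc p) (contraction t l) x)))"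
  proof (rule continuous_on_bary_integral)
    show "continuous_on (standard_simplex p) (\<lambda>x. G (lin_map (Suc p) (contraction t l) x))" if "t \<in> {0..1}" for t
      by (rule continuous_on_compose2[OF G continuous_on_lin_map]) (use L[OF that] in auto)
    show "continuous_on {0..1} (\<lambda>t. G (lin_map (Suc p) (contraction t l) x))" if "x \<in> standard_simplex p" for x
    proof (rule continuous_on_compose2[OF G])
      show "continuous_on {0..1} (\<lambda>t. lin_map (Suc p) (contraction t l) x)"
        unfolding lin_map_contraction[OF that, abs_def]
        by (intro continuous_on_coordinatewise_then_product) (auto simp: lin_map_contraction[OF that] intro!: continuous_intros)
    qed (use L that in auto)
    show "\<bar>G (lin_map (Suc p) (contraction t l) x)\<bar> \<le> B" if "t \<in> {0..1}" "x \<in> standard_simplex p" for t x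
      using B L[OF that] by blast
  qed
  then show "continuous_on {0..1} (\<lambda>t. bary_integral p (\<lambda>x. form_on_edges p q \<omega> s l (lin_map (Suc p) (contraction t l) x)))"
    unfolding G_def .
  have "bary_integral p (\<lambda>x. G (lin_map (Suc p) (contraction 0 l) x)) = bary_integral p (\<lambda>_. G (unit_vec 0))"
  proof (rule bary_integral_cong)
    fix x assume "x \<in> standard_simplex p"
    then have "lin_map (Suc p) (contraction 0 l) x = unit_vec 0" by (intro ext) (simp add: lin_map_contraction)
    then show "G (lin_map (Suc p) (contraction 0 l) x) = G (unit_vec 0)" by simp
  qed
  also have "\<dots> = G (unit_vec 0) * param_volume p" by (rule bary_integral_const)
  finally show "bary_integral p (\<lambda>x. form_on_edges p q \<omega> s l (lin_map (Suc p) (contraction 0 l) x)) =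
      form_on_edges p q \<omega> s l (unit_vec 0) * param_volume p"
    unfolding G_def .
qed

text \<open>The power \<open>0 ^ p\<close> separates the cases: the limit is 0 in positive degree,
  while for p = 0 the factor is 1 and the evaluation at the vertex survives.\<close>

lemma continuous_on_integral_simplex_contraction:
  assumes \<omega>: "is_form M p \<omega>" and s: "smooth_simplex M q s" and l: "\<And>j. j \<le> p \<Longrightarrow> l j \<in> standard_simplex q"
  shows "continuous_on {0..1} (\<lambda>t. integral_simplex M p \<omega> (affine_subsimplex p (contraction t l) s))"
    and "integral_simplex M p \<omega> (affine_subsimplex p (contraction 0 l) s) =
      0 ^ p * (form_on_edges p q \<omega> s l (unit_vec 0) * param_volume p)"
proof -
  have "continuous_on {0..1}
      (\<lambda>t. t ^ p * bary_integral p (\<lambda>x. form_on_edges p q \<omega> s l (lin_map (Suc p) (contraction t l) x)))"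
    by (intro continuous_on_mult continuous_on_power continuous_on_id continuous_on_bary_integral_contraction(1)[OF \<omega> s l])
  then show "continuous_on {0..1} (\<lambda>t. integral_simplex M p \<omega> (affine_subsimplex p (contraction t l) s))"
    by (rule continuous_on_eq) (rule integral_simplex_contraction[OF \<omega> s l, symmetric])
  show "integral_simplex M p \<omega> (affine_subsimplex p (contraction 0 l) s) =
      0 ^ p * (form_on_edges p q \<omega> s l (unit_vec 0) * param_volume p)"
    by (rule trans[OF integral_simplex_contraction[OF \<omega> s l]
          arg_cong2[where f = "(*)", OF refl continuous_on_bary_integral_contraction(2)[OF \<omega> s l]]]) auto
qed

text \<open>For q > 1 every face has positive dimension and contributes 0 at t = 0. For q = 1 both
  faces have become the vertex 0 and there are no edge vectors, so the two contributions are equal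
  up to their opposite signs.\<close>

lemma boundary_integral_shrink:
  assumes s: "smooth_simplex M q s" and q: "1 \<le> q" and \<omega>: "is_form M (q - 1) \<omega>"
  defines "\<phi> t \<equiv> (\<Sum>i\<le>q. (-1) ^ i * integral_simplex M (q - 1) \<omega> (singular_face q i (shrink q t s)))"
  shows "continuous_on {0..1} \<phi>" and "\<phi> 0 = 0"
proof -
  let ?l = "\<lambda>i j. unit_vec (if j < i then j else Suc j)"
  have l: "?l i j \<in> standard_simplex q" if "i \<le> q" "j \<le> q - 1" for i j
    by (rule unit_vec_in_standard_simplex) (use that q in auto)
  have \<phi>: "\<phi> t = (\<Sum>i\<le>q. (-1) ^ i * integral_simplex M (q - 1) \<omega> (affine_subsimplex (q - 1) (contraction t (?l i)) s))" for t
    unfolding \<phi>_def by (intro sum.cong refl) (simp only: singular_face_shrink[OF q] atMost_iff)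
  show "continuous_on {0..1} \<phi>"
    unfolding \<phi>[abs_def]
    by (intro continuous_on_sum continuous_on_mult continuous_on_const continuous_on_integral_simplex_contraction(1)[OF \<omega> s l]) auto
  have "\<phi> 0 = (\<Sum>i\<le>q. (-1) ^ i * (0 ^ (q - 1) * (form_on_edges (q - 1) q \<omega> s (?l i) (unit_vec 0) * param_volume (q - 1))))"
    unfolding \<phi> by (intro sum.cong refl arg_cong2[where f = "(*)"] continuous_on_integral_simplex_contraction(2)[OF \<omega> s l]) auto
  also have "\<dots> = 0"
  proof (cases "q = 1")
    case True
    then show ?thesis by (simp add: atMost_Suc)
  next
    case False
    then show ?thesis using q by (simp add: power_0_left)
  qed
  finally show "\<phi> 0 = 0" .
qed

end

section \<open>Forms determined by their integrals\<close>

context smooth_mfd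
begin

text \<open>Outside tuples of tangent vectors a form is 0 by convention. A tangent vector is
  determined by its coordinates in one chart, and the expansion in that chart involves only the
  values on coordinate vectors.\<close>

lemma form_eq_zeroI:
  assumes \<omega>: "is_form M k \<omega>"
    and z: "\<And>c p js. c \<in> atlas M \<Longrightarrow> p \<in> fst c \<Longrightarrow> set js \<subseteq> {..<mdim M} \<Longrightarrow> length js = k \<Longrightarrow>
      \<omega> p (map (\<lambda>j. tvec_of M c p (unit_vec j)) js) = 0"
  shows "\<omega> = (\<lambda>p vs. 0)"
proof (intro ext)
  fix p vs
  show "\<omega> p vs = 0"
  proof (cases "p \<in> topspace (mtop M)")
    case False
    then show ?thesis using \<omega> by (simp add: is_form_def)
  next
    case True
    show ?thesis
    proof (cases "length vs = k \<and> set vs \<subseteq> tangent_space M p")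
      case False
      then show ?thesis using form_alternating[OF \<omega> True] by (simp add: alternating_multilinear_def)
    next
      case vs: True
      obtain c where c: "c \<in> atlas M" "p \<in> fst c" using obtain_chart[OF True] by blast
      have "map (tvec_of M c p) (map (\<lambda>v. v c) vs) = map (\<lambda>v. v) vs"
        unfolding map_map comp_def by (rule map_cong[OF refl]) (use tangent_space_tvec_of[OF _ c] vs in blast)
      then have "\<omega> p vs = \<omega> p (map (tvec_of M c p) (map (\<lambda>v. v c) vs))" by simp
      also have "\<dots> = (\<Sum>js\<in>{js. set js \<subseteq> {..<mdim M} \<and> length js = k}.
          prod_list (map2 (\<lambda>a j. a j) (map (\<lambda>v. v c) vs) js) * \<omega> p (map (\<lambda>j. tvec_of M c p (unit_vec j)) js))"
        by (rule form_expand[OF \<omega> c]) (use vs in simp)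
      also have "\<dots> = 0" using z[OF c] by (intro sum.neutral) auto
      finally show ?thesis .
    qed
  qed
qed

lemma continuous_map_inv_chart:
  assumes "c \<in> atlas M"
  shows "continuous_map (top_of_set (snd c ` fst c)) (mtop M) (inv_chart c)"
proof -
  have eq: "subtopology (half_space (mdim M)) (snd c ` fst c) = top_of_set (snd c ` fst c)"
  proof -
    have "snd c ` fst c \<subseteq> topspace (half_space (mdim M))"
      using is_chart[OF assms] by (simp add: is_chart_def openin_subset)
    then have "coord_space (mdim M) \<inter> {x. 0 \<le> x 0} \<inter> snd c ` fst c = snd c ` fst c"
      by (auto simp: half_space_def topspace_Euclidean_space)
    then show ?thesis
      unfolding half_space_def Euclidean_space_eq subtopology_subtopology by simp
  qed
  obtain g where g: "homeomorphic_maps (subtopology (mtop M) (fst c)) (top_of_set (snd c ` fst c)) (snd c) g"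
    using chart_homeomorphic[OF assms] unfolding eq homeomorphic_map_maps by blast
  then have "continuous_map (top_of_set (snd c ` fst c)) (mtop M) g"
    by (auto simp: homeomorphic_maps_def continuous_map_in_subtopology)
  then show ?thesis
  proof (rule continuous_map_eq)
    fix x assume "x \<in> topspace (top_of_set (snd c ` fst c))"
    then obtain p where p: "p \<in> fst c" "x = snd c p" by auto
    then have "g x = p"
      using g chart_subset[OF assms] by (auto simp: homeomorphic_maps_def)
    then show "g x = inv_chart c x" using inv_chart_left[OF assms p(1)] p(2) by simp
  qed
qed

text \<open>A source of simplices with prescribed edges at a point: in the chart \<open>c\<close>
  the simplex is affine, so its differential is the linear part.\<close>

lemma chart_affine_simplex:
  assumes c: "c \<in> atlas M" and A: "\<And>x. x \<in> standard_simplex k \<Longrightarrow> (\<lambda>i. a i + lin_map (Suc k) l x i) \<in> snd c ` fst c"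
  defines "s \<equiv> restrict (\<lambda>x. inv_chart c (\<lambda>i. a i + lin_map (Suc k) l x i)) (standard_simplex k)"
  shows "smooth_simplex M k s"
    and "x \<in> standard_simplex k \<Longrightarrow> (\<Sum>i\<le>k. v i) = 0 \<Longrightarrow>
      simplex_differential M k s x v = tvec_of M c (s x) (lin_map (Suc k) l v)"
proof -
  let ?A = "\<lambda>x i. a i + lin_map (Suc k) l x i"
  have sx: "s x = inv_chart c (?A x)" "s x \<in> fst c" "snd c (s x) = ?A x" if x: "x \<in> standard_simplex k" for x
  proof -
    show 1: "s x = inv_chart c (?A x)" using x by (simp add: s_def)
    obtain p where "p \<in> fst c" "?A x = snd c p" using A[OF x] by blast
    then show "s x \<in> fst c" "snd c (s x) = ?A x" using inv_chart_left[OF c, of p] 1 by auto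
  qed
  have sing: "singular_simplex k (mtop M) s"
    unfolding singular_simplex_iff_top_of_set
  proof
    have "continuous_on (standard_simplex k) ?A"
      by (intro continuous_on_coordinatewise_then_product continuous_on_add continuous_on_const
          continuous_on_product_then_coordinatewise[OF continuous_on_lin_map])
    then have "continuous_map (top_of_set (standard_simplex k)) (top_of_set (snd c ` fst c)) ?A"
      using A by auto
    from continuous_map_compose[OF this continuous_map_inv_chart[OF c]]
    show "continuous_map (top_of_set (standard_simplex k)) (mtop M) s"
      by (rule continuous_map_eq) (auto simp: sx(1))
  qed (simp add: s_def)
  show s: "smooth_simplex M k s"
    unfolding smooth_simplex_def
  proof (intro conjI sing ballI)
    fix d assume d: "d \<in> atlas M"
    have sub: "simplex_chart k s d \<subseteq> coord_space (Suc k)" using standard_simplex_subset_coord_space by blast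
    have "smooth_vec_on (Suc k) (simplex_chart k s d) (\<lambda>x. (snd d \<circ> inv_chart c) (?A x))"
    proof (rule smooth_vec_on_compose[OF smooth_vec_on_affine[OF sub] transition_smooth[OF c d]])
      fix x assume "x \<in> simplex_chart k s d"
      then show "?A x \<in> overlap c d" using sx(2,3)[of x] by force
    qed
    then show "smooth_vec_on (Suc k) (simplex_chart k s d) (snd d \<circ> s)"
      by (rule smooth_vec_on_cong_subset) (auto simp: sx(1))
  qed
  assume x: "x \<in> standard_simplex k" and v: "(\<Sum>i\<le>k. v i) = 0"
  have xS: "x \<in> simplex_chart k s c" using x sx(2) by simp
  note det = determined_dir_simplex_chart[OF sing c xS v]
  have sub: "simplex_chart k s c \<subseteq> coord_space (Suc k)" using standard_simplex_subset_coord_space by blast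
  have "simplex_differential M k s x v = tvec_of M c (s x) (differential (Suc k) (simplex_chart k s c) (snd c \<circ> s) x v)"
    by (rule simplex_differential_tvec_of[OF s x c sx(2)[OF x] v])
  also have "differential (Suc k) (simplex_chart k s c) (snd c \<circ> s) x v = differential (Suc k) (simplex_chart k s c) ?A x v"
    by (rule differential_subset[OF smooth_simplex_chart[OF s c] order_refl xS det]) (auto simp: sx(3))
  also have "\<dots> = lin_map (Suc k) l v" by (rule differential_affine[OF sub xS det])
  finally show "simplex_differential M k s x v = tvec_of M c (s x) (lin_map (Suc k) l v)" .
qed

text \<open>The integral over the contracted simplex is \<open>t ^ k * ?K t\<close>. It is constant
  because its values lie in \<Lambda>, and it is 0 at t = 0 because k is positive. Hence
  \<open>?K\<close> vanishes for t > 0 and by continuity at 0, where it is the value at the vertex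
  times a positive volume.\<close>

lemma form_on_edges_eq_zero:
  assumes \<omega>: "is_form M k \<omega>" and k: "1 \<le> k"
    and \<Lambda>: "\<And>x y. x \<in> \<Lambda> \<Longrightarrow> y \<in> \<Lambda> \<Longrightarrow> x - y \<in> \<Lambda>" "\<Lambda> \<noteq> UNIV"
    and int: "\<And>s. smooth_simplex M k s \<Longrightarrow> integral_simplex M k \<omega> s \<in> \<Lambda>"
    and s: "smooth_simplex M k s"
  shows "form_on_edges k k \<omega> s unit_vec (unit_vec 0) = 0"
proof -
  let ?K = "\<lambda>t. bary_integral k (\<lambda>x. form_on_edges k k \<omega> s unit_vec (lin_map (Suc k) (contraction t unit_vec) x))"
  note u = unit_vec_in_standard_simplex
  have c: "integral_simplex M k \<omega> (shrink k t s) = integral_simplex M k \<omega> (shrink k 0 s)" if "t \<in> {0..1}" for t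
  proof (rule constant_if_values_in_proper_subgroup[OF \<Lambda> continuous_on_integral_simplex_contraction(1)[OF \<omega> s u] _ that])
    fix t :: real assume "t \<in> {0..1}"
    then show "integral_simplex M k \<omega> (shrink k t s) \<in> \<Lambda>"
      by (intro int smooth_simplex_affine_subsimplex[OF s] contraction_in_standard_simplex u)
  qed
  have "?K 0 = 0"
  proof (rule vanishes_at_0[OF continuous_on_bary_integral_contraction(1)[OF \<omega> s u]])
    fix t :: real assume t: "0 < t" "t \<le> 1"
    have "t ^ k * ?K t = integral_simplex M k \<omega> (shrink k t s)"
      by (rule integral_simplex_contraction[OF \<omega> s u, symmetric]) (use t in auto)
    also have "\<dots> = integral_simplex M k \<omega> (shrink k 0 s)" by (rule c) (use t in auto)
    also have "\<dots> = 0 ^ k * (form_on_edges k k \<omega> s unit_vec (unit_vec 0) * param_volume k)"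
      by (rule continuous_on_integral_simplex_contraction(2)[OF \<omega> s u])
    also have "\<dots> = 0" using k by (simp add: power_0_left)
    finally show "?K t = 0" using t by simp
  qed auto
  moreover have "?K 0 = form_on_edges k k \<omega> s unit_vec (unit_vec 0) * param_volume k"
    by (rule continuous_on_bary_integral_contraction(2)[OF \<omega> s u])
  ultimately have "form_on_edges k k \<omega> s unit_vec (unit_vec 0) * param_volume k = 0" by (simp only:)
  then show ?thesis
    unfolding mult_eq_0_iff by (rule disjE) (use param_volume_pos[of k] in simp_all)
qed

text \<open>Test simplices are affine in a chart, with edges along coordinate vectors. Since these point into
  the half space, boundary points need no separate treatment.\<close>

theorem form_eq_zero_if_integrals_in_proper_subgroup:
  assumes \<omega>: "is_form M k \<omega>" and k: "1 \<le> k"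
    and \<Lambda>: "\<And>x y. x \<in> \<Lambda> \<Longrightarrow> y \<in> \<Lambda> \<Longrightarrow> x - y \<in> \<Lambda>" "\<Lambda> \<noteq> UNIV"
    and int: "\<And>s. smooth_simplex M k s \<Longrightarrow> integral_simplex M k \<omega> s \<in> \<Lambda>"
  shows "\<omega> = (\<lambda>p vs. 0)"
proof (rule form_eq_zeroI[OF \<omega>])
  fix c p js
  assume c: "c \<in> atlas M" "p \<in> fst c" and js: "set js \<subseteq> {..<mdim M}" "length js = k"
  let ?n = "mdim M"
  obtain V where V: "openin (Euclidean_space ?n) V" "snd c ` fst c = V \<inter> {x. 0 \<le> x 0}"
    using is_chart[OF c(1)] unfolding is_chart_def half_space_def openin_subtopology by blast
  have pV: "snd c p \<in> V" "0 \<le> snd c p 0" using V(2) c(2) by auto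
  obtain d where d: "d > 0" "\<forall>z\<in>coord_space ?n. (\<forall>i<?n. \<bar>z i - snd c p i\<bar> < d) \<longrightarrow> z \<in> V"
    using openin_Euclidean_space_box[OF V(1) pV(1)] by blast
  define \<epsilon> where "\<epsilon> = d / 2"
  have \<epsilon>: "\<epsilon> > 0" "\<epsilon> < d" using d(1) by (auto simp: \<epsilon>_def)
  \<comment> \<open>Vertex 0 is placed at \<open>p\<close>, vertex j at distance \<epsilon> along
    the coordinate \<open>js ! (j - 1)\<close>; edges are numbered from 1 and list entries from 0.
    Repeated entries are allowed and give degenerate simplices.\<close>
  define l where "l j = (if j = 0 then (\<lambda>_. 0) else (\<lambda>i. \<epsilon> * unit_vec (js ! (j - 1)) i))" for j :: nat
  have l: "0 \<le> l j i" "l j i \<le> \<epsilon>" for i j using \<epsilon> by (auto simp: l_def unit_vec_def)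
  have ln: "l j i = 0" if "j \<le> k" "?n \<le> i" for i j
  proof (cases "j = 0")
    case False
    then have "j - 1 < length js" using that(1) js(2) by auto
    then have "js ! (j - 1) < ?n" using js(1) nth_mem by blast
    then show ?thesis using that(2) by (simp add: l_def unit_vec_def)
  qed (simp add: l_def)
  have A: "(\<lambda>i. snd c p i + lin_map (Suc k) l x i) \<in> snd c ` fst c" if x: "x \<in> standard_simplex k" for x
  proof -
    have x': "\<And>j. 0 \<le> x j" "(\<Sum>j<Suc k. x j) = 1"
      using x by (auto simp: standard_simplex_def lessThan_Suc_atMost)
    have b0: "0 \<le> lin_map (Suc k) l x i" for i
      unfolding lin_map_def using l(1) x'(1) by (intro sum_nonneg mult_nonneg_nonneg)
    have b1: "lin_map (Suc k) l x i \<le> \<epsilon>" for i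
    proof -
      have "lin_map (Suc k) l x i \<le> (\<Sum>j<Suc k. \<epsilon> * x j)"
        unfolding lin_map_def using l(2) x'(1) by (intro sum_mono mult_right_mono)
      also have "\<dots> = \<epsilon>" using x'(2) by (simp only: sum_distrib_left[symmetric] mult_1_right)
      finally show ?thesis .
    qed
    have "lin_map (Suc k) l x i = 0" if "?n \<le> i" for i
      unfolding lin_map_def using ln that by (intro sum.neutral) auto
    then have "(\<lambda>i. snd c p i + lin_map (Suc k) l x i) \<in> coord_space ?n"
      using chart_in_coord_space[OF c] by simp
    then have "(\<lambda>i. snd c p i + lin_map (Suc k) l x i) \<in> V"
    proof (rule d(2)[rule_format])
      fix i
      show "\<bar>snd c p i + lin_map (Suc k) l x i - snd c p i\<bar> < d" using b0[of i] b1[of i] \<epsilon>(2) by simp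
    qed
    moreover have "0 \<le> snd c p 0 + lin_map (Suc k) l x 0" using pV(2) b0[of 0] by simp
    ultimately show ?thesis using V(2) by simp
  qed
  define s where "s = restrict (\<lambda>x. inv_chart c (\<lambda>i. snd c p i + lin_map (Suc k) l x i)) (standard_simplex k)"
  note sm = chart_affine_simplex[OF c(1) A, folded s_def]
  have e0: "unit_vec 0 \<in> standard_simplex k" by (rule unit_vec_in_standard_simplex) simp
  have "lin_map (Suc k) l (unit_vec 0) = (\<lambda>_. 0)" by (subst lin_map_apply_unit_vec) (auto simp: l_def)
  then have s0: "s (unit_vec 0) = p" using e0 inv_chart_left[OF c] by (simp add: s_def)
  have pt: "p \<in> topspace (mtop M)" using chart_subset[OF c(1)] c(2) by blast
  define E where "E j = tvec_of M c p (unit_vec j)" for j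
  have sd: "simplex_differential M k s (unit_vec 0) (\<lambda>i. unit_vec j i - unit_vec 0 i) = (\<lambda>d i. \<epsilon> * E (js ! (j - 1)) d i)"
    if j: "j \<in> set [1..<Suc k]" for j
  proof -
    have v0: "(\<Sum>i\<le>k. unit_vec j i - unit_vec 0 i) = 0"
      by (rule standard_simplex_diff_sum_zero[OF unit_vec_in_standard_simplex e0]) (use j in auto)
    have "lin_map (Suc k) l (\<lambda>i. unit_vec j i - unit_vec 0 i) =
        (\<lambda>i. \<epsilon> * unit_vec (js ! (j - 1)) i)"
      using j unfolding lin_map_diff by (subst (1 2) lin_map_apply_unit_vec) (auto simp: l_def)
    moreover have "tvec_of M c p (\<lambda>i. \<epsilon> * unit_vec m i) = (\<lambda>d i. \<epsilon> * E m d i)" for m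
      using tvec_of_lincomb[of c p \<epsilon> "unit_vec m" 0 "unit_vec m"] by (simp add: E_def)
    ultimately show ?thesis using sm(2)[OF _ e0 v0] by (simp add: s0)
  qed
  have "form_on_edges k k \<omega> s unit_vec (unit_vec 0) = 0"
    using form_on_edges_eq_zero[OF \<omega> k \<Lambda> int sm(1)] by simp
  moreover have "map (\<lambda>j. simplex_differential M k s (unit_vec 0) (\<lambda>i. unit_vec j i - unit_vec 0 i)) [1..<Suc k] =
      map (\<lambda>v d i. \<epsilon> * v d i) (map E js)"
    by (rule nth_equalityI) (use js(2) sd in \<open>simp_all del: upt_Suc\<close>)
  ultimately have "\<omega> p ([] @ map (\<lambda>v d i. \<epsilon> * v d i) (map E js)) = 0" by (simp only: s0 append_Nil)
  moreover have "\<omega> p ([] @ map (\<lambda>v d i. \<epsilon> * v d i) (map E js)) = \<epsilon> ^ length (map E js) * \<omega> p ([] @ map E js)"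
    by (rule form_scale[OF \<omega> pt]) (use js(2) tvec_of_in_tangent_space[OF c] in \<open>auto simp: E_def\<close>)
  ultimately show "\<omega> p (map (\<lambda>j. tvec_of M c p (unit_vec j)) js) = 0"
    using \<epsilon>(1) unfolding E_def[abs_def] by simp
qed

end

section \<open>Extension of additive maps\<close>

text \<open>Expresses at once that a nonempty \<open>H\<close> is a subgroup and that
  \<open>f\<close> is a homomorphism from it into \<open>L\<close>: closure under differences yields
  0, negatives and sums.\<close>

definition additive_on :: "'g::ab_group_add set \<Rightarrow> 'h::ab_group_add set \<Rightarrow> ('g \<Rightarrow> 'h) \<Rightarrow> bool" where
  "additive_on H L f \<longleftrightarrow> (\<forall>a\<in>H. f a \<in> L) \<and> (\<forall>a\<in>H. \<forall>b\<in>H. a - b \<in> H \<and> f (a - b) = f a - f b)"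

lemma additive_onD:
  assumes "additive_on H L f" "a \<in> H" "b \<in> H"
  shows "f a \<in> L" "a - b \<in> H" "f (a - b) = f a - f b"
  using assms by (auto simp: additive_on_def)

lemma additive_on_zero:
  assumes "additive_on H L f" "a \<in> H"
  shows "0 \<in> H" "f 0 = 0"
  using additive_onD[OF assms(1) assms(2,2)] by simp_all

lemma additive_on_minus:
  assumes "additive_on H L f" "a \<in> H"
  shows "- a \<in> H" "f (- a) = - f a"
  using additive_onD[OF assms(1) additive_on_zero(1)[OF assms] assms(2)] additive_on_zero[OF assms] by simp_all

lemma additive_on_add:
  assumes "additive_on H L f" "a \<in> H" "b \<in> H"
  shows "a + b \<in> H" "f (a + b) = f a + f b"
  using additive_onD[OF assms(1,2) additive_on_minus(1)[OF assms(1,3)]] additive_on_minus[OF assms(1,3)] by simp_all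

text \<open>The common Zorn argument behind extension into a divisible group and splitting of a
  kernel. The predicate \<open>P\<close> restricts the domains that are allowed; it has to survive
  unions of chains, and every proper domain has to admit a larger one.\<close>

lemma additive_extension:
  fixes f0 :: "'g::ab_group_add \<Rightarrow> 'h::ab_group_add"
  assumes P0: "P H0" "H0 \<subseteq> S" and f0: "additive_on H0 L f0"
    and chain: "\<And>\<C>. \<C> \<noteq> {} \<Longrightarrow> (\<And>H. H \<in> \<C> \<Longrightarrow> P H) \<Longrightarrow> (\<And>H. H \<in> \<C> \<Longrightarrow> H0 \<subseteq> H) \<Longrightarrow>
        (\<And>H K. H \<in> \<C> \<Longrightarrow> K \<in> \<C> \<Longrightarrow> H \<subseteq> K \<or> K \<subseteq> H) \<Longrightarrow> P (\<Union>\<C>)"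
    and step: "\<And>H f. P H \<Longrightarrow> H0 \<subseteq> H \<Longrightarrow> H \<subset> S \<Longrightarrow> additive_on H L f \<Longrightarrow>
        \<exists>H' f'. P H' \<and> H \<subset> H' \<and> H' \<subseteq> S \<and> additive_on H' L f' \<and> (\<forall>a\<in>H. f' a = f a)"
  shows "\<exists>f. additive_on S L f \<and> (\<forall>a\<in>H0. f a = f0 a)"
proof -
  define graph where "graph H f = (\<lambda>a. (a, f a)) ` H" for H :: "'g set" and f :: "'g \<Rightarrow> 'h"
  \<comment> \<open>Partial homomorphisms are represented by their graphs, so that extension becomes
    inclusion and the upper bound of a chain is its union.\<close>
  define \<A> where "\<A> = {R. P (fst ` R) \<and> fst ` R \<subseteq> S \<and> graph H0 f0 \<subseteq> R \<and> snd ` R \<subseteq> L \<and>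
    (\<forall>a r r'. (a, r) \<in> R \<longrightarrow> (a, r') \<in> R \<longrightarrow> r = r') \<and>
    (\<forall>a r b q. (a, r) \<in> R \<longrightarrow> (b, q) \<in> R \<longrightarrow> (a - b, r - q) \<in> R)}"
  have fst_graph: "fst ` graph H f = H" for H f by (force simp: graph_def)
  have graphI: "graph H f \<in> \<A>"
    if "P H" "H0 \<subseteq> H" "H \<subseteq> S" "additive_on H L f" "\<And>a. a \<in> H0 \<Longrightarrow> f a = f0 a" for H f
    using that unfolding \<A>_def additive_on_def by (auto simp: fst_graph) (auto simp: graph_def)
  have "\<exists>M\<in>\<A>. \<forall>R\<in>\<A>. M \<subseteq> R \<longrightarrow> R = M"
  proof (rule subset_Zorn_nonempty)
    show "\<A> \<noteq> {}" using graphI[OF P0(1) order_refl P0(2) f0] by blast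
    fix \<R> assume ne: "\<R> \<noteq> {}" and "subset.chain \<A> \<R>"
    then have R: "\<And>R. R \<in> \<R> \<Longrightarrow> R \<in> \<A>" and tot: "\<And>R R'. R \<in> \<R> \<Longrightarrow> R' \<in> \<R> \<Longrightarrow> R \<subseteq> R' \<or> R' \<subseteq> R"
      by (auto simp: subset.chain_def)
    have common: "\<exists>R\<in>\<R>. x \<in> R \<and> y \<in> R" if "x \<in> \<Union>\<R>" "y \<in> \<Union>\<R>" for x y
      using that tot by (meson UnionE subsetD)
    have "P (\<Union>((`) fst ` \<R>))"
    proof (rule chain)
      show "(`) fst ` \<R> \<noteq> {}" using ne by blast
      show "P H" if "H \<in> (`) fst ` \<R>" for H using that R by (auto simp: \<A>_def)
      show "H0 \<subseteq> H" if H: "H \<in> (`) fst ` \<R>" for H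
      proof -
        obtain Q where "Q \<in> \<R>" "H = fst ` Q" using H by blast
        moreover from this have "graph H0 f0 \<subseteq> Q" using R by (simp add: \<A>_def)
        ultimately show ?thesis using fst_graph[of H0 f0] by blast
      qed
      show "H \<subseteq> K \<or> K \<subseteq> H" if HK: "H \<in> (`) fst ` \<R>" "K \<in> (`) fst ` \<R>" for H K
      proof -
        obtain Q Q' where Q: "Q \<in> \<R>" "H = fst ` Q" "Q' \<in> \<R>" "K = fst ` Q'" using HK by blast
        show ?thesis unfolding Q(2,4) using tot[OF Q(1,3)] by (auto intro: image_mono)
      qed
    qed
    moreover have "\<Union>((`) fst ` \<R>) = fst ` \<Union>\<R>" by (simp add: image_Union)
    moreover have "\<forall>a r r'. (a, r) \<in> \<Union>\<R> \<longrightarrow> (a, r') \<in> \<Union>\<R> \<longrightarrow> r = r'"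
    proof (intro allI impI)
      fix a r r' assume "(a, r) \<in> \<Union>\<R>" "(a, r') \<in> \<Union>\<R>"
      then obtain Q where "Q \<in> \<R>" "(a, r) \<in> Q" "(a, r') \<in> Q" using common by blast
      then show "r = r'" using R[of Q] unfolding \<A>_def by blast
    qed
    moreover have "\<forall>a r b q. (a, r) \<in> \<Union>\<R> \<longrightarrow> (b, q) \<in> \<Union>\<R> \<longrightarrow> (a - b, r - q) \<in> \<Union>\<R>"
    proof (intro allI impI)
      fix a r b q assume "(a, r) \<in> \<Union>\<R>" "(b, q) \<in> \<Union>\<R>"
      then obtain Q where Q: "Q \<in> \<R>" "(a, r) \<in> Q" "(b, q) \<in> Q" using common by blast
      then have "(a - b, r - q) \<in> Q" using R[of Q] unfolding \<A>_def by blast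
      then show "(a - b, r - q) \<in> \<Union>\<R>" using Q(1) by blast
    qed
    moreover have "fst ` \<Union>\<R> \<subseteq> S"
    proof
      fix a assume "a \<in> fst ` \<Union>\<R>"
      then obtain Q where "Q \<in> \<R>" "a \<in> fst ` Q" by blast
      then show "a \<in> S" using R[of Q] unfolding \<A>_def by blast
    qed
    moreover have "snd ` \<Union>\<R> \<subseteq> L"
    proof
      fix a assume "a \<in> snd ` \<Union>\<R>"
      then obtain Q where "Q \<in> \<R>" "a \<in> snd ` Q" by blast
      then show "a \<in> L" using R[of Q] unfolding \<A>_def by blast
    qed
    moreover have "graph H0 f0 \<subseteq> \<Union>\<R>"
    proof -
      obtain Q where "Q \<in> \<R>" using ne by blast
      then show ?thesis using R[of Q] unfolding \<A>_def by blast
    qed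
    ultimately show "\<Union>\<R> \<in> \<A>" unfolding \<A>_def by simp
  qed
  then obtain M where M: "M \<in> \<A>" "\<And>R. R \<in> \<A> \<Longrightarrow> M \<subseteq> R \<Longrightarrow> R = M" by blast
  define H where "H = fst ` M"
  define f where "f a = (THE r. (a, r) \<in> M)" for a
  have fM: "f a = r" if "(a, r) \<in> M" for a r
    unfolding f_def using M(1) that by (intro the_equality) (auto simp: \<A>_def)
  have MfM: "(a, f a) \<in> M" if "a \<in> H" for a using that fM by (auto simp: H_def)
  have Mg: "M = graph H f" using fM MfM by (force simp: graph_def H_def)
  have HP: "P H" "H \<subseteq> S" using M(1) by (simp_all add: \<A>_def H_def)
  have g0: "graph H0 f0 \<subseteq> M" using M(1) by (simp add: \<A>_def)
  have f00: "f a = f0 a" "a \<in> H" if "a \<in> H0" for a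
  proof -
    have "(a, f0 a) \<in> M" using g0 that by (auto simp: graph_def)
    then show "f a = f0 a" "a \<in> H" using fM by (force simp: H_def)+
  qed
  have add: "additive_on H L f"
    unfolding additive_on_def
  proof (intro conjI ballI)
    have sndM: "snd ` M \<subseteq> L" using M(1) by (simp add: \<A>_def)
    show "f a \<in> L" if "a \<in> H" for a using subsetD[OF sndM imageI[OF MfM[OF that]]] by simp
    have Mdiff: "\<forall>a r b q. (a, r) \<in> M \<longrightarrow> (b, q) \<in> M \<longrightarrow> (a - b, r - q) \<in> M"
      using M(1) by (simp add: \<A>_def)
    fix a b assume "a \<in> H" "b \<in> H"
    then have ab: "(a - b, f a - f b) \<in> M" using MfM Mdiff by blast
    show "f (a - b) = f a - f b" by (rule fM[OF ab])
    show "a - b \<in> H" using imageI[OF ab, of fst] by (simp add: H_def)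
  qed
  have "H = S"
  proof (rule ccontr)
    assume "H \<noteq> S"
    then have "H \<subset> S" "H0 \<subseteq> H" using HP f00 by auto
    from step[OF HP(1) this(2,1) add] obtain H' f' where H': "P H'" "H \<subset> H'" "H' \<subseteq> S" "additive_on H' L f'"
      "\<And>a. a \<in> H \<Longrightarrow> f' a = f a" by blast
    have "graph H' f' \<in> \<A>"
      by (rule graphI[OF H'(1) _ H'(3,4)]) (use f00 H' in auto)
    moreover have "M \<subseteq> graph H' f'" unfolding Mg using H' by (auto simp: graph_def)
    ultimately have "graph H' f' = M" by (rule M(2))
    then have "H' = H" using fst_graph[of H' f'] H_def by simp
    then show False using H'(2) by simp
  qed
  then show ?thesis using add f00 by blast
qed

text \<open>Integer multiples in an abelian group; the two laws determine them by induction. They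
  are axiomatised in order to be instantiated by \<open>frag_cmul\<close> on pairs of
  chains.\<close>

locale int_scaling =
  fixes sc :: "int \<Rightarrow> 'g::ab_group_add \<Rightarrow> 'g"
  assumes sc_diff: "sc (m - n) a = sc m a - sc n a" and sc_1: "sc 1 a = a"
begin

lemma sc_0: "sc 0 a = 0"
  using sc_diff[of 0 0 a] by simp

lemma additive_on_sc:
  fixes f :: "'g \<Rightarrow> 'h::ring_1"
  assumes f: "additive_on H L f" and a: "a \<in> H"
  shows "sc m a \<in> H \<and> f (sc m a) = of_int m * f a"
proof (induction m rule: int_induct[where k = 0])
  case base
  then show ?case using additive_on_zero[OF f a] by (simp add: sc_0)
next
  case (step1 i)
  have "sc (i + 1) a = sc i a + a" using sc_diff[of "i + 1" 1 a] by (simp add: sc_1 algebra_simps)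
  then show ?case using step1 additive_on_add[OF f _ a, of "sc i a"] by (simp add: algebra_simps)
next
  case (step2 i)
  then show ?case using additive_onD[OF f _ a, of "sc i a"] by (simp add: sc_diff sc_1 algebra_simps)
qed

text \<open>\<open>\<alpha> m\<close> is the prescribed value at \<open>sc m c\<close>.\<close>

lemma additive_on_adjoin:
  fixes f :: "'g \<Rightarrow> 'h::ab_group_add"
  assumes f: "additive_on H L f" and S: "additive_on S UNIV (\<lambda>a. a)" and "H \<subseteq> S" "c \<in> S" "H \<noteq> {}"
    and \<alpha>: "\<And>m n. \<alpha> (m - n) = \<alpha> m - \<alpha> n" "\<And>m. sc m c \<in> H \<Longrightarrow> f (sc m c) = \<alpha> m"
    and L: "\<And>r m. r \<in> L \<Longrightarrow> r + \<alpha> m \<in> L"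
  shows "\<exists>f'. additive_on {h + sc m c | h m. h \<in> H} L f' \<and> (\<forall>a\<in>H. f' a = f a)"
    and "H \<subseteq> {h + sc m c | h m. h \<in> H}" "c \<in> {h + sc m c | h m. h \<in> H}" "{h + sc m c | h m. h \<in> H} \<subseteq> S"
proof -
  let ?H' = "{h + sc m c | h m. h \<in> H}"
  \<comment> \<open>Well-definedness: two representations of one element differ by a multiple of
    \<open>c\<close> that lies in \<open>H\<close>, and there \<open>\<alpha>\<close> is the value
    of \<open>f\<close>.\<close>
  have eq: "f h + \<alpha> m = f h' + \<alpha> m'" if "h \<in> H" "h' \<in> H" "h + sc m c = h' + sc m' c" for h h' m m'
  proof -
    have "h' - h = sc (m - m') c" using that(3) by (simp add: sc_diff algebra_simps)
    then have "f (sc (m - m') c) = f h' - f h" "sc (m - m') c \<in> H" using additive_onD[OF f that(2,1)] by simp_all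
    then have "f h' - f h = \<alpha> m - \<alpha> m'" using \<alpha> by simp
    then show ?thesis by (simp add: algebra_simps)
  qed
  define f' where "f' a = (THE r. \<exists>h m. h \<in> H \<and> a = h + sc m c \<and> r = f h + \<alpha> m)" for a
  have f': "f' (h + sc m c) = f h + \<alpha> m" if "h \<in> H" for h m
    unfolding f'_def
  proof (rule the_equality)
    show "\<exists>h' m'. h' \<in> H \<and> h + sc m c = h' + sc m' c \<and> f h + \<alpha> m = f h' + \<alpha> m'" using that by blast
    fix r assume "\<exists>h' m'. h' \<in> H \<and> h + sc m c = h' + sc m' c \<and> r = f h' + \<alpha> m'"
    then show "r = f h + \<alpha> m" using eq[OF that] by auto
  qed
  have "additive_on ?H' L f'"
    unfolding additive_on_def
  proof (intro conjI ballI)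
    show "f' a \<in> L" if "a \<in> ?H'" for a using that f' L additive_onD(1)[OF f] by auto
    fix a b assume "a \<in> ?H'" "b \<in> ?H'"
    then obtain h m h' m' where ab: "h \<in> H" "a = h + sc m c" "h' \<in> H" "b = h' + sc m' c" by blast
    have d: "a - b = (h - h') + sc (m - m') c" using ab by (simp add: sc_diff algebra_simps)
    note D = additive_onD[OF f ab(1,3)]
    show "a - b \<in> ?H'" using d D(2) by blast
    show "f' (a - b) = f' a - f' b"
    proof -
      have "f' (a - b) = f (h - h') + \<alpha> (m - m')" unfolding d by (rule f'[OF D(2)])
      moreover have "f' a = f h + \<alpha> m" unfolding ab by (rule f'[OF ab(1)])
      moreover have "f' b = f h' + \<alpha> m'" unfolding ab by (rule f'[OF ab(3)])
      ultimately show ?thesis using D(3) \<alpha>(1) by simp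
    qed
  qed
  moreover have "f' a = f a" if "a \<in> H" for a
    using f'[OF that, of 0] \<alpha>(1)[of 0 0] by (simp add: sc_0)
  ultimately show "\<exists>f'. additive_on ?H' L f' \<and> (\<forall>a\<in>H. f' a = f a)" by blast
  have "a = a + sc 0 c" for a by (simp add: sc_0)
  then show "H \<subseteq> ?H'" by blast
  have "0 \<in> H" using assms(5) additive_on_zero(1)[OF f] by blast
  moreover have "c = 0 + sc 1 c" by (simp add: sc_1)
  ultimately show "c \<in> ?H'" by blast
  have "sc m c \<in> S" for m
  proof (induction m rule: int_induct[where k = 0])
    case base
    then show ?case using additive_on_zero(1)[OF S \<open>c \<in> S\<close>] by (simp add: sc_0)
  next
    case (step1 i)
    have "sc (i + 1) c = sc i c + c" using sc_diff[of "i + 1" 1 c] by (simp add: sc_1 algebra_simps)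
    then show ?case using step1 additive_on_add(1)[OF S _ \<open>c \<in> S\<close>] by simp
  next
    case (step2 i)
    then show ?case using additive_onD(2)[OF S _ \<open>c \<in> S\<close>] by (simp add: sc_diff sc_1)
  qed
  then show "?H' \<subseteq> S" using assms(3) additive_on_add(1)[OF S] by blast
qed

text \<open>Divisibility of the reals: a partial homomorphism extends to one more element
  \<open>c\<close> because a value prescribed at a nonzero multiple of \<open>c\<close> can be
  divided by the multiplier.\<close>

lemma additive_extension_real:
  fixes f0 :: "'g \<Rightarrow> real"
  assumes S: "additive_on S UNIV (\<lambda>a. a)" and H0: "H0 \<subseteq> S" "H0 \<noteq> {}" and f0: "additive_on H0 UNIV f0"
  shows "\<exists>f. additive_on S UNIV f \<and> (\<forall>a\<in>H0. f a = f0 a)"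
proof (rule additive_extension[where P = "\<lambda>_. True", OF _ H0(1) f0])
  fix H :: "'g set" and f :: "'g \<Rightarrow> real"
  assume H: "H0 \<subseteq> H" "H \<subset> S" and f: "additive_on H UNIV f"
  then obtain c where c: "c \<in> S" "c \<notin> H" by blast
  \<comment> \<open>If a nonzero multiple of \<open>c\<close> lies in \<open>H\<close>, the value at
    \<open>c\<close> is forced; otherwise it is free and set to 0.\<close>
  define \<alpha> where "\<alpha> = (if \<exists>n. n \<noteq> 0 \<and> sc n c \<in> H then (let n = SOME n. n \<noteq> 0 \<and> sc n c \<in> H in f (sc n c) / of_int n) else 0)"
  have \<alpha>: "f (sc m c) = of_int m * \<alpha>" if m: "sc m c \<in> H" for m
  proof (cases "m = 0")
    case True
    then show ?thesis using additive_on_zero[OF f m] by (simp add: sc_0)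
  next
    case False
    define n where "n = (SOME n. n \<noteq> 0 \<and> sc n c \<in> H)"
    have ex: "\<exists>n. n \<noteq> 0 \<and> sc n c \<in> H" using False m by blast
    then have n: "n \<noteq> 0" "sc n c \<in> H" unfolding n_def using someI_ex[OF ex] by auto
    have \<alpha>n: "\<alpha> = f (sc n c) / of_int n" unfolding \<alpha>_def n_def Let_def using ex by simp
    have idS: "additive_on S UNIV (\<lambda>a::'g. a)" by (rule S)
    have scsc: "sc i (sc j c) = sc (j * i) c" for i j
    proof (induction i rule: int_induct[where k = 0])
      case (step1 i)
      have "sc (i + 1) (sc j c) = sc i (sc j c) + sc j c" using sc_diff[of "i + 1" 1 "sc j c"] by (simp add: sc_1 algebra_simps)
      moreover have "sc (j * (i + 1)) c = sc (j * i) c + sc j c" using sc_diff[of "j * (i + 1)" j c] by (simp add: algebra_simps)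
      ultimately show ?case using step1 by simp
    next
      case (step2 i)
      then show ?case using sc_diff[of "j * i" j c] by (simp add: sc_diff sc_1 algebra_simps)
    qed (simp add: sc_0)
    \<comment> \<open>Both expressions are the value at the same multiple of \<open>c\<close>, which
      compares the chosen multiplier n with an arbitrary m.\<close>
    have "f (sc n (sc m c)) = of_int n * f (sc m c)" "f (sc m (sc n c)) = of_int m * f (sc n c)"
      using additive_on_sc[OF f m] additive_on_sc[OF f n(2)] by auto
    then have "of_int n * f (sc m c) = of_int m * f (sc n c)" using scsc[of n m] scsc[of m n] by (simp add: mult.commute)
    then show ?thesis unfolding \<alpha>n using n(1) by (simp add: field_simps)
  qed
  let ?H' = "{h + sc m c | h m. h \<in> H}"
  have ne: "H \<noteq> {}" using H H0 by blast
  have HS: "H \<subseteq> S" using H by blast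
  note A = additive_on_adjoin[OF f S HS c(1) ne, of "\<lambda>m. of_int m * \<alpha>"]
  have "\<exists>f'. additive_on ?H' UNIV f' \<and> (\<forall>a\<in>H. f' a = f a)"
    by (rule A(1)) (auto simp: left_diff_distrib \<alpha>)
  moreover have "H \<subseteq> ?H'" by (rule A(2)) (auto simp: left_diff_distrib \<alpha>)
  moreover have "c \<in> ?H'" by (rule A(3)) (auto simp: left_diff_distrib \<alpha>)
  moreover have "?H' \<subseteq> S" by (rule A(4)) (auto simp: left_diff_distrib \<alpha>)
  ultimately show "\<exists>H' f'. True \<and> H \<subset> H' \<and> H' \<subseteq> S \<and> additive_on H' UNIV f' \<and> (\<forall>a\<in>H. f' a = f a)"
    using c(2) by blast
qed auto

text \<open>The admissible domains of the Zorn argument are those determined by the coordinates that do not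
  vanish on them; a proper one is enlarged by a single element.\<close>

lemma kernel_retraction:
  fixes D :: "'x \<Rightarrow> 'g \<Rightarrow> int"
  assumes S: "additive_on S UNIV (\<lambda>a. a)" and S0: "S \<noteq> {}" and D: "\<And>x. additive_on S UNIV (D x)"
    and fin: "\<And>a. a \<in> S \<Longrightarrow> finite {x. D x a \<noteq> 0}"
  defines "K \<equiv> {a \<in> S. \<forall>x. D x a = 0}"
  shows "\<exists>\<pi>. additive_on S K \<pi> \<and> (\<forall>a\<in>K. \<pi> a = a)"
proof -
  have Dd: "D x (a - b) = D x a - D x b" "a - b \<in> S" if "a \<in> S" "b \<in> S" for x a b
    using additive_onD[OF D that] by auto
  have zS: "0 \<in> S" "D x 0 = 0" for x using S0 additive_on_zero[OF D] by blast+
  define Q where "Q H x \<longleftrightarrow> (\<exists>b\<in>H. D x b \<noteq> 0)" for H x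
  define P where "P H \<longleftrightarrow> (\<forall>a\<in>S. (\<forall>x. D x a \<noteq> 0 \<longrightarrow> Q H x) \<longrightarrow> a \<in> H)" for H
  show ?thesis
  proof (rule additive_extension[where P = P and ?f0.0 = "\<lambda>a. a"])
    show "P K" by (auto simp: P_def Q_def K_def)
    show "K \<subseteq> S" by (auto simp: K_def)
    show "additive_on K K (\<lambda>a. a)" by (auto simp: additive_on_def K_def Dd)
  next
    fix \<C> assume C: "\<C> \<noteq> {}" "\<And>H. H \<in> \<C> \<Longrightarrow> P H" "\<And>H K. H \<in> \<C> \<Longrightarrow> K \<in> \<C> \<Longrightarrow> H \<subseteq> K \<or> K \<subseteq> H"
    show "P (\<Union>\<C>)"
      unfolding P_def
    proof (intro ballI impI)
      fix a assume a: "a \<in> S" "\<forall>x. D x a \<noteq> 0 \<longrightarrow> Q (\<Union>\<C>) x"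
      \<comment> \<open>An element has only finitely many nonzero coordinates, so one member of the
        chain already meets all of them.\<close>
      have "\<exists>H\<in>\<C>. \<forall>x\<in>F. Q H x" if "finite F" "F \<subseteq> {x. D x a \<noteq> 0}" for F
        using that
      proof (induction F)
        case empty
        then show ?case using C(1) by blast
      next
        case (insert x F)
        then obtain H where H: "H \<in> \<C>" "\<forall>x\<in>F. Q H x" by blast
        have "Q (\<Union>\<C>) x" using a(2) insert.prems by blast
        then obtain H' where H': "H' \<in> \<C>" "Q H' x" by (auto simp: Q_def)
        have mono: "Q A x \<Longrightarrow> A \<subseteq> B \<Longrightarrow> Q B x" for A B x by (auto simp: Q_def)
        show ?case
        proof (cases "H \<subseteq> H'")
          case True
          then show ?thesis using H H' mono by blast
        next
          case False
          then have "H' \<subseteq> H" using C(3)[OF H(1) H'(1)] by blast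
          then show ?thesis using H H' mono by blast
        qed
      qed
      from this[OF fin[OF a(1)]] obtain H where "H \<in> \<C>" "\<forall>x\<in>{x. D x a \<noteq> 0}. Q H x" by blast
      then show "a \<in> \<Union>\<C>" using C(2)[of H] a(1) unfolding P_def by blast
    qed
  next
    fix H f assume PH: "P H" and H: "K \<subseteq> H" "H \<subset> S" and f: "additive_on H K f"
    define N where "N a = {x. D x a \<noteq> 0 \<and> \<not> Q H x}" for a
    have finN: "finite (N a)" if "a \<in> S" for a using fin[OF that] by (rule finite_subset[rotated]) (auto simp: N_def)
    \<comment> \<open>An element outside \<open>H\<close> with as few coordinates new to
      \<open>H\<close> as possible; minimality is what makes the enlargement cyclic over
      \<open>H\<close>.\<close>
    obtain c where c: "c \<in> S - H" "\<And>a. a \<in> S - H \<Longrightarrow> card (N c) \<le> card (N a)"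
      using ex_has_least_nat[of "\<lambda>a. a \<in> S - H" _ "\<lambda>a. card (N a)"] H(2) by blast
    have "N c \<noteq> {}" using c(1) PH by (auto simp: P_def N_def)
    then obtain x where x: "x \<in> N c" by blast
    \<comment> \<open>The smallest admissible candidate containing \<open>c\<close>: besides the
      coordinates of \<open>H\<close>, only those new with \<open>c\<close> may be nonzero.\<close>
    define H' where "H' = {a \<in> S. \<forall>y. D y a \<noteq> 0 \<longrightarrow> y \<in> N c \<or> Q H y}"
    have sub: "H \<subseteq> H'" using H(2) by (auto simp: H'_def Q_def)
    have cH': "c \<in> H'" using c(1) by (auto simp: H'_def N_def)
    have H'S: "H' \<subseteq> S" by (auto simp: H'_def)
    have zH': "a - b \<in> H'" if "a \<in> H'" "b \<in> H'" for a b
    proof -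
      have "y \<in> N c \<or> Q H y" if "D y (a - b) \<noteq> 0" for y
      proof -
        have "D y a \<noteq> 0 \<or> D y b \<noteq> 0" using that Dd(1)[of a b y] \<open>a \<in> H'\<close> \<open>b \<in> H'\<close> by (auto simp: H'_def)
        then show ?thesis using \<open>a \<in> H'\<close> \<open>b \<in> H'\<close> by (auto simp: H'_def)
      qed
      then show ?thesis using that Dd(2) by (auto simp: H'_def)
    qed
    have DH: "D x a = 0" if "a \<in> H" for a using x that by (auto simp: N_def Q_def)
    \<comment> \<open>Such an element outside \<open>H\<close> would have new coordinates among
      those of \<open>c\<close> but not \<open>x\<close>, hence fewer than \<open>c\<close>.\<close>
    have ker: "a \<in> H" if a: "a \<in> H'" "D x a = 0" for a
    proof (rule ccontr)
      assume "a \<notin> H"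
      then have "card (N c) \<le> card (N a)" using c(2) a H'S by blast
      moreover have "N a \<subseteq> N c - {x}" using a by (auto simp: H'_def N_def)
      then have "card (N a) < card (N c)"
        using x finN c(1) by (intro psubset_card_mono) auto
      ultimately show False by simp
    qed
    have addH': "additive_on H' UNIV (D x)"
      unfolding additive_on_def using zH' Dd(1) H'S by blast
    have "\<exists>c0. c0 \<in> H' \<and> 0 < D x c0"
    proof (cases "0 < D x c")
      case True
      then show ?thesis using cH' by blast
    next
      case False
      moreover have "D x c \<noteq> 0" using x by (simp add: N_def)
      ultimately show ?thesis using additive_on_minus[OF addH' cH'] by (intro exI[of _ "- c"]) auto
    qed
    \<comment> \<open>A generator of the image of \<open>H'\<close> under the coordinate
      \<open>x\<close>, found as an element of least positive value.\<close>
    then obtain c0 where c0: "c0 \<in> H'" "0 < D x c0"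
      "\<And>a. a \<in> H' \<Longrightarrow> 0 < D x a \<Longrightarrow> nat (D x c0) \<le> nat (D x a)"
      using ex_has_least_nat[of "\<lambda>a. a \<in> H' \<and> 0 < D x a" _ "\<lambda>a. nat (D x a)"] by blast
    have idH': "additive_on H' UNIV (\<lambda>a. a)" using zH' by (auto simp: additive_on_def)
    have ne: "H \<noteq> {}" using H zS by (auto simp: K_def)
    \<comment> \<open>Division with remainder by \<open>D x c0\<close>: by minimality the remainder
      is 0, so what is left after subtracting a multiple of \<open>c0\<close> lies in
      \<open>H\<close> by \<open>ker\<close>.\<close>
    have eqH': "{h + sc m c0 | h m. h \<in> H} = H'"
    proof
      note sc0 = additive_on_sc[OF addH' c0(1)]
      show "{h + sc m c0 | h m. h \<in> H} \<subseteq> H'"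
        using sc0 sub additive_on_add(1)[OF addH'] by blast
      show "H' \<subseteq> {h + sc m c0 | h m. h \<in> H}"
      proof
        fix a assume a: "a \<in> H'"
        define m where "m = D x a div D x c0"
        have r: "a - sc m c0 \<in> H'" "D x (a - sc m c0) = D x a mod D x c0"
          using sc0 additive_onD[OF addH' a, of "sc m c0"] by (auto simp: m_def minus_div_mult_eq_mod)
        have "D x (a - sc m c0) = 0"
        proof (rule ccontr)
          assume "D x (a - sc m c0) \<noteq> 0"
          moreover have "0 \<le> D x a mod D x c0" "D x a mod D x c0 < D x c0" using c0(2) by simp_all
          ultimately show False using c0(3)[OF r(1)] r(2) by simp
        qed
        then have "a - sc m c0 \<in> H" by (rule ker[OF r(1)])
        moreover have "a = (a - sc m c0) + sc m c0" by simp
        ultimately show "a \<in> {h + sc m c0 | h m. h \<in> H}" by blast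
      qed
    qed
    \<comment> \<open>The new generator is sent to 0. This is consistent, since the coordinate
      \<open>x\<close> vanishes on \<open>H\<close> and so no nonzero multiple of \<open>c0\<close>
      lies in \<open>H\<close>.\<close>
    have "\<exists>f'. additive_on {h + sc m c0 | h m. h \<in> H} K f' \<and> (\<forall>a\<in>H. f' a = f a)"
    proof (rule additive_on_adjoin(1)[where \<alpha> = "\<lambda>_. 0", OF f idH' sub c0(1) ne])
      fix m assume "sc m c0 \<in> H"
      then have "D x (sc m c0) = 0" by (rule DH)
      then have "m = 0" using additive_on_sc[OF addH' c0(1), of m] c0(2) by simp
      then show "f (sc m c0) = 0" using additive_on_zero(2)[OF f] ne by (auto simp: sc_0)
    qed auto
    then obtain f' where "additive_on H' K f'" "\<forall>a\<in>H. f' a = f a" unfolding eqH' by blast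
    moreover have "P H'"
      unfolding P_def
    proof (intro ballI impI)
      fix a assume a: "a \<in> S" "\<forall>y. D y a \<noteq> 0 \<longrightarrow> Q H' y"
      have "y \<in> N c \<or> Q H y" if y: "D y a \<noteq> 0" for y
      proof -
        obtain b where "b \<in> H'" "D y b \<noteq> 0" using a(2) y unfolding Q_def[of H'] by blast
        then show ?thesis by (auto simp: H'_def)
      qed
      then show "a \<in> H'" using a(1) by (simp add: H'_def)
    qed
    ultimately show "\<exists>H' f'. P H' \<and> H \<subset> H' \<and> H' \<subseteq> S \<and> additive_on H' K f' \<and> (\<forall>a\<in>H. f' a = f a)"
      using sub cH' c(1) H'S by blast
  qed
qed

end

section \<open>Relative chains\<close>

lemma integral_chain_superset:
  assumes "finite F" "Poly_Mapping.keys c \<subseteq> F"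
  shows "integral_chain M k \<omega> c = (\<Sum>s\<in>F. of_int (Poly_Mapping.lookup c s) * integral_simplex M (nat k) \<omega> s)"
  unfolding integral_chain_def
  by (rule sum.mono_neutral_left) (use assms in \<open>auto simp: in_keys_iff\<close>)

lemma integral_chain_diff: "integral_chain M k \<omega> (a - b) = integral_chain M k \<omega> a - integral_chain M k \<omega> b"
proof -
  let ?F = "Poly_Mapping.keys a \<union> Poly_Mapping.keys b"
  have "integral_chain M k \<omega> (a - b) =
      (\<Sum>s\<in>?F. of_int (Poly_Mapping.lookup (a - b) s) * integral_simplex M (nat k) \<omega> s)"
    by (rule integral_chain_superset) (use keys_diff[of a b] in auto)
  also have "\<dots> = (\<Sum>s\<in>?F. of_int (Poly_Mapping.lookup a s) * integral_simplex M (nat k) \<omega> s) -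
      (\<Sum>s\<in>?F. of_int (Poly_Mapping.lookup b s) * integral_simplex M (nat k) \<omega> s)"
    by (simp add: lookup_minus left_diff_distrib sum_subtractf)
  also have "\<dots> = integral_chain M k \<omega> a - integral_chain M k \<omega> b"
    by (subst (1 2) integral_chain_superset[of ?F]) auto
  finally show ?thesis .
qed

lemma integral_chain_0 [simp]: "integral_chain M k \<omega> 0 = 0"
  by (simp add: integral_chain_def)

lemma integral_chain_minus: "integral_chain M k \<omega> (- a) = - integral_chain M k \<omega> a"
  using integral_chain_diff[of M k \<omega> 0 a] by simp

lemma integral_chain_add: "integral_chain M k \<omega> (a + b) = integral_chain M k \<omega> a + integral_chain M k \<omega> b"
  using integral_chain_diff[of M k \<omega> a "- b"] by (simp add: integral_chain_minus)

lemma integral_chain_of: "integral_chain M k \<omega> (frag_of s) = integral_simplex M (nat k) \<omega> s"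
  by (simp add: integral_chain_def)

lemma integral_chain_cmul: "integral_chain M k \<omega> (frag_cmul m a) = of_int m * integral_chain M k \<omega> a"
proof -
  have "integral_chain M k \<omega> (frag_cmul m a) =
      (\<Sum>s\<in>Poly_Mapping.keys a. of_int (Poly_Mapping.lookup (frag_cmul m a) s) * integral_simplex M (nat k) \<omega> s)"
    by (rule integral_chain_superset) (use keys_cmul[of m a] in auto)
  then show ?thesis by (simp add: integral_chain_def sum_distrib_left mult.assoc)
qed

lemma integral_chain_sum: "integral_chain M k \<omega> (\<Sum>i\<in>I. a i) = (\<Sum>i\<in>I. integral_chain M k \<omega> (a i))"
  by (induction I rule: infinite_finite_induct) (simp_all add: integral_chain_add)

lemma integral_chain_boundary_of:
  assumes "1 \<le> q"
  shows "integral_chain M k \<omega> (chain_boundary q (frag_of s)) =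
    (\<Sum>i\<le>q. (-1) ^ i * integral_simplex M (nat k) \<omega> (singular_face q i s))"
  using assms by (simp add: chain_boundary_of integral_chain_sum integral_chain_cmul integral_chain_of)

lemma carrier_smooth_chains:
  "carrier (smooth_chains M k) = {c. Poly_Mapping.keys c \<subseteq> (if k < 0 then {} else {s. smooth_simplex M (nat k) s})}"
  by (auto simp: smooth_chains_def)

lemma smooth_chains_induct [consumes 1, case_names zero simplex diff]:
  assumes "c \<in> carrier (smooth_chains M k)" and "P 0"
    and "\<And>s. 0 \<le> k \<Longrightarrow> smooth_simplex M (nat k) s \<Longrightarrow> P (frag_of s)"
    and "\<And>a b. P a \<Longrightarrow> P b \<Longrightarrow> P (a - b)"
  shows "P c"
proof (rule frag_induction[of c "if k < 0 then {} else {s. smooth_simplex M (nat k) s}" P])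
  show "P (frag_of s)" if "s \<in> (if k < 0 then {} else {s. smooth_simplex M (nat k) s})" for s
    using that assms(3) by (auto split: if_splits)
qed (use assms in \<open>auto simp: carrier_smooth_chains\<close>)

lemma smooth_chains_zero: "0 \<in> carrier (smooth_chains M k)"
  by (simp add: carrier_smooth_chains)

lemma smooth_chains_diff:
  "a \<in> carrier (smooth_chains M k) \<Longrightarrow> b \<in> carrier (smooth_chains M k) \<Longrightarrow> a - b \<in> carrier (smooth_chains M k)"
  unfolding carrier_smooth_chains mem_Collect_eq by (rule order_trans[OF keys_diff Un_least])

lemma smooth_chains_minus: "a \<in> carrier (smooth_chains M k) \<Longrightarrow> - a \<in> carrier (smooth_chains M k)"
  using smooth_chains_diff[OF smooth_chains_zero] by fastforce

lemma smooth_chains_add: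
  "a \<in> carrier (smooth_chains M k) \<Longrightarrow> b \<in> carrier (smooth_chains M k) \<Longrightarrow> a + b \<in> carrier (smooth_chains M k)"
  using smooth_chains_diff[OF _ smooth_chains_minus, of a M k b] by simp

lemma smooth_chains_of: "0 \<le> k \<Longrightarrow> smooth_simplex M (nat k) s \<Longrightarrow> frag_of s \<in> carrier (smooth_chains M k)"
  by (simp add: carrier_smooth_chains)

lemma smooth_chains_cmul: "a \<in> carrier (smooth_chains M k) \<Longrightarrow> frag_cmul m a \<in> carrier (smooth_chains M k)"
  using keys_cmul[of m a] by (auto simp: carrier_smooth_chains)

lemma smooth_chains_sum:
  "(\<And>i. i \<in> I \<Longrightarrow> a i \<in> carrier (smooth_chains M k)) \<Longrightarrow> (\<Sum>i\<in>I. a i) \<in> carrier (smooth_chains M k)"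
  by (induction I rule: infinite_finite_induct) (auto intro: smooth_chains_add smooth_chains_zero)

lemma smooth_chain_singular: "c \<in> carrier (smooth_chains M k) \<Longrightarrow> singular_chain (nat k) (mtop M) c"
  by (induction rule: smooth_chains_induct)
    (auto simp: singular_chain_of smooth_simplex_def intro: singular_chain_diff)

lemma (in smooth_mfd) smooth_simplex_face:
  assumes "smooth_simplex M q s" "1 \<le> q" "i \<le> q"
  shows "smooth_simplex M (q - 1) (singular_face q i s)"
  unfolding singular_face_eq_affine_subsimplex[OF assms(2,3)]
  by (rule smooth_simplex_affine_subsimplex[OF assms(1)], rule unit_vec_in_standard_simplex) (use assms in auto)

lemma (in smooth_mfd) smooth_chain_boundary:
  assumes "c \<in> carrier (smooth_chains M k)"
  shows "chain_boundary (nat k) c \<in> carrier (smooth_chains M (k - 1))"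
  using assms
proof (induction rule: smooth_chains_induct)
  case (simplex s)
  show ?case
  proof (cases "k = 0")
    case False
    then have k: "1 \<le> nat k" "0 \<le> k - 1" "nat (k - 1) = nat k - 1" using simplex(1) by auto
    have "(\<Sum>i\<le>nat k. frag_cmul ((-1) ^ i) (frag_of (singular_face (nat k) i s))) \<in> carrier (smooth_chains M (k - 1))"
      by (intro smooth_chains_sum smooth_chains_cmul smooth_chains_of k(2))
        (simp only: k(3) atMost_iff smooth_simplex_face[OF simplex(2) k(1)])
    then show ?thesis using False simplex(1) by (simp add: chain_boundary_of smooth_chains_zero)
  qed (simp add: chain_boundary_of smooth_chains_zero)
qed (auto simp: chain_boundary_diff smooth_chains_zero intro: smooth_chains_diff)

section \<open>The relative setting\<close>

locale rel_mfd = A: smooth_mfd A + M: smooth_mfd M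
  for A :: "'a mfd" and M :: "'m mfd" +
  fixes \<rho> :: "'a \<Rightarrow> 'm" and \<Lambda> :: "real set"
  assumes smooth_map: "smooth_map A M \<rho>" and subring: "subring \<Lambda> real_ring" and proper: "\<Lambda> \<noteq> UNIV"
begin

abbreviation "Ch k \<equiv> carrier (rel_chains A M k)"
abbreviation "Cyc k \<equiv> carrier (rel_cycles A M \<rho> k)"
abbreviation "bd \<equiv> rel_boundary \<rho>"
abbreviation "hatC \<equiv> hat_complex A M \<rho> \<Lambda>"
abbreviation "hatZ \<equiv> hat_cocycles A M \<rho> \<Lambda>"
abbreviation "hatB \<equiv> hat_coboundaries A M \<rho> \<Lambda>"
abbreviation "hatH \<equiv> hat_cohomology A M \<rho> \<Lambda>"
abbreviation "hatD \<equiv> hat_diff A M \<rho>"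
abbreviation "cmap \<equiv> char_map A M \<rho> \<Lambda>"
abbreviation "DChar \<equiv> diff_characters A M \<rho> \<Lambda>"
abbreviation "intg \<equiv> rel_integral A M"
abbreviation "RForms \<equiv> rel_forms A M"
abbreviation "PForms \<equiv> rel_period_forms A M \<rho> \<Lambda>"

lemma subring_diff: "x \<in> \<Lambda> \<Longrightarrow> y \<in> \<Lambda> \<Longrightarrow> x - y \<in> \<Lambda>" and subring_zero: "0 \<in> \<Lambda>"
proof -
  have sg: "subgroup \<Lambda> real_group" using subring by (simp add: subring_def)
  show "0 \<in> \<Lambda>" using subgroup.one_closed[OF sg] by (simp add: ring_of_type_algebra_def)
  interpret R: group real_group
    using cring_from_type_algebra[where 'a = real] by (simp add: cring_def ring_def abelian_group_def abelian_group_axioms_def comm_group_def)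
  assume xy: "x \<in> \<Lambda>" "y \<in> \<Lambda>"
  have "inv\<^bsub>real_group\<^esub> y = - y"
    by (rule R.inv_equality) (simp_all add: ring_of_type_algebra_def)
  then have "- y \<in> \<Lambda>" using subgroup.m_inv_closed[OF sg xy(2)] by simp
  then show "x - y \<in> \<Lambda>" using subgroup.m_closed[OF sg xy(1), of "- y"] by (simp add: ring_of_type_algebra_def)
qed

lemma subring_minus: "x \<in> \<Lambda> \<Longrightarrow> - x \<in> \<Lambda>"
  using subring_diff[OF subring_zero] by simp

lemma subring_add: "x \<in> \<Lambda> \<Longrightarrow> y \<in> \<Lambda> \<Longrightarrow> x + y \<in> \<Lambda>"
  using subring_diff[OF _ subring_minus] by fastforce

lemma Ch_iff: "(\<sigma>, \<tau>) \<in> Ch k \<longleftrightarrow> \<sigma> \<in> carrier (smooth_chains M k) \<and> \<tau> \<in> carrier (smooth_chains A (k - 1))"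
  by (simp add: rel_chains_def)

lemma additive_on_Ch: "additive_on (Ch k) UNIV (\<lambda>a. a)"
  by (auto simp: additive_on_def rel_chains_def smooth_chains_diff)

lemma Ch_zero: "0 \<in> Ch k"
  by (simp add: zero_prod_def Ch_iff smooth_chains_zero)

lemma Ch_diff: "x \<in> Ch k \<Longrightarrow> y \<in> Ch k \<Longrightarrow> x - y \<in> Ch k"
  by (rule additive_onD(2)[OF additive_on_Ch])

lemma Ch_add: "x \<in> Ch k \<Longrightarrow> y \<in> Ch k \<Longrightarrow> x + y \<in> Ch k"
  by (rule additive_on_add(1)[OF additive_on_Ch])

lemma bd_diff: "bd k (x - y) = bd k x - bd k y"
  by (cases x; cases y) (simp add: rel_boundary_def chain_boundary_diff chain_map_diff algebra_simps)

lemma bd_0: "bd k 0 = 0"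
  using bd_diff[of k 0 0] by simp

lemma bd_minus: "bd k (- x) = - bd k x"
  using bd_diff[of k 0 x] by (simp add: bd_0)

lemma bd_add: "bd k (x + y) = bd k x + bd k y"
  using bd_diff[of k x "- y"] by (simp add: bd_minus)

lemma smooth_chain_map:
  assumes "c \<in> carrier (smooth_chains A k)"
  shows "chain_map (nat k) \<rho> c \<in> carrier (smooth_chains M k)"
  using assms
proof (induction rule: smooth_chains_induct)
  case (simplex s)
  then show ?case
    using smooth_simplex_map[OF A.smooth_manifold M.smooth_manifold smooth_map] by (simp add: smooth_chains_of)
qed (auto simp: chain_map_diff smooth_chains_zero intro: smooth_chains_diff)

lemma bd_in_Ch: "x \<in> Ch k \<Longrightarrow> bd k x \<in> Ch (k - 1)"
  using M.smooth_chain_boundary[of _ k] A.smooth_chain_boundary[of _ "k - 1"] smooth_chain_map[of _ "k - 1"]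
  by (cases x) (simp add: rel_boundary_def Ch_iff smooth_chains_add smooth_chains_minus)

text \<open>By naturality of the boundary the two mixed terms are equal, and the minus sign in the
  second component makes them cancel.\<close>

lemma bd_bd:
  assumes "x \<in> Ch k"
  shows "bd (k - 1) (bd k x) = 0"
proof -
  obtain \<sigma> \<tau> where x: "x = (\<sigma>, \<tau>)" by (cases x)
  then have st: "singular_chain (nat k) (mtop M) \<sigma>" "singular_chain (nat (k - 1)) (mtop A) \<tau>"
    using assms by (auto simp: Ch_iff intro: smooth_chain_singular)
  \<comment> \<open>Truncated subtraction agrees with the passage to the previous degree for every
    integer, negative ones included.\<close>
  have n: "nat (k - 1) = nat k - Suc 0" "nat (k - 1 - 1) = nat (k - 1) - Suc 0" by auto
  show ?thesis
    unfolding x rel_boundary_def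
    using chain_boundary_boundary[OF st(1)] chain_boundary_boundary[OF st(2)] chain_boundary_chain_map[OF st(2), of \<rho>]
    unfolding n(2) n(1)[symmetric]
    by (simp add: chain_boundary_add chain_map_minus chain_boundary_minus zero_prod_def)
qed

lemma Cyc_iff: "x \<in> Cyc k \<longleftrightarrow> x \<in> Ch k \<and> bd k x = 0"
  by (auto simp: rel_cycles_def kernel_def rel_chains_def smooth_chains_def zero_prod_def)

lemma bd_in_Cyc: "x \<in> Ch k \<Longrightarrow> bd k x \<in> Cyc (k - 1)"
  by (simp add: Cyc_iff bd_in_Ch bd_bd)

lemma rel_integral_diff: "intg k w (x - y) = intg k w x - intg k w y"
  by (cases w; cases x; cases y) (simp add: rel_integral_def integral_chain_diff)

lemma carrier_rel_forms: "(\<omega>, \<theta>) \<in> carrier (RForms k) \<longleftrightarrow> \<omega> \<in> carrier (forms M k) \<and> \<theta> \<in> carrier (forms A (k - 1))"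
  by (simp add: rel_forms_def)

lemma Ch_induct [consumes 1, case_names left right diff zero]:
  assumes "x \<in> Ch k"
    and l: "\<And>s. 0 \<le> k \<Longrightarrow> smooth_simplex M (nat k) s \<Longrightarrow> P (frag_of s, 0)"
    and r: "\<And>s. 0 \<le> k - 1 \<Longrightarrow> smooth_simplex A (nat (k - 1)) s \<Longrightarrow> P (0, frag_of s)"
    and d: "\<And>a b. P a \<Longrightarrow> P b \<Longrightarrow> P (a - b)" and z: "P 0"
  shows "P x"
proof -
  obtain \<sigma> \<tau> where x: "x = (\<sigma>, \<tau>)" "\<sigma> \<in> carrier (smooth_chains M k)" "\<tau> \<in> carrier (smooth_chains A (k - 1))"
    using assms(1) by (cases x) (auto simp: Ch_iff)
  have 1: "P (\<sigma>, 0)"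
    using x(2)
  proof (induction rule: smooth_chains_induct)
    case (diff a b)
    then show ?case using d[of "(a, 0)" "(b, 0)"] by simp
  qed (use z l in \<open>auto simp: zero_prod_def\<close>)
  have 2: "P (0, \<tau>)"
    using x(3)
  proof (induction rule: smooth_chains_induct)
    case (diff a b)
    then show ?case using d[of "(0, a)" "(0, b)"] by simp
  qed (use z r in \<open>auto simp: zero_prod_def\<close>)
  show ?thesis using d[OF 1 d[OF z 2]] by (simp add: x(1) zero_prod_def)
qed

text \<open>The replacement for Stokes' theorem: contracting a simplex changes the integral over its boundary
  continuously, hence not at all when it takes values in \<open>\<Lambda>\<close>.\<close>

theorem integral_boundary_eq_zero:
  assumes k: "0 \<le> k" "k = 0 \<Longrightarrow> topspace (mtop A) = {}" and w: "w \<in> carrier (RForms k)"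
    and int: "\<And>x. x \<in> Ch (k + 1) \<Longrightarrow> intg k w (bd (k + 1) x) \<in> \<Lambda>"
    and x: "x \<in> Ch (k + 1)"
  shows "intg k w (bd (k + 1) x) = 0"
proof -
  obtain \<omega> \<theta> where w': "w = (\<omega>, \<theta>)" by (cases w)
  define q where "q = nat k"
  have q: "k = int q" "nat (k + 1) = Suc q" "nat k = q" using k(1) by (auto simp: q_def)
  have \<omega>: "is_form M q \<omega>" using w k(1) by (auto simp: w' carrier_rel_forms forms_def q_def)
  have unit: "\<phi> 1 = \<phi> 0" if "continuous_on {0..1} \<phi>" "\<And>t. t \<in> {0..1} \<Longrightarrow> \<phi> t \<in> \<Lambda>" for \<phi> :: "real \<Rightarrow> real"
    by (rule constant_if_values_in_proper_subgroup[OF subring_diff proper that]) auto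
  show ?thesis
    using x
  proof (induction rule: Ch_induct)
    case (left s)
    then have s: "smooth_simplex M (Suc q) s" using q by simp
    define \<phi> where "\<phi> t = (\<Sum>i\<le>Suc q. (-1) ^ i * integral_simplex M q \<omega> (singular_face (Suc q) i (shrink (Suc q) t s)))" for t
    have eq: "intg k w (bd (k + 1) (frag_of r, 0)) =
        (\<Sum>i\<le>Suc q. (-1) ^ i * integral_simplex M q \<omega> (singular_face (Suc q) i r))" for r
      using integral_chain_boundary_of[of "Suc q" M k \<omega> r] by (simp add: w' rel_integral_def rel_boundary_def q q(2)[unfolded q(1)] del: sum.atMost_Suc)
    have "\<phi> 1 = \<phi> 0"
    proof (rule unit)
      show "continuous_on {0..1} \<phi>"
        using M.boundary_integral_shrink(1)[OF s, of \<omega>] \<omega> by (simp add: \<phi>_def[abs_def] del: sum.atMost_Suc)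
      fix t :: real assume t: "t \<in> {0..1}"
      have "smooth_simplex M (Suc q) (shrink (Suc q) t s)"
        by (rule M.smooth_simplex_affine_subsimplex[OF s contraction_in_standard_simplex[OF unit_vec_in_standard_simplex t]])
      then have "(frag_of (shrink (Suc q) t s), 0) \<in> Ch (k + 1)"
        using k(1) by (simp add: Ch_iff smooth_chains_zero smooth_chains_of q(2))
      from int[OF this] show "\<phi> t \<in> \<Lambda>" unfolding eq \<phi>_def .
    qed
    also have "\<phi> 0 = 0"
      using M.boundary_integral_shrink(2)[OF s, of \<omega>] \<omega> by (simp add: \<phi>_def del: sum.atMost_Suc)
    finally show ?case
      unfolding eq \<phi>_def shrink_1[OF M.smooth_simplex_singular[OF s]] .
  next
    case (right s)
    then have s: "smooth_simplex A q s" using q by simp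
    \<comment> \<open>In degree 0 the boundary of \<open>(0, frag_of s)\<close> is a point of
      \<open>M\<close>, where contraction has no effect. That degree occurs only when
      \<open>A\<close> is empty and has no simplices.\<close>
    have "k \<noteq> 0"
      using k(2) singular_simplex_empty[of "mtop A" q s] A.smooth_simplex_singular[OF s] by blast
    then have q1: "1 \<le> q" "nat (k - 1) = q - 1" using k(1) by (auto simp: q_def)
    have \<theta>: "is_form A (q - 1) \<theta>" using w k(1) \<open>k \<noteq> 0\<close> q1(2) by (auto simp: w' carrier_rel_forms forms_def)
    have rs: "smooth_simplex M q (simplex_map q \<rho> s)"
      by (rule smooth_simplex_map[OF A.smooth_manifold M.smooth_manifold smooth_map s])
    define \<phi> where "\<phi> t = integral_simplex M q \<omega> (shrink q t (simplex_map q \<rho> s)) -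
      (\<Sum>i\<le>q. (-1) ^ i * integral_simplex A (q - 1) \<theta> (singular_face q i (shrink q t s)))" for t
    have eq: "intg k w (bd (k + 1) (0, frag_of r)) = integral_simplex M q \<omega> (simplex_map q \<rho> r) -
        (\<Sum>i\<le>q. (-1) ^ i * integral_simplex A (q - 1) \<theta> (singular_face q i r))" for r
      using integral_chain_boundary_of[OF q1(1), of A "k - 1" \<theta> r]
      by (simp add: w' rel_integral_def rel_boundary_def q(2,3) q1(2) integral_chain_of integral_chain_minus)
    note u = unit_vec_in_standard_simplex
    have "\<phi> 1 = \<phi> 0"
    proof (rule unit)
      show "continuous_on {0..1} \<phi>"
        unfolding \<phi>_def[abs_def]
        by (intro continuous_on_diff M.continuous_on_integral_simplex_contraction(1)[OF \<omega> rs u]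
            A.boundary_integral_shrink(1)[OF s q1(1) \<theta>])
      fix t :: real assume t: "t \<in> {0..1}"
      have "smooth_simplex A q (shrink q t s)"
        by (rule A.smooth_simplex_affine_subsimplex[OF s contraction_in_standard_simplex[OF u t]])
      then have "(0, frag_of (shrink q t s)) \<in> Ch (k + 1)"
        using k(1) by (simp add: Ch_iff smooth_chains_zero smooth_chains_of q)
      from int[OF this] show "\<phi> t \<in> \<Lambda>" unfolding eq \<phi>_def simplex_map_shrink[OF t] .
    qed
    \<comment> \<open>The simplex in \<open>M\<close> has positive dimension q, so its integral also
      tends to 0.\<close>
    also have "\<phi> 0 = 0"
    proof -
      have "integral_simplex M q \<omega> (shrink q 0 (simplex_map q \<rho> s)) =
          0 ^ q * (M.form_on_edges q q \<omega> (simplex_map q \<rho> s) unit_vec (unit_vec 0) * param_volume q)"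
        by (rule M.continuous_on_integral_simplex_contraction(2)[OF \<omega> rs u])
      then show ?thesis
        unfolding \<phi>_def A.boundary_integral_shrink(2)[OF s q1(1) \<theta>] using q1(1) by (simp add: power_0_left)
    qed
    finally show ?case
      unfolding eq \<phi>_def shrink_1[OF A.smooth_simplex_singular[OF s]] shrink_1[OF M.smooth_simplex_singular[OF rs]] .
  next
    case (diff a b)
    then show ?case by (simp add: bd_diff rel_integral_diff)
  next
    case zero
    show ?case using rel_integral_diff[of k w 0 0] by (simp add: bd_0)
  qed
qed

text \<open>The chains \<open>(frag_of s, 0)\<close> and \<open>(0, frag_of s)\<close> test the two
  components separately. For k = 1 the second component is a function, on which integrals with
  values in \<Lambda> give no control; then \<open>A\<close> is empty.\<close>

theorem rel_form_eq_zero: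
  assumes k: "1 \<le> k" "k = 1 \<Longrightarrow> topspace (mtop A) = {}" and w: "w \<in> carrier (RForms k)"
    and int: "\<And>x. x \<in> Ch k \<Longrightarrow> intg k w x \<in> \<Lambda>"
  shows "w = (\<lambda>p vs. 0, \<lambda>p vs. 0)"
proof -
  obtain \<omega> \<theta> where w': "w = (\<omega>, \<theta>)" by (cases w)
  have "\<omega> = (\<lambda>p vs. 0)"
  proof (rule M.form_eq_zero_if_integrals_in_proper_subgroup[OF _ _ subring_diff proper])
    show "is_form M (nat k) \<omega>" using w k(1) by (auto simp: w' carrier_rel_forms forms_def)
    show "1 \<le> nat k" using k(1) by simp
    show "integral_simplex M (nat k) \<omega> s \<in> \<Lambda>" if "smooth_simplex M (nat k) s" for s
    proof -
      have "(frag_of s, 0) \<in> Ch k" using that k(1) by (simp add: Ch_iff smooth_chains_zero smooth_chains_of)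
      from int[OF this] show ?thesis by (simp add: w' rel_integral_def integral_chain_of)
    qed
  qed
  moreover have \<theta>: "is_form A (nat (k - 1)) \<theta>" using w k(1) by (auto simp: w' carrier_rel_forms forms_def)
  have "\<theta> = (\<lambda>p vs. 0)"
  proof (cases "k = 1")
    case True
    then show ?thesis using k(2) \<theta> by (auto simp: is_form_def)
  next
    case False
    show ?thesis
    proof (rule A.form_eq_zero_if_integrals_in_proper_subgroup[OF \<theta> _ subring_diff proper])
      show "1 \<le> nat (k - 1)" using k(1) False by simp
      show "integral_simplex A (nat (k - 1)) \<theta> s \<in> \<Lambda>" if "smooth_simplex A (nat (k - 1)) s" for s
      proof -
        have "(0, frag_of s) \<in> Ch k" using that k(1) by (simp add: Ch_iff smooth_chains_zero smooth_chains_of)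
        from int[OF this] show ?thesis by (simp add: w' rel_integral_def integral_chain_of)
      qed
    qed
  qed
  ultimately show ?thesis by (simp add: w')
qed

end

section \<open>The groups of the complex\<close>

lemma real_ring_simps [simp]:
  "carrier real_ring = UNIV" "x \<oplus>\<^bsub>real_ring\<^esub> y = x + y" "\<zero>\<^bsub>real_ring\<^esub> = 0"
  by (simp_all add: ring_of_type_algebra_def)

lemma comm_group_real_group: "comm_group real_group"
  by (rule comm_groupI) (auto intro: exI[of _ "- x" for x :: real])

text \<open>Makes real cochains the case \<open>UNIV\<close> of cochains with values in a subgroup,
  so that one set of lemmas serves both coefficient groups.\<close>

lemma real_group_eq_subring_group: "real_group = subring_group UNIV"
  by (simp add: subring_group_def ring_of_type_algebra_def)

lemma comm_group_DirProd:
  assumes "comm_group G" "comm_group H"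
  shows "comm_group (G \<times>\<times> H)"
proof -
  interpret G: comm_group G by fact
  interpret H: comm_group H by fact
  show ?thesis
    by (rule group.group_comm_groupI[OF DirProd_group[OF G.is_group H.is_group]])
      (auto simp: G.m_comm H.m_comm)
qed

lemma comm_group_restrict:
  assumes "comm_group G" "subgroup J G"
  shows "comm_group (G\<lparr>carrier := J\<rparr>)"
proof -
  interpret G: comm_group G by fact
  show ?thesis
    by (rule group.group_comm_groupI[OF subgroup.subgroup_is_group[OF assms(2) G.is_group]])
      (use subgroup.subset[OF assms(2)] G.m_comm in auto)
qed

lemma comm_group_Hom_group:
  assumes "group C" "comm_group G"
  shows "comm_group (Hom_group C G)"
proof -
  interpret C: group C by fact
  interpret G: comm_group G by fact
  show ?thesis
  proof (rule comm_groupI)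
    fix f g assume f: "f \<in> carrier (Hom_group C G)" and g: "g \<in> carrier (Hom_group C G)"
    then have c: "\<And>x. x \<in> carrier C \<Longrightarrow> f x \<in> carrier G" "\<And>x. x \<in> carrier C \<Longrightarrow> g x \<in> carrier G"
      "\<And>x y. x \<in> carrier C \<Longrightarrow> y \<in> carrier C \<Longrightarrow> f (x \<otimes>\<^bsub>C\<^esub> y) = f x \<otimes>\<^bsub>G\<^esub> f y"
      "\<And>x y. x \<in> carrier C \<Longrightarrow> y \<in> carrier C \<Longrightarrow> g (x \<otimes>\<^bsub>C\<^esub> y) = g x \<otimes>\<^bsub>G\<^esub> g y"
      by (auto simp: Hom_group_def hom_def)
    show "f \<otimes>\<^bsub>Hom_group C G\<^esub> g \<in> carrier (Hom_group C G)"
      using c by (auto simp: Hom_group_def hom_def G.m_ac)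
    show "f \<otimes>\<^bsub>Hom_group C G\<^esub> g = g \<otimes>\<^bsub>Hom_group C G\<^esub> f"
      using c by (auto simp: Hom_group_def G.m_comm restrict_def fun_eq_iff)
    fix h assume h: "h \<in> carrier (Hom_group C G)"
    then have "\<And>x. x \<in> carrier C \<Longrightarrow> h x \<in> carrier G" by (auto simp: Hom_group_def hom_def)
    then show "f \<otimes>\<^bsub>Hom_group C G\<^esub> g \<otimes>\<^bsub>Hom_group C G\<^esub> h = f \<otimes>\<^bsub>Hom_group C G\<^esub> (g \<otimes>\<^bsub>Hom_group C G\<^esub> h)"
      using c by (auto simp: Hom_group_def G.m_assoc restrict_def fun_eq_iff)
  next
    show "\<one>\<^bsub>Hom_group C G\<^esub> \<in> carrier (Hom_group C G)"
      by (auto simp: Hom_group_def hom_def)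
  next
    fix f assume f: "f \<in> carrier (Hom_group C G)"
    then have c: "\<And>x. x \<in> carrier C \<Longrightarrow> f x \<in> carrier G" "f \<in> extensional (carrier C)"
      "\<And>x y. x \<in> carrier C \<Longrightarrow> y \<in> carrier C \<Longrightarrow> f (x \<otimes>\<^bsub>C\<^esub> y) = f x \<otimes>\<^bsub>G\<^esub> f y"
      by (auto simp: Hom_group_def hom_def)
    show "\<one>\<^bsub>Hom_group C G\<^esub> \<otimes>\<^bsub>Hom_group C G\<^esub> f = f"
      using c by (auto simp: Hom_group_def restrict_def fun_eq_iff extensional_def)
    show "\<exists>g\<in>carrier (Hom_group C G). g \<otimes>\<^bsub>Hom_group C G\<^esub> f = \<one>\<^bsub>Hom_group C G\<^esub>"
    proof (rule bexI)
      show "(\<lambda>x\<in>carrier C. inv\<^bsub>G\<^esub> f x) \<in> carrier (Hom_group C G)"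
        using c by (auto simp: Hom_group_def hom_def G.inv_mult)
      show "(\<lambda>x\<in>carrier C. inv\<^bsub>G\<^esub> f x) \<otimes>\<^bsub>Hom_group C G\<^esub> f = \<one>\<^bsub>Hom_group C G\<^esub>"
        using c by (auto simp: Hom_group_def restrict_def fun_eq_iff)
    qed
  qed
qed

lemma alternating_multilinear_combine:
  assumes f: "alternating_multilinear k T f" and g: "alternating_multilinear k T g"
  shows "alternating_multilinear k T (\<lambda>vs. a * f vs + b * g vs)"
  unfolding alternating_multilinear_def
proof (intro conjI allI impI)
  note f' = f[unfolded alternating_multilinear_def] and g' = g[unfolded alternating_multilinear_def]
  fix vs :: "'a tvec list"
  show "a * f vs + b * g vs = 0" if "\<not> (length vs = k \<and> set vs \<subseteq> T)"
    using conjunct1[OF f', rule_format, OF that] conjunct1[OF g', rule_format, OF that] by simp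
  fix i :: nat
  show "a * f (vs[i := \<lambda>c j. \<alpha> * u c j + \<beta> * w c j]) + b * g (vs[i := \<lambda>c j. \<alpha> * u c j + \<beta> * w c j]) =
      \<alpha> * (a * f (vs[i := u]) + b * g (vs[i := u])) + \<beta> * (a * f (vs[i := w]) + b * g (vs[i := w]))"
    if "length vs = k \<and> set vs \<subseteq> T \<and> i < k \<and> u \<in> T \<and> w \<in> T" for u w \<alpha> \<beta>
    using conjunct1[OF conjunct2[OF f'], rule_format, OF that] conjunct1[OF conjunct2[OF g'], rule_format, OF that]
    by (simp add: algebra_simps)
  show "a * f vs + b * g vs = 0" if "length vs = k \<and> set vs \<subseteq> T \<and> i < j \<and> j < k \<and> vs ! i = vs ! j" for j
    using conjunct2[OF conjunct2[OF f'], rule_format, OF that] conjunct2[OF conjunct2[OF g'], rule_format, OF that]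
    by simp
qed

context smooth_mfd
begin

lemma is_form_combine:
  assumes \<omega>: "is_form M k \<omega>" and \<eta>: "is_form M k \<eta>"
  shows "is_form M k (\<lambda>p vs. a * \<omega> p vs + b * \<eta> p vs)"
  unfolding is_form_def
proof (intro conjI allI impI ballI)
  show "(\<lambda>vs. a * \<omega> p vs + b * \<eta> p vs) = (\<lambda>_. 0)" if "p \<notin> topspace (mtop M)" for p
    using \<omega> \<eta> that by (simp add: is_form_def)
  show "alternating_multilinear k (tangent_space M p) (\<lambda>vs. a * \<omega> p vs + b * \<eta> p vs)"
    if "p \<in> topspace (mtop M)" for p
    by (rule alternating_multilinear_combine[OF form_alternating[OF \<omega> that] form_alternating[OF \<eta> that]])
  fix c js assume c: "c \<in> atlas M" and js: "length js = k \<and> set js \<subseteq> {..<mdim M}"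
  show "smooth_on (mdim M) (snd c ` fst c)
      (\<lambda>x. a * \<omega> (inv_chart c x) (map (\<lambda>j. tvec_of M c (inv_chart c x) (unit_vec j)) js) +
           b * \<eta> (inv_chart c x) (map (\<lambda>j. tvec_of M c (inv_chart c x) (unit_vec j)) js))"
    using \<omega> \<eta> c js chart_image_coord_space[OF c]
    by (intro smooth_on_add smooth_on_mult smooth_on_const) (simp_all add: is_form_def)
qed

lemma is_form_zero: "is_form M k (\<lambda>p vs. 0)"
  using smooth_on_const[OF chart_image_coord_space] by (simp add: is_form_def alternating_multilinear_def)

lemma comm_group_forms: "comm_group (forms M k)"
proof (cases "k < 0")
  case True
  then show ?thesis by (intro comm_groupI) (auto simp: forms_def)
next
  case False
  show ?thesis
  proof (rule comm_groupI)
    fix \<omega> \<eta> assume "\<omega> \<in> carrier (forms M k)" "\<eta> \<in> carrier (forms M k)"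
    then show "\<omega> \<otimes>\<^bsub>forms M k\<^esub> \<eta> \<in> carrier (forms M k)"
      using False is_form_combine[of "nat k" \<omega> \<eta> 1 1] by (simp add: forms_def)
  next
    show "\<one>\<^bsub>forms M k\<^esub> \<in> carrier (forms M k)" using False is_form_zero by (simp add: forms_def)
  next
    fix \<omega> assume "\<omega> \<in> carrier (forms M k)"
    then have "(\<lambda>p vs. (-1) * \<omega> p vs + 0 * \<omega> p vs) \<in> carrier (forms M k)"
      using False is_form_combine[of "nat k" \<omega> \<omega> "-1" 0] by (simp add: forms_def)
    then show "\<exists>\<eta>\<in>carrier (forms M k). \<eta> \<otimes>\<^bsub>forms M k\<^esub> \<omega> = \<one>\<^bsub>forms M k\<^esub>"
      by (rule bexI[rotated]) (simp add: forms_def)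
  qed (auto simp: forms_def add_ac)
qed

lemma integral_chain_form_add:
  assumes "\<omega> \<in> carrier (forms M k)" "\<eta> \<in> carrier (forms M k)" "c \<in> carrier (smooth_chains M k)"
  shows "integral_chain M k (\<omega> \<otimes>\<^bsub>forms M k\<^esub> \<eta>) c = integral_chain M k \<omega> c + integral_chain M k \<eta> c"
  unfolding integral_chain_def sum.distrib[symmetric]
proof (rule sum.cong[OF refl])
  fix s assume "s \<in> Poly_Mapping.keys c"
  then have "0 \<le> k" "smooth_simplex M (nat k) s" using assms(3) by (auto simp: carrier_smooth_chains split: if_splits)
  moreover from this have "is_form M (nat k) \<omega>" "is_form M (nat k) \<eta>" using assms(1,2) by (auto simp: forms_def)
  ultimately have "integral_simplex M (nat k) (\<omega> \<otimes>\<^bsub>forms M k\<^esub> \<eta>) s =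
      integral_simplex M (nat k) \<omega> s + integral_simplex M (nat k) \<eta> s"
    using integral_simplex_add by (simp add: forms_def)
  then show "real_of_int (Poly_Mapping.lookup c s) * integral_simplex M (nat k) (\<omega> \<otimes>\<^bsub>forms M k\<^esub> \<eta>) s =
      real_of_int (Poly_Mapping.lookup c s) * integral_simplex M (nat k) \<omega> s +
      real_of_int (Poly_Mapping.lookup c s) * integral_simplex M (nat k) \<eta> s"
    by (simp add: distrib_left)
qed

end

section \<open>Relative cochains, forms with periods, and the complex\<close>

context rel_mfd
begin

lemma subgroup_subring: "subgroup \<Lambda> real_group"
  using subring by (simp add: subring_def)

lemma rel_chains_simps [simp]:
  "x \<otimes>\<^bsub>rel_chains A M k\<^esub> y = x + y" "\<one>\<^bsub>rel_chains A M k\<^esub> = 0"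
  by (cases x; cases y) (simp_all add: rel_chains_def smooth_chains_def zero_prod_def)

lemma comm_group_rel_chains: "comm_group (rel_chains A M k)"
  unfolding rel_chains_def smooth_chains_def
  by (intro comm_group_DirProd abelian_free_Abelian_group)

lemma comm_group_rel_cochains:
  assumes "subgroup L real_group"
  shows "comm_group (rel_cochains A M k (subring_group L))"
  unfolding rel_cochains_def subring_group_def
  by (intro comm_group_Hom_group comm_group_restrict[OF comm_group_real_group assms]
      comm_group.axioms(2)[OF comm_group_rel_chains])

lemma subgroup_UNIV: "subgroup UNIV real_group"
  using group.subgroup_self[OF comm_group.axioms(2)[OF comm_group_real_group]] by simp

lemma rel_cochains_iff:
  "f \<in> carrier (rel_cochains A M k (subring_group L)) \<longleftrightarrow> additive_on (Ch k) L f \<and> f \<in> extensional (Ch k)"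
proof -
  have "f \<in> hom (rel_chains A M k) (subring_group L) \<longleftrightarrow> additive_on (Ch k) L f"
  proof
    assume "f \<in> hom (rel_chains A M k) (subring_group L)"
    then have f: "\<And>x. x \<in> Ch k \<Longrightarrow> f x \<in> L" "\<And>x y. x \<in> Ch k \<Longrightarrow> y \<in> Ch k \<Longrightarrow> f (x + y) = f x + f y"
      by (auto simp: hom_def subring_group_def)
    show "additive_on (Ch k) L f"
      unfolding additive_on_def
    proof (intro conjI ballI f(1) Ch_diff)
      fix x y assume xy: "x \<in> Ch k" "y \<in> Ch k"
      show "f (x - y) = f x - f y" using f(2)[OF Ch_diff[OF xy] xy(2)] by simp
    qed
  next
    assume "additive_on (Ch k) L f"
    then show "f \<in> hom (rel_chains A M k) (subring_group L)"
      using additive_onD(1) additive_on_add(2) by (fastforce simp: hom_def subring_group_def)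
  qed
  then show ?thesis by (simp add: rel_cochains_def Hom_group_def)
qed

lemma rel_cochains_simps [simp]:
  "f \<otimes>\<^bsub>rel_cochains A M k (subring_group L)\<^esub> g = (\<lambda>x\<in>Ch k. f x + g x)"
  "\<one>\<^bsub>rel_cochains A M k (subring_group L)\<^esub> = (\<lambda>x\<in>Ch k. 0)"
  by (simp_all add: rel_cochains_def Hom_group_def subring_group_def)

text \<open>The componentwise formula for \<delta> is composition with the relative boundary; in
  this form \<delta>\<delta> = 0 and vanishing on cycles are immediate.\<close>

lemma rel_coboundary_eq:
  assumes f: "additive_on (Ch k) L f"
  shows "rel_coboundary A M \<rho> k f = (\<lambda>x\<in>Ch (k + 1). f (bd (k + 1) x))"
proof -
  have "f (chain_boundary (nat (k + 1)) \<sigma>, 0) + (f (chain_map (nat k) \<rho> \<tau>, 0) - f (0, chain_boundary (nat k) \<tau>)) =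
      f (bd (k + 1) (\<sigma>, \<tau>))" if "(\<sigma>, \<tau>) \<in> Ch (k + 1)" for \<sigma> \<tau>
  proof -
    have st: "\<sigma> \<in> carrier (smooth_chains M (k + 1))" "\<tau> \<in> carrier (smooth_chains A k)"
      using that by (auto simp: Ch_iff)
    have in_Ch: "(chain_boundary (nat (k + 1)) \<sigma>, 0) \<in> Ch k" "(chain_map (nat k) \<rho> \<tau>, 0) \<in> Ch k"
        "(0, chain_boundary (nat k) \<tau>) \<in> Ch k"
      using M.smooth_chain_boundary[OF st(1)] smooth_chain_map[OF st(2)] A.smooth_chain_boundary[OF st(2)]
      by (auto simp: Ch_iff smooth_chains_zero)
    have "bd (k + 1) (\<sigma>, \<tau>) = (chain_boundary (nat (k + 1)) \<sigma>, 0) + ((chain_map (nat k) \<rho> \<tau>, 0) - (0, chain_boundary (nat k) \<tau>))"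
      by (simp add: rel_boundary_def)
    then show ?thesis
      using additive_on_add(2)[OF f in_Ch(1) Ch_diff[OF in_Ch(2,3)]] additive_onD(3)[OF f in_Ch(2,3)] by simp
  qed
  then show ?thesis by (auto simp: rel_coboundary_def Let_def restrict_def fun_eq_iff)
qed

lemma comm_group_rel_forms: "comm_group (RForms k)"
  unfolding rel_forms_def by (intro comm_group_DirProd A.comm_group_forms M.comm_group_forms)

lemma one_rel_forms: "\<one>\<^bsub>RForms k\<^esub> = (\<lambda>p vs. 0, \<lambda>p vs. 0)"
  by (simp add: rel_forms_def forms_def)

lemma rel_integral_form_add:
  assumes "w \<in> carrier (RForms k)" "w' \<in> carrier (RForms k)" "x \<in> Ch k"
  shows "intg k (w \<otimes>\<^bsub>RForms k\<^esub> w') x = intg k w x + intg k w' x"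
  using assms by (cases w; cases w'; cases x)
    (simp add: rel_forms_def rel_integral_def Ch_iff M.integral_chain_form_add A.integral_chain_form_add)

lemma rel_integral_form_zero: "intg k \<one>\<^bsub>RForms k\<^esub> x = 0"
  by (cases x) (simp add: one_rel_forms rel_integral_def integral_chain_def integral_simplex_def set_lebesgue_integral_def)

lemma rel_period_forms_iff:
  "w \<in> carrier (PForms k) \<longleftrightarrow>
    w \<in> carrier (RForms k) \<and> (\<forall>z\<in>Cyc k. intg k w z \<in> \<Lambda>)"
  by (simp add: rel_period_forms_def)

lemma rel_period_forms_simps [simp]:
  "w \<otimes>\<^bsub>PForms k\<^esub> w' = w \<otimes>\<^bsub>RForms k\<^esub> w'"
  "\<one>\<^bsub>PForms k\<^esub> = \<one>\<^bsub>RForms k\<^esub>"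
  by (simp_all add: rel_period_forms_def)

lemma subgroup_rel_period_forms: "subgroup (carrier (PForms k)) (RForms k)"
proof -
  interpret F: comm_group "RForms k" by (rule comm_group_rel_forms)
  show ?thesis
  proof (rule F.subgroupI)
    show "carrier (PForms k) \<subseteq> carrier (RForms k)" by (auto simp: rel_period_forms_iff)
    have "\<one>\<^bsub>RForms k\<^esub> \<in> carrier (PForms k)"
      by (simp add: rel_period_forms_iff rel_integral_form_zero subring_zero)
    then show "carrier (PForms k) \<noteq> {}" by blast
  next
    fix w assume w: "w \<in> carrier (PForms k)"
    then have wf: "w \<in> carrier (RForms k)" by (simp add: rel_period_forms_iff)
    have "intg k (inv\<^bsub>RForms k\<^esub> w) z = - intg k w z" if "z \<in> Cyc k" for z
      using rel_integral_form_add[OF wf F.inv_closed[OF wf], of z] that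
      by (simp add: Cyc_iff F.r_inv[OF wf] rel_integral_form_zero)
    then show "inv\<^bsub>RForms k\<^esub> w \<in> carrier (PForms k)"
      using w wf by (simp add: rel_period_forms_iff subring_minus)
    fix w' assume w': "w' \<in> carrier (PForms k)"
    then show "w \<otimes>\<^bsub>RForms k\<^esub> w' \<in> carrier (PForms k)"
      using w by (simp add: rel_period_forms_iff rel_integral_form_add Cyc_iff subring_add)
  qed
qed

lemma comm_group_rel_period_forms: "comm_group (PForms k)"
proof -
  have "PForms k = (RForms k)\<lparr>carrier := carrier (PForms k)\<rparr>"
    by (simp add: rel_period_forms_def)
  then show ?thesis using comm_group_restrict[OF comm_group_rel_forms subgroup_rel_period_forms, of k] by simp
qed

lemma hat_complex_eq:
  "hatC k = rel_cochains A M k (subring_group \<Lambda>) \<times>\<times> rel_cochains A M (k - 1) (subring_group UNIV)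
       \<times>\<times> PForms k"
  by (simp only: hat_complex_def real_group_eq_subring_group)

lemma comm_group_hat_complex: "comm_group (hatC k)"
  unfolding hat_complex_eq
  by (intro comm_group_DirProd comm_group_rel_cochains comm_group_rel_period_forms subgroup_subring subgroup_UNIV)

lemma hat_complex_iff:
  "(c, h, w) \<in> carrier (hatC k) \<longleftrightarrow>
    (additive_on (Ch k) \<Lambda> c \<and> c \<in> extensional (Ch k)) \<and>
    (additive_on (Ch (k - 1)) UNIV h \<and> h \<in> extensional (Ch (k - 1))) \<and> w \<in> carrier (PForms k)"
  by (simp add: hat_complex_eq rel_cochains_iff)

lemma hat_complex_mult:
  "(c, h, w) \<otimes>\<^bsub>hatC k\<^esub> (c', h', w') =
    ((\<lambda>x\<in>Ch k. c x + c' x), (\<lambda>x\<in>Ch (k - 1). h x + h' x), w \<otimes>\<^bsub>RForms k\<^esub> w')"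
  by (simp add: hat_complex_eq)

lemma hat_complex_one:
  "\<one>\<^bsub>hatC k\<^esub> = ((\<lambda>x\<in>Ch k. 0), (\<lambda>x\<in>Ch (k - 1). 0), \<one>\<^bsub>RForms k\<^esub>)"
  by (simp add: hat_complex_eq)

lemma hat_diff_eq:
  assumes "(c, h, w) \<in> carrier (hatC k)"
  shows "hatD k (c, h, w) =
    ((\<lambda>x\<in>Ch (k + 1). c (bd (k + 1) x)), (\<lambda>x\<in>Ch k. intg k w x - c x - h (bd k x)), \<one>\<^bsub>RForms (k + 1)\<^esub>)"
proof -
  have c: "additive_on (Ch k) \<Lambda> c" and h: "additive_on (Ch (k - 1)) UNIV h" using assms by (auto simp: hat_complex_iff)
  show ?thesis
    using rel_coboundary_eq[OF c] rel_coboundary_eq[OF h] by (auto simp: hat_diff_def restrict_def fun_eq_iff)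
qed

lemma additive_on_restrict:
  "additive_on (Ch k) L (restrict f (Ch k)) \<longleftrightarrow> additive_on (Ch k) L f"
  by (auto simp: additive_on_def Ch_diff)

lemma additive_on_bd:
  assumes "additive_on (Ch k) L f"
  shows "additive_on (Ch (k + 1)) L (\<lambda>x. f (bd (k + 1) x))"
  unfolding additive_on_def
proof (intro conjI ballI Ch_diff)
  have bd: "bd (k + 1) x \<in> Ch k" if "x \<in> Ch (k + 1)" for x using bd_in_Ch[OF that] by simp
  show "f (bd (k + 1) x) \<in> L" if "x \<in> Ch (k + 1)" for x by (rule additive_onD(1)[OF assms bd[OF that] bd[OF that]])
  show "f (bd (k + 1) (x - y)) = f (bd (k + 1) x) - f (bd (k + 1) y)" if "x \<in> Ch (k + 1)" "y \<in> Ch (k + 1)" for x y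
    unfolding bd_diff by (rule additive_onD(3)[OF assms bd[OF that(1)] bd[OF that(2)]])
qed

lemma hat_diff_in:
  assumes "(c, h, w) \<in> carrier (hatC k)"
  shows "hatD k (c, h, w) \<in> carrier (hatC (k + 1))"
proof -
  have c: "additive_on (Ch k) \<Lambda> c" and h: "additive_on (Ch (k - 1)) UNIV h" using assms by (auto simp: hat_complex_iff)
  have "additive_on (Ch (k + 1)) \<Lambda> (\<lambda>x. c (bd (k + 1) x))" by (rule additive_on_bd[OF c])
  moreover have "additive_on (Ch k) UNIV (\<lambda>x. h (bd k x))" using additive_on_bd[OF h] by simp
  then have "additive_on (Ch k) UNIV (\<lambda>x. intg k w x - c x - h (bd k x))"
    using c unfolding additive_on_def by (simp add: rel_integral_diff)
  moreover have "\<one>\<^bsub>RForms (k + 1)\<^esub> \<in> carrier (PForms (k + 1))"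
    by (rule subgroup.one_closed[OF subgroup_rel_period_forms])
  ultimately show ?thesis
    unfolding hat_diff_eq[OF assms] by (simp add: hat_complex_iff additive_on_restrict)
qed

lemma hat_diff_hom: "hatD k \<in> hom (hatC k) (hatC (k + 1))"
proof (rule homI)
  fix x assume "x \<in> carrier (hatC k)"
  then show "hatD k x \<in> carrier (hatC (k + 1))"
    using hat_diff_in by (cases x) auto
next
  fix x y assume xy: "x \<in> carrier (hatC k)" "y \<in> carrier (hatC k)"
  obtain c h w c' h' w' where e: "x = (c, h, w)" "y = (c', h', w')" by (cases x, cases y) auto
  note m = monoid.m_closed[OF group.is_monoid[OF comm_group.axioms(2)[OF comm_group_hat_complex]] xy]
  have "w \<in> carrier (RForms k)" "w' \<in> carrier (RForms k)"
    using xy by (auto simp: e hat_complex_iff rel_period_forms_iff)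
  then have "hatD k (x \<otimes>\<^bsub>hatC k\<^esub> y) =
      ((\<lambda>x\<in>Ch (k + 1). c (bd (k + 1) x) + c' (bd (k + 1) x)),
       (\<lambda>x\<in>Ch k. (intg k w x - c x - h (bd k x)) + (intg k w' x - c' x - h' (bd k x))),
       \<one>\<^bsub>RForms (k + 1)\<^esub>)"
    using hat_diff_eq[OF m[unfolded e hat_complex_mult]] bd_in_Ch[of _ k] bd_in_Ch[of _ "k + 1"]
    unfolding e hat_complex_mult
    by (auto simp: restrict_def fun_eq_iff rel_integral_form_add)
  also have "\<dots> = hatD k x \<otimes>\<^bsub>hatC (k + 1)\<^esub> hatD k y"
    using xy unfolding e
    by (simp add: hat_diff_eq hat_complex_mult)
      (auto simp: restrict_def fun_eq_iff one_rel_forms rel_forms_def forms_def)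
  finally show "hatD k (x \<otimes>\<^bsub>hatC k\<^esub> y) =
      hatD k x \<otimes>\<^bsub>hatC (k + 1)\<^esub> hatD k y" .
qed

lemma hat_diff_group_hom: "group_hom (hatC k) (hatC (k + 1)) (hatD k)"
  by (intro group_hom.intro group_hom_axioms.intro comm_group.axioms(2)[OF comm_group_hat_complex] hat_diff_hom)

text \<open>The third component of the differential is always neutral, which leaves two
  conditions.\<close>

lemma hat_cocycles_iff:
  "(c, h, w) \<in> carrier (hatZ k) \<longleftrightarrow>
    (c, h, w) \<in> carrier (hatC k) \<and> (\<forall>x\<in>Ch (k + 1). c (bd (k + 1) x) = 0) \<and>
    (\<forall>x\<in>Ch k. intg k w x = c x + h (bd k x))"
proof (cases "(c, h, w) \<in> carrier (hatC k)")
  case True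
  have "hatD k (c, h, w) = \<one>\<^bsub>hatC (k + 1)\<^esub> \<longleftrightarrow>
      (\<forall>x\<in>Ch (k + 1). c (bd (k + 1) x) = 0) \<and> (\<forall>x\<in>Ch k. intg k w x = c x + h (bd k x))"
    unfolding hat_diff_eq[OF True] hat_complex_one by (auto simp: fun_eq_iff algebra_simps)
  then show ?thesis using True by (simp add: hat_cocycles_def kernel_def)
qed (simp add: hat_cocycles_def kernel_def)

lemma subgroup_hat_cocycles: "subgroup (carrier (hatZ k)) (hatC k)"
  using group_hom.subgroup_kernel[OF hat_diff_group_hom, of k] by (simp add: hat_cocycles_def)

lemma hat_cocycles_eq:
  "hatZ k = (hatC k)\<lparr>carrier := carrier (hatZ k)\<rparr>"
  by (simp add: hat_cocycles_def)

lemma comm_group_hat_cocycles: "comm_group (hatZ k)"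
  by (subst hat_cocycles_eq) (rule comm_group_restrict[OF comm_group_hat_complex subgroup_hat_cocycles])

text \<open>In the square of the differential everything cancels formally except the integral of
  \<open>w\<close> over boundaries. Boundaries are cycles, so these integrals lie in \<Lambda>, and
  \<open>integral_boundary_eq_zero\<close> makes them vanish.\<close>

lemma hat_coboundaries_subset:
  assumes k: "1 \<le> k" "k = 1 \<Longrightarrow> topspace (mtop A) = {}"
  shows "hatB k \<subseteq> carrier (hatZ k)"
proof
  fix y assume "y \<in> hatB k"
  then obtain c h w where x: "(c, h, w) \<in> carrier (hatC (k - 1))" and y: "y = hatD (k - 1) (c, h, w)"
    by (auto simp: hat_coboundaries_def)
  have c: "additive_on (Ch (k - 1)) \<Lambda> c" and h: "additive_on (Ch (k - 1 - 1)) UNIV h"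
    and w: "w \<in> carrier (PForms (k - 1))"
    using x by (auto simp: hat_complex_iff)
  have c0: "c 0 = 0" "h 0 = 0" using additive_on_zero(2)[OF c Ch_zero] additive_on_zero(2)[OF h Ch_zero] by auto
  have closed: "intg (k - 1) w (bd k x) = 0" if "x \<in> Ch k" for x
    using integral_boundary_eq_zero[of "k - 1" w x] k w that bd_in_Cyc[of _ k] by (auto simp: rel_period_forms_iff)
  have bb: "bd k (bd (k + 1) x) = 0" if "x \<in> Ch (k + 1)" for x using bd_bd[OF that] by simp
  have y': "y = ((\<lambda>x\<in>Ch k. c (bd k x)), (\<lambda>x\<in>Ch (k - 1). intg (k - 1) w x - c x - h (bd (k - 1) x)), \<one>\<^bsub>RForms k\<^esub>)"
    using hat_diff_eq[OF x] by (simp add: y)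
  have "y \<in> carrier (hatC k)" using hat_diff_in[OF x] by (simp add: y)
  then show "y \<in> carrier (hatZ k)"
    unfolding y' using closed bb bd_in_Ch[of _ k] bd_in_Ch[of _ "k + 1"] bd_bd[of _ k] c0
    by (simp add: hat_cocycles_iff rel_integral_form_zero)
qed

lemma subgroup_hat_coboundaries:
  assumes k: "1 \<le> k" "k = 1 \<Longrightarrow> topspace (mtop A) = {}"
  shows "subgroup (hatB k) (hatZ k)"
proof -
  have "subgroup (hatB k) (hatC k)"
    using group_hom.img_is_subgroup[OF hat_diff_group_hom, of "k - 1"] by (simp add: hat_coboundaries_def)
  then show ?thesis
    by (subst hat_cocycles_eq)
      (rule group.subgroup_incl[OF comm_group.axioms(2)[OF comm_group_hat_complex] _ subgroup_hat_cocycles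
          hat_coboundaries_subset[OF k]])
qed

end

section \<open>Differential characters\<close>

context rel_mfd
begin

lemma reduce_mod_eq: "reduce_mod \<Lambda> x = (\<lambda>h. h + x) ` \<Lambda>"
  by (auto simp: reduce_mod_def r_coset_def)

lemma reduce_mod_eq_iff: "reduce_mod \<Lambda> x = reduce_mod \<Lambda> y \<longleftrightarrow> x - y \<in> \<Lambda>"
proof
  assume "reduce_mod \<Lambda> x = reduce_mod \<Lambda> y"
  moreover have "x \<in> reduce_mod \<Lambda> x" using subring_zero by (force simp: reduce_mod_eq)
  ultimately obtain h where "h \<in> \<Lambda>" "x = h + y" by (auto simp: reduce_mod_eq)
  then show "x - y \<in> \<Lambda>" by simp
next
  have *: "reduce_mod \<Lambda> x \<subseteq> reduce_mod \<Lambda> y" if "x - y \<in> \<Lambda>" for x y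
  proof
    fix r assume "r \<in> reduce_mod \<Lambda> x"
    then obtain h where h: "h \<in> \<Lambda>" "r = h + x" by (auto simp: reduce_mod_eq)
    have "r = (h + (x - y)) + y" using h(2) by simp
    then show "r \<in> reduce_mod \<Lambda> y" using subring_add[OF h(1) that] unfolding reduce_mod_eq by (rule image_eqI)
  qed
  assume "x - y \<in> \<Lambda>"
  then show "reduce_mod \<Lambda> x = reduce_mod \<Lambda> y" using *[of x y] *[of y x] subring_minus[of "x - y"] by simp
qed

lemma comm_group_reals_mod: "comm_group (reals_mod \<Lambda>)"
  unfolding reals_mod_def by (rule comm_group.abelian_FactGroup[OF comm_group_real_group subgroup_subring])

lemma reals_mod_simps:
  "carrier (reals_mod \<Lambda>) = range (reduce_mod \<Lambda>)"
  "reduce_mod \<Lambda> x \<otimes>\<^bsub>reals_mod \<Lambda>\<^esub> reduce_mod \<Lambda> y = reduce_mod \<Lambda> (x + y)"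
  "\<one>\<^bsub>reals_mod \<Lambda>\<^esub> = reduce_mod \<Lambda> 0"
proof -
  have nrm: "\<Lambda> \<lhd> real_group"
    using comm_group.normal_iff_subgroup[OF comm_group_real_group] subgroup_subring by blast
  show "carrier (reals_mod \<Lambda>) = range (reduce_mod \<Lambda>)"
    by (auto simp: reals_mod_def carrier_FactGroup reduce_mod_def)
  show "reduce_mod \<Lambda> x \<otimes>\<^bsub>reals_mod \<Lambda>\<^esub> reduce_mod \<Lambda> y = reduce_mod \<Lambda> (x + y)"
    using hom_mult[OF normal.r_coset_hom_Mod[OF nrm], of x y] by (simp add: reduce_mod_def reals_mod_def)
  show "\<one>\<^bsub>reals_mod \<Lambda>\<^esub> = reduce_mod \<Lambda> 0" by (simp add: reals_mod_def reduce_mod_eq)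
qed

lemma Cyc_add: "z \<in> Cyc k \<Longrightarrow> z' \<in> Cyc k \<Longrightarrow> z + z' \<in> Cyc k"
  by (simp add: Cyc_iff Ch_add bd_add)

lemma rel_cycles_mult [simp]: "x \<otimes>\<^bsub>rel_cycles A M \<rho> k\<^esub> y = x + y"
  using rel_chains_simps(1)[where x = x and y = y and k = k] by (simp add: rel_cycles_def)

lemma comm_group_rel_cycles: "comm_group (rel_cycles A M \<rho> k)"
proof -
  have "bd k \<in> hom (rel_chains A M k) (rel_chains A M (k - 1))"
    by (rule homI) (use bd_in_Ch bd_add in \<open>auto simp del: split_paired_All\<close>)
  then have "group_hom (rel_chains A M k) (rel_chains A M (k - 1)) (bd k)"
    by (intro group_hom.intro group_hom_axioms.intro comm_group.axioms(2)[OF comm_group_rel_chains])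
  then show ?thesis
    unfolding rel_cycles_def by (intro comm_group_restrict[OF comm_group_rel_chains] group_hom.subgroup_kernel)
qed

section \<open>Characters on cycles and the character map\<close>

abbreviation "Char_group k \<equiv> Hom_group (rel_cycles A M \<rho> k) (reals_mod \<Lambda>)"

lemma comm_group_Char_group: "comm_group (Char_group k)"
  by (rule comm_group_Hom_group[OF comm_group.axioms(2)[OF comm_group_rel_cycles] comm_group_reals_mod])

lemma Char_group_iff:
  "f \<in> carrier (Char_group k) \<longleftrightarrow> f \<in> extensional (Cyc k) \<and> (\<forall>z\<in>Cyc k. f z \<in> range (reduce_mod \<Lambda>)) \<and>
    (\<forall>z\<in>Cyc k. \<forall>z'\<in>Cyc k. f (z + z') = f z \<otimes>\<^bsub>reals_mod \<Lambda>\<^esub> f z')"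
  by (auto simp: Hom_group_def hom_def reals_mod_simps(1))

lemma diff_characters_iff:
  "f \<in> carrier (DChar k) \<longleftrightarrow> f \<in> carrier (Char_group (k - 1)) \<and>
    (\<exists>w\<in>carrier (RForms k). \<forall>x\<in>Ch k. f (bd k x) = reduce_mod \<Lambda> (intg k w x))"
  by (simp add: diff_characters_def)

lemma diff_characters_eq:
  "DChar k = (Char_group (k - 1))\<lparr>carrier := carrier (DChar k)\<rparr>"
  by (simp add: diff_characters_def)

lemma char_map_eq: "cmap k (c, h, w) = (\<lambda>z\<in>Cyc (k - 1). reduce_mod \<Lambda> (h z))"
  by (simp add: char_map_def)

text \<open>By the cocycle equation, \<open>h\<close> composed with the boundary is the integral of
  \<open>w\<close> up to \<open>c\<close>, and the values of \<open>c\<close> disappear modulo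
  \<Lambda>.\<close>

lemma char_map_in:
  assumes "y \<in> carrier (hatZ k)"
  shows "cmap k y \<in> carrier (DChar k)"
proof -
  obtain c h w where y: "y = (c, h, w)" by (cases y)
  have c: "additive_on (Ch k) \<Lambda> c" and h: "additive_on (Ch (k - 1)) UNIV h" and w: "w \<in> carrier (RForms k)"
    and e: "\<And>x. x \<in> Ch k \<Longrightarrow> intg k w x = c x + h (bd k x)"
    using assms by (auto simp: y hat_cocycles_iff hat_complex_iff rel_period_forms_iff)
  have "h (z + z') = h z + h z'" if "z \<in> Cyc (k - 1)" "z' \<in> Cyc (k - 1)" for z z'
    using additive_on_add(2)[OF h] that by (simp add: Cyc_iff)
  then have "cmap k y \<in> carrier (Char_group (k - 1))"
    unfolding y char_map_eq Char_group_iff by (auto simp: reals_mod_simps(2) Cyc_add)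
  moreover have "cmap k y (bd k x) = reduce_mod \<Lambda> (intg k w x)" if x: "x \<in> Ch k" for x
    using bd_in_Cyc[OF x] e[OF x] subring_minus[OF additive_onD(1)[OF c x x]]
    by (simp add: y char_map_eq reduce_mod_eq_iff)
  ultimately show ?thesis using w by (auto simp: diff_characters_iff)
qed

lemma char_map_mult:
  assumes "y \<in> carrier (hatZ k)" "y' \<in> carrier (hatZ k)"
  shows "cmap k (y \<otimes>\<^bsub>hatZ k\<^esub> y') =
    cmap k y \<otimes>\<^bsub>DChar k\<^esub> cmap k y'"
proof -
  obtain c h w c' h' w' where y: "y = (c, h, w)" "y' = (c', h', w')" by (cases y, cases y') auto
  have "y \<otimes>\<^bsub>hatZ k\<^esub> y' = ((\<lambda>x\<in>Ch k. c x + c' x), (\<lambda>x\<in>Ch (k - 1). h x + h' x), w \<otimes>\<^bsub>RForms k\<^esub> w')"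
    unfolding y by (simp add: hat_cocycles_def hat_complex_mult)
  then show ?thesis
    unfolding y char_map_eq diff_characters_def
    by (auto simp: char_map_eq Hom_group_def restrict_def fun_eq_iff reals_mod_simps(2) Cyc_iff)
qed

text \<open>The coordinates of \<open>kernel_retraction\<close> are the coefficients of the
  boundary, indexed by the simplices of \<open>M\<close> and of \<open>A\<close> together; finitely
  many are nonzero, and their common kernel is the group of cycles.\<close>

lemma cycle_retraction: "\<exists>\<pi>. additive_on (Ch k) (Cyc k) \<pi> \<and> (\<forall>z\<in>Cyc k. \<pi> z = z)"
proof -
  interpret int_scaling "\<lambda>m (a :: 'm chain, b :: 'a chain). (frag_cmul m a, frag_cmul m b)"
    by unfold_locales (auto simp: frag_cmul_diff_distrib)
  define D :: "((nat \<Rightarrow> real) \<Rightarrow> 'm) + ((nat \<Rightarrow> real) \<Rightarrow> 'a) \<Rightarrow> 'm chain \<times> 'a chain \<Rightarrow> int" where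
    "D i x = (case i of Inl s \<Rightarrow> Poly_Mapping.lookup (fst (bd k x)) s | Inr s \<Rightarrow> Poly_Mapping.lookup (snd (bd k x)) s)" for i x
  have add: "additive_on (Ch k) UNIV (D i)" for i
    unfolding additive_on_def
    by (intro conjI ballI Ch_diff) (simp_all add: D_def bd_diff lookup_minus split: sum.split)
  have fin: "finite {i. D i x \<noteq> 0}" for x
  proof (rule finite_subset)
    show "{i. D i x \<noteq> 0} \<subseteq> Inl ` Poly_Mapping.keys (fst (bd k x)) \<union> Inr ` Poly_Mapping.keys (snd (bd k x))"
    proof
      fix i assume "i \<in> {i. D i x \<noteq> 0}"
      then show "i \<in> Inl ` Poly_Mapping.keys (fst (bd k x)) \<union> Inr ` Poly_Mapping.keys (snd (bd k x))"
        by (cases i) (auto simp: D_def in_keys_iff)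
    qed
  qed simp
  have "{a \<in> Ch k. \<forall>i. D i a = 0} = Cyc k"
  proof -
    have "(\<forall>i. D i a = 0) \<longleftrightarrow> bd k a = 0" for a
    proof
      assume z: "\<forall>i. D i a = 0"
      have "fst (bd k a) = 0" by (rule poly_mapping_eqI) (use z[rule_format, of "Inl _"] in \<open>simp add: D_def\<close>)
      moreover have "snd (bd k a) = 0" by (rule poly_mapping_eqI) (use z[rule_format, of "Inr _"] in \<open>simp add: D_def\<close>)
      ultimately show "bd k a = 0" by (simp add: prod_eq_iff)
    qed (simp add: D_def split: sum.split)
    then show ?thesis by (auto simp: Cyc_iff)
  qed
  moreover have "\<exists>\<pi>. additive_on (Ch k) {a \<in> Ch k. \<forall>i. D i a = 0} \<pi> \<and> (\<forall>a\<in>{a \<in> Ch k. \<forall>i. D i a = 0}. \<pi> a = a)"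
    by (rule kernel_retraction[OF additive_on_Ch _ add fin]) (use Ch_zero in blast)
  ultimately show ?thesis by simp
qed

text \<open>Lifting along \<open>\<real> \<rightarrow> \<real>/\<Lambda>\<close>, by freeness of the chain groups.\<close>

lemma additive_lift:
  assumes u: "\<And>x y. x \<in> Ch k \<Longrightarrow> y \<in> Ch k \<Longrightarrow> u (x - y) - (u x - u y) \<in> \<Lambda>"
  shows "\<exists>h. additive_on (Ch k) UNIV h \<and> (\<forall>x\<in>Ch k. h x - u x \<in> \<Lambda>)"
proof -
  have univ: "\<exists>h\<in>hom (free_Abelian_group S) real_group. \<forall>s\<in>S. h (frag_of s) = r s" for S :: "'c set" and r
    using comm_group.free_Abelian_group_universal[OF comm_group_real_group, of r S] by (metis real_ring_simps(1) partial_object.select_convs(1) subset_UNIV)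
  let ?SM = "if k < 0 then {} else {s. smooth_simplex M (nat k) s}"
  let ?SA = "if k - 1 < 0 then {} else {s. smooth_simplex A (nat (k - 1)) s}"
  obtain h1 where h1: "h1 \<in> hom (smooth_chains M k) real_group" "\<forall>s\<in>?SM. h1 (frag_of s) = u (frag_of s, 0)"
    using univ[of ?SM "\<lambda>s. u (frag_of s, 0)"] unfolding smooth_chains_def by blast
  obtain h2 where h2: "h2 \<in> hom (smooth_chains A (k - 1)) real_group" "\<forall>s\<in>?SA. h2 (frag_of s) = u (0, frag_of s)"
    using univ[of ?SA "\<lambda>s. u (0, frag_of s)"] unfolding smooth_chains_def by blast
  have a1: "h1 (a + b) = h1 a + h1 b" if "a \<in> carrier (smooth_chains M k)" "b \<in> carrier (smooth_chains M k)" for a b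
    using hom_mult[OF h1(1) that] by (simp add: smooth_chains_def)
  have a2: "h2 (a + b) = h2 a + h2 b" if "a \<in> carrier (smooth_chains A (k - 1))" "b \<in> carrier (smooth_chains A (k - 1))" for a b
    using hom_mult[OF h2(1) that] by (simp add: smooth_chains_def)
  define h where "h x = h1 (fst x) + h2 (snd x)" for x
  have hd: "h (x - y) = h x - h y" if "x \<in> Ch k" "y \<in> Ch k" for x y
  proof -
    obtain a b a' b' where xy: "x = (a, b)" "y = (a', b')" by (cases x, cases y)
    have "a - a' \<in> carrier (smooth_chains M k)" "a' \<in> carrier (smooth_chains M k)"
      "b - b' \<in> carrier (smooth_chains A (k - 1))" "b' \<in> carrier (smooth_chains A (k - 1))"
      using that Ch_diff[OF that] by (auto simp: xy Ch_iff)
    from a1[OF this(1,2)] a2[OF this(3,4)] show ?thesis by (simp add: h_def xy)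
  qed
  then have h: "additive_on (Ch k) UNIV h" by (auto simp: additive_on_def Ch_diff simp del: split_paired_All split_paired_Ball_Sigma)
  have z1: "h1 0 = 0" using a1[OF smooth_chains_zero smooth_chains_zero] by simp
  have z2: "h2 0 = 0" using a2[OF smooth_chains_zero smooth_chains_zero] by simp
  \<comment> \<open>Membership is carried through the induction because the hypothesis on
    \<open>u\<close> concerns chains only.\<close>
  have "x \<in> Ch k \<and> h x - u x \<in> \<Lambda>" if "x \<in> Ch k" for x
    using that
  proof (induction rule: Ch_induct)
    case (left s)
    then show ?case using h1(2) z2 by (simp add: h_def subring_zero Ch_iff smooth_chains_of smooth_chains_zero)
  next
    case (right s)
    then show ?case using h2(2) z1 by (simp add: h_def subring_zero Ch_iff smooth_chains_of smooth_chains_zero)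
  next
    case (diff a b)
    then have ab: "a \<in> Ch k" "h a - u a \<in> \<Lambda>" "b \<in> Ch k" "h b - u b \<in> \<Lambda>" by auto
    have "(h a - u a) - (h b - u b) - (u (a - b) - (u a - u b)) \<in> \<Lambda>"
      by (rule subring_diff[OF subring_diff[OF ab(2,4)] u[OF ab(1,3)]])
    moreover have "(h a - u a) - (h b - u b) - (u (a - b) - (u a - u b)) = h (a - b) - u (a - b)"
      using hd[OF ab(1,3)] by simp
    ultimately show ?case using Ch_diff[OF ab(1,3)] by simp
  next
    case zero
    have "h 0 = 0" by (simp add: h_def z1 z2)
    moreover have "u 0 \<in> \<Lambda>" using u[OF Ch_zero Ch_zero] by simp
    ultimately show ?case using subring_minus Ch_zero by simp
  qed
  then show ?thesis using h by blast
qed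

text \<open>The retraction extends the character to all chains, and freeness lifts the extension to
  a real cochain \<open>h\<close>. The form \<open>w\<close> of the character minus
  \<delta>\<open>h\<close> then takes values in \<Lambda> and is the required
  \<open>c\<close>.\<close>

lemma char_map_surj:
  assumes k: "1 \<le> k" and f: "f \<in> carrier (DChar k)"
  shows "f \<in> cmap k ` carrier (hatZ k)"
proof -
  obtain w where w: "w \<in> carrier (RForms k)" "\<And>x. x \<in> Ch k \<Longrightarrow> f (bd k x) = reduce_mod \<Lambda> (intg k w x)"
    using f unfolding diff_characters_iff by blast
  have fc: "f \<in> extensional (Cyc (k - 1))" "\<And>z. z \<in> Cyc (k - 1) \<Longrightarrow> f z \<in> range (reduce_mod \<Lambda>)"
    "\<And>z z'. z \<in> Cyc (k - 1) \<Longrightarrow> z' \<in> Cyc (k - 1) \<Longrightarrow> f (z + z') = f z \<otimes>\<^bsub>reals_mod \<Lambda>\<^esub> f z'"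
    using f unfolding diff_characters_iff Char_group_iff by blast+
  obtain \<pi> where \<pi>: "additive_on (Ch (k - 1)) (Cyc (k - 1)) \<pi>" "\<And>z. z \<in> Cyc (k - 1) \<Longrightarrow> \<pi> z = z"
    using cycle_retraction[of "k - 1"] by blast
  \<comment> \<open>Arbitrary real representatives: additive only modulo \<Lambda>, which is all
    that \<open>additive_lift\<close> asks for.\<close>
  define g where "g z = (SOME r. f z = reduce_mod \<Lambda> r)" for z
  have g: "f z = reduce_mod \<Lambda> (g z)" if "z \<in> Cyc (k - 1)" for z
  proof -
    have "\<exists>r. f z = reduce_mod \<Lambda> r" using fc(2)[OF that] by blast
    from someI_ex[OF this] show ?thesis unfolding g_def .
  qed
  have "g (\<pi> (x - y)) - (g (\<pi> x) - g (\<pi> y)) \<in> \<Lambda>" if xy: "x \<in> Ch (k - 1)" "y \<in> Ch (k - 1)" for x y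
  proof -
    note d = Ch_diff[OF xy]
    have p: "\<pi> x \<in> Cyc (k - 1)" "\<pi> y \<in> Cyc (k - 1)" "\<pi> (x - y) \<in> Cyc (k - 1)" "\<pi> x = \<pi> (x - y) + \<pi> y"
      using additive_onD(1)[OF \<pi>(1) xy(1) xy(1)] additive_onD(1)[OF \<pi>(1) xy(2) xy(2)]
        additive_onD(1)[OF \<pi>(1) d d] additive_onD(3)[OF \<pi>(1) xy] by simp_all
    have "reduce_mod \<Lambda> (g (\<pi> (x - y)) + g (\<pi> y)) = f (\<pi> (x - y) + \<pi> y)"
      using fc(3)[OF p(3,2)] g[OF p(3)] g[OF p(2)] by (simp add: reals_mod_simps(2))
    also have "\<dots> = reduce_mod \<Lambda> (g (\<pi> x))" using g[OF p(1)] p(4) by simp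
    finally show ?thesis unfolding reduce_mod_eq_iff by (simp add: algebra_simps)
  qed
  from additive_lift[of "k - 1" "\<lambda>x. g (\<pi> x)", OF this] obtain h where
    h: "additive_on (Ch (k - 1)) UNIV h" "\<And>x. x \<in> Ch (k - 1) \<Longrightarrow> h x - g (\<pi> x) \<in> \<Lambda>" by blast
  have h0: "h 0 = 0" by (rule additive_on_zero(2)[OF h(1) Ch_zero])
  \<comment> \<open>Dictated by the cocycle equation.\<close>
  define c where "c x = intg k w x - h (bd k x)" for x
  have hbd: "additive_on (Ch k) UNIV (\<lambda>x. h (bd k x))" using additive_on_bd[OF h(1)] by simp
  have c\<Lambda>: "c x \<in> \<Lambda>" if x: "x \<in> Ch k" for x
  proof -
    have "intg k w x - g (bd k x) \<in> \<Lambda>"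
      using trans[OF w(2)[OF x, symmetric] g[OF bd_in_Cyc[OF x]]] unfolding reduce_mod_eq_iff .
    moreover have "h (bd k x) - g (bd k x) \<in> \<Lambda>" using h(2)[OF bd_in_Ch[OF x]] \<pi>(2)[OF bd_in_Cyc[OF x]] by simp
    ultimately have "(intg k w x - g (bd k x)) - (h (bd k x) - g (bd k x)) \<in> \<Lambda>" by (rule subring_diff)
    then show ?thesis by (simp add: c_def)
  qed
  have c: "additive_on (Ch k) \<Lambda> c"
    unfolding additive_on_def
  proof (intro conjI ballI Ch_diff c\<Lambda>)
    fix x y assume "x \<in> Ch k" "y \<in> Ch k"
    then show "c (x - y) = c x - c y"
      using additive_onD(3)[OF hbd] by (simp add: c_def rel_integral_diff)
  qed
  \<comment> \<open>On a cycle the term with \<open>h\<close> drops out, so the periods of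
    \<open>w\<close> are values of \<open>c\<close>. This gives \<Lambda>-periods, and with them
    closedness of \<open>w\<close> and the cocycle condition for \<open>c\<close>.\<close>
  have cyc: "intg k w z = c z" if "z \<in> Cyc k" for z using that h0 by (simp add: c_def Cyc_iff)
  have wp: "w \<in> carrier (PForms k)"
    using w(1) cyc c\<Lambda> by (simp add: rel_period_forms_iff Cyc_iff)
  have bdc: "bd (k + 1) x \<in> Cyc k" if "x \<in> Ch (k + 1)" for x using bd_in_Cyc[OF that] by simp
  have cb: "c (bd (k + 1) x) = 0" if x: "x \<in> Ch (k + 1)" for x
  proof -
    have "intg k w (bd (k + 1) x) = 0"
    proof (rule integral_boundary_eq_zero[OF _ _ w(1) _ x])
      show "intg k w (bd (k + 1) y) \<in> \<Lambda>" if "y \<in> Ch (k + 1)" for y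
        using cyc[OF bdc[OF that]] c\<Lambda> bdc[OF that] by (simp add: Cyc_iff)
    qed (use k in auto)
    then show ?thesis using cyc[OF bdc[OF x]] by simp
  qed
  let ?y = "(restrict c (Ch k), restrict h (Ch (k - 1)), w)"
  have "?y \<in> carrier (hatC k)"
    using c h(1) wp by (simp add: hat_complex_iff additive_on_restrict)
  then have y: "?y \<in> carrier (hatZ k)"
    using cb bdc bd_in_Ch[of _ k] by (auto simp: hat_cocycles_iff Cyc_iff c_def)
  have "cmap k ?y = f"
  proof
    fix z
    show "cmap k ?y z = f z"
    proof (cases "z \<in> Cyc (k - 1)")
      case True
      then have zc: "z \<in> Ch (k - 1)" by (simp add: Cyc_iff)
      have "reduce_mod \<Lambda> (h z) = f z" using h(2)[OF zc] \<pi>(2)[OF True] g[OF True] by (simp add: reduce_mod_eq_iff)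
      then show ?thesis using True zc by (simp add: char_map_eq)
    next
      case False
      then show ?thesis using extensional_arb[OF fc(1) False] by (simp add: char_map_eq)
    qed
  qed
  then show ?thesis using y by force
qed

text \<open>All integrals of \<open>w\<close> are values of \<open>c\<close> plus values of
  \<open>h\<close> on boundaries, hence lie in \<Lambda>, so \<open>w\<close> is 0 and
  \<open>c\<close> is minus \<delta>\<open>h\<close>. What remains is to split \<open>h\<close> into
  a cochain with values in \<Lambda> and a real coboundary, up to sign.\<close>

lemma hat_coboundary_if_integral_on_cycles:
  assumes k: "1 \<le> k" "k = 1 \<Longrightarrow> topspace (mtop A) = {}" and y: "(c, h, w) \<in> carrier (hatZ k)"
    and int: "\<And>z. z \<in> Cyc (k - 1) \<Longrightarrow> h z \<in> \<Lambda>"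
  shows "(c, h, w) \<in> hatB k"
proof -
  have c: "additive_on (Ch k) \<Lambda> c" "c \<in> extensional (Ch k)"
    and h: "additive_on (Ch (k - 1)) UNIV h" "h \<in> extensional (Ch (k - 1))"
    and w: "w \<in> carrier (RForms k)"
    and e: "\<And>x. x \<in> Ch k \<Longrightarrow> intg k w x = c x + h (bd k x)"
    using y by (auto simp: hat_cocycles_iff hat_complex_iff rel_period_forms_iff)
  have w1: "w = \<one>\<^bsub>RForms k\<^esub>"
    unfolding one_rel_forms
  proof (rule rel_form_eq_zero[OF k w])
    fix x assume x: "x \<in> Ch k"
    show "intg k w x \<in> \<Lambda>"
      unfolding e[OF x] by (rule subring_add[OF additive_onD(1)[OF c(1) x x] int[OF bd_in_Cyc[OF x]]])
  qed
  have cx: "c x = - h (bd k x)" if "x \<in> Ch k" for x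
    using e[OF that] unfolding w1 rel_integral_form_zero by simp
  obtain \<pi> where \<pi>: "additive_on (Ch (k - 1)) (Cyc (k - 1)) \<pi>" "\<And>z. z \<in> Cyc (k - 1) \<Longrightarrow> \<pi> z = z"
    using cycle_retraction[of "k - 1"] by blast
  \<comment> \<open>The retraction spreads the \<Lambda>-values of \<open>h\<close> on cycles to all
    chains. Since boundaries are cycles, the coboundary of \<open>c'\<close> is still minus
    \<delta>\<open>h\<close>, that is \<open>c\<close>.\<close>
  define c' where "c' x = - h (\<pi> x)" for x
  have \<pi>c: "\<pi> x \<in> Cyc (k - 1)" "\<pi> x \<in> Ch (k - 1)" if "x \<in> Ch (k - 1)" for x
    using additive_onD(1)[OF \<pi>(1) that that] by (simp_all add: Cyc_iff)
  have c': "additive_on (Ch (k - 1)) \<Lambda> c'"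
    unfolding additive_on_def
  proof (intro conjI ballI Ch_diff)
    show "c' x \<in> \<Lambda>" if "x \<in> Ch (k - 1)" for x
      unfolding c'_def by (rule subring_minus[OF int[OF \<pi>c(1)[OF that]]])
    show "c' (x - y) = c' x - c' y" if "x \<in> Ch (k - 1)" "y \<in> Ch (k - 1)" for x y
      unfolding c'_def additive_onD(3)[OF \<pi>(1) that] additive_onD(3)[OF h(1) \<pi>c(2)[OF that(1)] \<pi>c(2)[OF that(2)]] by simp
  qed
  \<comment> \<open>The second component of the differential forces the coboundary of
    \<open>h'\<close> to be \<open>v\<close>. As \<open>v\<close> vanishes on cycles, it factors
    through the boundary.\<close>
  define v where "v x = - (h x + c' x)" for x
  have v: "v (x - y) = v x - v y" if "x \<in> Ch (k - 1)" "y \<in> Ch (k - 1)" for x y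
    unfolding v_def additive_onD(3)[OF h(1) that] additive_onD(3)[OF c' that] by simp
  have v0: "v z = 0" if "z \<in> Cyc (k - 1)" for z using \<pi>(2)[OF that] by (simp add: v_def c'_def)
  define H0 where "H0 = bd (k - 1) ` Ch (k - 1)"
  \<comment> \<open>The value on a boundary is that of \<open>v\<close> on any chain bounding it;
    two such chains differ by a cycle. Divisibility of the reals then extends \<open>f0\<close> from
    boundaries to all chains.\<close>
  define f0 where "f0 b = v (SOME x. x \<in> Ch (k - 1) \<and> bd (k - 1) x = b)" for b
  have f0: "f0 (bd (k - 1) x) = v x" if x: "x \<in> Ch (k - 1)" for x
  proof -
    define x' where "x' = (SOME x'. x' \<in> Ch (k - 1) \<and> bd (k - 1) x' = bd (k - 1) x)"
    have x': "x' \<in> Ch (k - 1) \<and> bd (k - 1) x' = bd (k - 1) x"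
      unfolding x'_def by (rule someI[of _ x]) (simp add: x)
    then have "x' - x \<in> Cyc (k - 1)" using x by (simp add: Cyc_iff Ch_diff bd_diff)
    then have "v x' - v x = 0" using v0 v[of x' x] x x' by simp
    then show ?thesis by (simp add: f0_def x'_def)
  qed
  have addH0: "additive_on H0 UNIV f0"
    unfolding additive_on_def
  proof (intro conjI ballI)
    fix a b assume "a \<in> H0" "b \<in> H0"
    then obtain x y where xy: "x \<in> Ch (k - 1)" "a = bd (k - 1) x" "y \<in> Ch (k - 1)" "b = bd (k - 1) y"
      unfolding H0_def by blast
    have d: "a - b = bd (k - 1) (x - y)" by (simp add: xy bd_diff)
    show "a - b \<in> H0" unfolding d H0_def by (intro imageI Ch_diff xy)
    show "f0 (a - b) = f0 a - f0 b"
      unfolding d f0[OF Ch_diff[OF xy(1,3)]] unfolding xy(2,4) f0[OF xy(1)] f0[OF xy(3)] by (rule v[OF xy(1,3)])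
  qed simp
  interpret int_scaling "\<lambda>m (a :: 'm chain, b :: 'a chain). (frag_cmul m a, frag_cmul m b)"
    by unfold_locales (auto simp: frag_cmul_diff_distrib)
  have "H0 \<subseteq> Ch (k - 1 - 1)" unfolding H0_def using bd_in_Ch by blast
  moreover have "H0 \<noteq> {}" unfolding H0_def using Ch_zero by blast
  ultimately obtain h' where h': "additive_on (Ch (k - 1 - 1)) UNIV h'" "\<And>a. a \<in> H0 \<Longrightarrow> h' a = f0 a"
    using additive_extension_real[OF additive_on_Ch _ _ addH0] by blast
  let ?x = "(restrict c' (Ch (k - 1)), restrict h' (Ch (k - 1 - 1)), \<one>\<^bsub>RForms (k - 1)\<^esub>)"
  have x: "?x \<in> carrier (hatC (k - 1))"
    using c' h'(1) subgroup.one_closed[OF subgroup_rel_period_forms]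
    by (simp add: hat_complex_iff additive_on_restrict)
  have "hatD (k - 1) ?x = (c, h, w)"
  proof -
    have "restrict c' (Ch (k - 1)) (bd k x) = c x" if "x \<in> Ch k" for x
      using bd_in_Ch[OF that] cx[OF that] \<pi>(2)[OF bd_in_Cyc[OF that]] by (simp add: c'_def)
    then have 1: "(\<lambda>x\<in>Ch k. restrict c' (Ch (k - 1)) (bd k x)) = c"
      using c(2) by (intro extensionalityI[of _ "Ch k"]) simp_all
    have "intg (k - 1) \<one>\<^bsub>RForms (k - 1)\<^esub> x - restrict c' (Ch (k - 1)) x -
        restrict h' (Ch (k - 1 - 1)) (bd (k - 1) x) = h x" if "x \<in> Ch (k - 1)" for x
    proof -
      have "h' (bd (k - 1) x) = v x" using h'(2)[of "bd (k - 1) x"] f0[OF that] that by (simp add: H0_def)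
      then show ?thesis using that bd_in_Ch[OF that] by (simp add: rel_integral_form_zero v_def)
    qed
    then have 2: "(\<lambda>x\<in>Ch (k - 1). intg (k - 1) \<one>\<^bsub>RForms (k - 1)\<^esub> x - restrict c' (Ch (k - 1)) x -
        restrict h' (Ch (k - 1 - 1)) (bd (k - 1) x)) = h"
      using h(2) by (intro extensionalityI[of _ "Ch (k - 1)"]) simp_all
    show ?thesis using hat_diff_eq[OF x] 1 2 w1 by simp
  qed
  then show ?thesis unfolding hat_coboundaries_def using x by (metis imageI)
qed

text \<open>On a cycle the coboundary term drops out; a period of \<open>w'\<close> and a value of
  \<open>c'\<close> remain, both in \<Lambda>.\<close>

lemma hat_coboundary_integral_on_cycles:
  assumes "(c, h, w) \<in> hatB k" "z \<in> Cyc (k - 1)"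
  shows "h z \<in> \<Lambda>"
proof -
  obtain c' h' w' where x: "(c', h', w') \<in> carrier (hatC (k - 1))"
    and e: "(c, h, w) = hatD (k - 1) (c', h', w')"
    using assms(1) by (auto simp: hat_coboundaries_def)
  have c': "additive_on (Ch (k - 1)) \<Lambda> c'" and h': "additive_on (Ch (k - 1 - 1)) UNIV h'"
    and w': "\<And>z. z \<in> Cyc (k - 1) \<Longrightarrow> intg (k - 1) w' z \<in> \<Lambda>"
    using x by (auto simp: hat_complex_iff rel_period_forms_iff)
  have z: "z \<in> Ch (k - 1)" "bd (k - 1) z = 0" using assms(2) by (auto simp: Cyc_iff)
  have "h z = intg (k - 1) w' z - c' z"
    using e unfolding hat_diff_eq[OF x] using z additive_on_zero(2)[OF h' Ch_zero] by simp
  then show ?thesis using subring_diff[OF w'[OF assms(2)] additive_onD(1)[OF c' z(1) z(1)]] by simp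
qed

section \<open>Kernel of the character map and the induced isomorphism\<close>

lemma char_map_kernel:
  assumes k: "1 \<le> k" "k = 1 \<Longrightarrow> topspace (mtop A) = {}"
  shows "kernel (hatZ k) (DChar k) (cmap k) = hatB k"
proof -
  have one: "\<one>\<^bsub>DChar k\<^esub> = (\<lambda>z\<in>Cyc (k - 1). reduce_mod \<Lambda> 0)"
    by (simp add: diff_characters_def Hom_group_def reals_mod_simps(3))
  have "cmap k (c, h, w) = \<one>\<^bsub>DChar k\<^esub> \<longleftrightarrow> (\<forall>z\<in>Cyc (k - 1). h z \<in> \<Lambda>)" for c h w
    unfolding one char_map_eq by (auto simp: fun_eq_iff restrict_def reduce_mod_eq_iff)
  then have iff: "(c, h, w) \<in> kernel (hatZ k) (DChar k) (cmap k) \<longleftrightarrow>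
      (c, h, w) \<in> hatB k" for c h w
    unfolding kernel_def mem_Collect_eq
    using hat_coboundary_if_integral_on_cycles[OF k] hat_coboundary_integral_on_cycles hat_coboundaries_subset[OF k]
    by blast
  show ?thesis
  proof (rule Set.set_eqI)
    fix y :: "('a, 'm) hat_cochain"
    obtain c h w where "y = (c, h, w)" by (cases y)
    then show "y \<in> kernel (hatZ k) (DChar k) (cmap k) \<longleftrightarrow>
        y \<in> hatB k"
      using iff by simp
  qed
qed

text \<open>The differential characters are the image of the character map inside the full character
  group, hence a subgroup; closure under the operations is inherited from the cocycles.\<close>

lemma group_diff_characters:
  assumes "1 \<le> k"
  shows "group (DChar k)"
proof -
  have "cmap k \<in> hom (hatZ k) (Char_group (k - 1))"
  proof (rule homI)
    show "cmap k y \<in> carrier (Char_group (k - 1))" if "y \<in> carrier (hatZ k)" for y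
      using char_map_in[OF that] by (simp add: diff_characters_iff)
    show "cmap k (y \<otimes>\<^bsub>hatZ k\<^esub> y') =
        cmap k y \<otimes>\<^bsub>Char_group (k - 1)\<^esub> cmap k y'"
      if "y \<in> carrier (hatZ k)" "y' \<in> carrier (hatZ k)" for y y'
      using char_map_mult[OF that] by (simp add: diff_characters_def)
  qed
  then have "group_hom (hatZ k) (Char_group (k - 1)) (cmap k)"
    by (intro group_hom.intro group_hom_axioms.intro comm_group.axioms(2)[OF comm_group_hat_cocycles]
        comm_group.axioms(2)[OF comm_group_Char_group])
  then have "subgroup (cmap k ` carrier (hatZ k)) (Char_group (k - 1))"
    by (rule group_hom.img_is_subgroup)
  moreover have "cmap k ` carrier (hatZ k) = carrier (DChar k)"
    using char_map_surj[OF assms] char_map_in by blast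
  ultimately have "subgroup (carrier (DChar k)) (Char_group (k - 1))" by simp
  then show ?thesis
    by (subst diff_characters_eq) (rule subgroup.subgroup_is_group[OF _ comm_group.axioms(2)[OF comm_group_Char_group]])
qed

theorem char_map_induces_iso:
  assumes k: "1 \<le> k" "k = 1 \<Longrightarrow> topspace (mtop A) = {}"
  shows "hatB k \<lhd> hatZ k"
    and "cmap k \<in> hom (hatZ k) (DChar k)"
    and "\<exists>\<psi> \<in> iso (hatH k) (DChar k).
       \<forall>z \<in> carrier (hatZ k).
         \<psi> (hatB k #>\<^bsub>hatZ k\<^esub> z) = cmap k z"
proof -
  let ?G = "hatZ k" and ?H = "DChar k" and ?\<phi> = "cmap k"
  let ?N = "hatB k"
  show nrm: "?N \<lhd> ?G"
    using comm_group.normal_iff_subgroup[OF comm_group_hat_cocycles] subgroup_hat_coboundaries[OF k] by blast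
  show hom: "?\<phi> \<in> hom ?G ?H" by (rule homI) (auto intro: char_map_in char_map_mult)
  interpret \<phi>: group_hom ?G ?H ?\<phi>
    by (intro group_hom.intro group_hom_axioms.intro comm_group.axioms(2)[OF comm_group_hat_cocycles]
        group_diff_characters k hom)
  have "?\<phi> ` carrier ?G = carrier ?H" using char_map_surj[OF k(1)] char_map_in by blast
  then have iso: "(\<lambda>S. the_elem (?\<phi> ` S)) \<in> iso (hatH k) ?H"
    using \<phi>.FactGroup_iso_set by (simp only: char_map_kernel[OF k] hat_cohomology_def)
  \<comment> \<open>The isomorphism of the first isomorphism theorem sends a coset to the only
    element of its image; this computes it on representatives.\<close>
  have el: "the_elem (?\<phi> ` (?N #>\<^bsub>?G\<^esub> z)) = ?\<phi> z" if z: "z \<in> carrier ?G" for z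
  proof -
    have "?\<phi> y = ?\<phi> z" if y: "y \<in> ?N #>\<^bsub>?G\<^esub> z" for y
    proof -
      obtain n where n: "n \<in> ?N" "y = n \<otimes>\<^bsub>?G\<^esub> z" using y unfolding r_coset_def by blast
      from n(1) have "n \<in> kernel ?G ?H ?\<phi>" using char_map_kernel[OF k] by simp
      then have "n \<in> carrier ?G" "?\<phi> n = \<one>\<^bsub>?H\<^esub>" by (simp_all add: kernel_def)
      then show ?thesis using n(2) z by simp
    qed
    moreover have "z \<in> ?N #>\<^bsub>?G\<^esub> z" by (rule \<phi>.G.rcos_self[OF z normal_imp_subgroup[OF nrm]])
    ultimately have "?\<phi> ` (?N #>\<^bsub>?G\<^esub> z) = {?\<phi> z}" by blast
    then show ?thesis by simp
  qed
  show "\<exists>\<psi> \<in> iso (hatH k) ?H. \<forall>z \<in> carrier ?G. \<psi> (?N #>\<^bsub>?G\<^esub> z) = ?\<phi> z"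
    by (rule bexI[OF _ iso]) (intro ballI el)
qed

end

theorem theorem2p3:
  fixes A :: "'a mfd" and M :: "'m mfd" and \<rho> :: "'a \<Rightarrow> 'm"
    and \<Lambda> :: "real set" and k :: int
  assumes "smooth_manifold A" and "compact_space (mtop A)"
    and "smooth_manifold M" and "compact_space (mtop M)"
    and "smooth_map A M \<rho>"
    and "subring \<Lambda> real_ring" and "\<Lambda> \<noteq> UNIV"
    and "k \<ge> 1"
    and "k = 1 \<Longrightarrow> topspace (mtop A) = {}"
  shows "hat_coboundaries A M \<rho> \<Lambda> k \<lhd> hat_cocycles A M \<rho> \<Lambda> k \<and>
    char_map A M \<rho> \<Lambda> k \<in> hom (hat_cocycles A M \<rho> \<Lambda> k) (diff_characters A M \<rho> \<Lambda> k) \<and>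
    (\<exists>\<psi> \<in> iso (hat_cohomology A M \<rho> \<Lambda> k) (diff_characters A M \<rho> \<Lambda> k).
       \<forall>z \<in> carrier (hat_cocycles A M \<rho> \<Lambda> k).
         \<psi> (hat_coboundaries A M \<rho> \<Lambda> k #>\<^bsub>hat_cocycles A M \<rho> \<Lambda> k\<^esub> z) = char_map A M \<rho> \<Lambda> k z)"
proof -
  interpret rel_mfd A M \<rho> \<Lambda>
    by (intro rel_mfd.intro smooth_mfd.intro rel_mfd_axioms.intro assms)
  show ?thesis
    by (intro conjI char_map_induces_iso[OF assms(8,9)])
qed

end
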